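(* For a latin square $L$ on $\{1,\dots,9\}$, let $\sigma(L)$ be the number of sudoku partitions of $\{1,\dots,9\}$ with respect to which $L$ is a division sudoku, and for a ds-isotopism class $\mathcal C$ of standard division sudokus of rank $3$ (with respect to the standard sudoku partition) let $\sigma(\mathcal C)=\max\{\sigma(L):L\in\mathcal C\}$. Let $\mathcal C_{17}$, $\mathcal C_{175}$, $\mathcal C_{179}$ be the ds-isotopism classes of $DS(9,17)$, $DS(9,175)$, $DS(9,179)$, respectively. Then $\sigma(\mathcal C_{17})=4$, $\sigma(\mathcal C_{175})=3$, $\sigma(\mathcal C_{179})=4$, and $\sigma(\mathcal C)=1$ for each of the remaining ones among the $186$ ds-isotopism classes $\mathcal C$ of standard division sudokus of rank $3$.
   Context: A latin square on a finite set $X$ is an array $L=(L(x,y))_{x,y\in X}$ with entries in $X$ such that every row and every column contains all symbols. Its orthogonal array is $O(L)=\{(x,y,L(x,y)):x,y\in X\}$. A sudoku partition of $X=\{1,\dots,9\}$ is an (unordered) partition $\{X_1,X_2,X_3\}$ of $X$ into $3$ blocks of size $3$; the standard one is $\{\{1,2,3\},\{4,5,6\},\{7,8,9\}\}$. Relative to a sudoku partition, the bands, stacks and piles of $L$ are $B_i=\{(x,y,z)\in O(L):x\in X_i\}$, $S_i=\{(x,y,z)\in O(L):y\in X_i\}$, $P_i=\{(x,y,z)\in O(L):z\in X_i\}$. $L$ is a division sudoku with respect to the sudoku partition if for all $i,j$: every $z\in X$ occurs as a third coordinate in $B_i\cap S_j$, every $y\in X$ occurs as a second coordinate in $B_i\cap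 P_j$, and every $x\in X$ occurs as a first coordinate in $S_i\cap P_j$. A standard division sudoku of rank $3$ is a latin square on $\{1,\dots,9\}$ that is a division sudoku with respect to the standard partition. Two standard division sudokus $L_1,L_2$ of rank $3$ are ds-isotopic if there are permutations $\alpha,\beta,\gamma$ of $\{1,\dots,9\}$, each mapping every block of the standard partition to a block of the standard partition, with $L_2(\alpha(x),\beta(y))=\gamma(L_1(x,y))$ for all $x,y$. There are $186$ ds-isotopism classes. The squares named in the claim are (rows $1,\dots,9$ in order, each row written as a string of the entries in columns $1,\dots,9$): $DS(9,17)$: 147258369, 825936714, 693471582, 258369147, 936714825, 471582693, 369147258, 714825936, 582693471. $DS(9,175)$: 147259386, 825736419, 693481752, 259617834, 736842591, 481395267, 374168925, 518924673, 962573148. $DS(9,179)$: 147259386, 825736419, 693481752, 268194573, 934527168, 571863924, 386915247, 419672835, 752348691. *)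

theory Defs
  imports "HOL-Library.FuncSet" "HOL-Library.Disjoint_Sets" "HOL-Combinatorics.Permutations"
begin

text \<open>
  Arrays on \<open>X\<close> are extensional functions, so that two latin squares on \<open>X\<close> are equal as
  HOL functions if and only if they agree on \<open>X \<times> X\<close>.
\<close>

definition latin_square :: "'a set \<Rightarrow> ('a \<Rightarrow> 'a \<Rightarrow> 'a) \<Rightarrow> bool" where
  "latin_square X L \<longleftrightarrow>
     L \<in> X \<rightarrow>\<^sub>E (X \<rightarrow>\<^sub>E X) \<and>
     (\<forall>x\<in>X. (\<lambda>y. L x y) ` X = X) \<and>
     (\<forall>y\<in>X. (\<lambda>x. L x y) ` X = X)"

definition orthogonal_array :: "'a set \<Rightarrow> ('a \<Rightarrow> 'a \<Rightarrow> 'a) \<Rightarrow> ('a \<times> 'a \<times> 'a) set" where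
  "orthogonal_array X L = {(x, y, L x y) |x y. x \<in> X \<and> y \<in> X}"

definition sudoku_partition :: "nat set set \<Rightarrow> bool" where
  "sudoku_partition P \<longleftrightarrow> partition_on {1..9} P \<and> card P = 3 \<and> (\<forall>A\<in>P. card A = 3)"

definition standard_partition :: "nat set set" where
  "standard_partition = {{1, 2, 3}, {4, 5, 6}, {7, 8, 9}}"

definition band :: "'a set \<Rightarrow> ('a \<Rightarrow> 'a \<Rightarrow> 'a) \<Rightarrow> 'a set \<Rightarrow> ('a \<times> 'a \<times> 'a) set" where
  "band X L A = {(x, y, z). (x, y, z) \<in> orthogonal_array X L \<and> x \<in> A}"

definition stack :: "'a set \<Rightarrow> ('a \<Rightarrow> 'a \<Rightarrow> 'a) \<Rightarrow> 'a set \<Rightarrow> ('a \<times> 'a \<times> 'a) set" where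
  "stack X L A = {(x, y, z). (x, y, z) \<in> orthogonal_array X L \<and> y \<in> A}"

definition pile :: "'a set \<Rightarrow> ('a \<Rightarrow> 'a \<Rightarrow> 'a) \<Rightarrow> 'a set \<Rightarrow> ('a \<times> 'a \<times> 'a) set" where
  "pile X L A = {(x, y, z). (x, y, z) \<in> orthogonal_array X L \<and> z \<in> A}"

definition division_sudoku :: "nat set set \<Rightarrow> (nat \<Rightarrow> nat \<Rightarrow> nat) \<Rightarrow> bool" where
  "division_sudoku P L \<longleftrightarrow>
     sudoku_partition P \<and> latin_square {1..9} L \<and>
     (\<forall>A\<in>P. \<forall>B\<in>P.
        (\<forall>z\<in>{1..9}. \<exists>x y. (x, y, z) \<in> band {1..9} L A \<inter> stack {1..9} L B) \<and>
        (\<forall>y\<in>{1..9}. \<exists>x z. (x, y, z) \<in> band {1..9} L A \<inter> pile {1..9} L B) \<and>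
        (\<forall>x\<in>{1..9}. \<exists>y z. (x, y, z) \<in> stack {1..9} L A \<inter> pile {1..9} L B))"

definition standard_division_sudokus :: "(nat \<Rightarrow> nat \<Rightarrow> nat) set" where
  "standard_division_sudokus = {L. division_sudoku standard_partition L}"

definition block_permutation :: "(nat \<Rightarrow> nat) \<Rightarrow> bool" where
  "block_permutation \<alpha> \<longleftrightarrow>
     \<alpha> permutes {1..9} \<and> (\<forall>A\<in>standard_partition. \<alpha> ` A \<in> standard_partition)"

definition ds_isotopic :: "(nat \<Rightarrow> nat \<Rightarrow> nat) \<Rightarrow> (nat \<Rightarrow> nat \<Rightarrow> nat) \<Rightarrow> bool" where
  "ds_isotopic L\<^sub>1 L\<^sub>2 \<longleftrightarrow>
     (\<exists>\<alpha> \<beta> \<gamma>. block_permutation \<alpha> \<and> block_permutation \<beta> \<and> block_permutation \<gamma> \<and>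
        (\<forall>x\<in>{1..9}. \<forall>y\<in>{1..9}. L\<^sub>2 (\<alpha> x) (\<beta> y) = \<gamma> (L\<^sub>1 x y)))"

definition ds_isotopism :: "((nat \<Rightarrow> nat \<Rightarrow> nat) \<times> (nat \<Rightarrow> nat \<Rightarrow> nat)) set" where
  "ds_isotopism =
     {(L\<^sub>1, L\<^sub>2). L\<^sub>1 \<in> standard_division_sudokus \<and> L\<^sub>2 \<in> standard_division_sudokus \<and>
        ds_isotopic L\<^sub>1 L\<^sub>2}"

definition ds_isotopism_classes :: "(nat \<Rightarrow> nat \<Rightarrow> nat) set set" where
  "ds_isotopism_classes = standard_division_sudokus // ds_isotopism"

definition ds_class :: "(nat \<Rightarrow> nat \<Rightarrow> nat) \<Rightarrow> (nat \<Rightarrow> nat \<Rightarrow> nat) set" where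
  "ds_class L = ds_isotopism `` {L}"

definition sigma :: "(nat \<Rightarrow> nat \<Rightarrow> nat) \<Rightarrow> nat" where
  "sigma L = card {P. sudoku_partition P \<and> division_sudoku P L}"

text \<open>
  The maximum is over a nonempty finite set for every ds-isotopism class: there are only
  finitely many latin squares on \<open>{1..9}\<close>, as these are extensional.
\<close>

definition sigma_class :: "(nat \<Rightarrow> nat \<Rightarrow> nat) set \<Rightarrow> nat" where
  "sigma_class C = Max (sigma ` C)"

text \<open>Row and column labels start at 1, list positions at 0.\<close>

definition array_of_rows :: "nat list list \<Rightarrow> nat \<Rightarrow> nat \<Rightarrow> nat" where
  "array_of_rows rows = (\<lambda>x\<in>{1..9}. \<lambda>y\<in>{1..9}. rows ! (x - 1) ! (y - 1))"

definition DS_9_17 :: "nat \<Rightarrow> nat \<Rightarrow> nat" where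
  "DS_9_17 = array_of_rows
     [[1, 4, 7, 2, 5, 8, 3, 6, 9],
      [8, 2, 5, 9, 3, 6, 7, 1, 4],
      [6, 9, 3, 4, 7, 1, 5, 8, 2],
      [2, 5, 8, 3, 6, 9, 1, 4, 7],
      [9, 3, 6, 7, 1, 4, 8, 2, 5],
      [4, 7, 1, 5, 8, 2, 6, 9, 3],
      [3, 6, 9, 1, 4, 7, 2, 5, 8],
      [7, 1, 4, 8, 2, 5, 9, 3, 6],
      [5, 8, 2, 6, 9, 3, 4, 7, 1]]"

definition DS_9_175 :: "nat \<Rightarrow> nat \<Rightarrow> nat" where
  "DS_9_175 = array_of_rows
     [[1, 4, 7, 2, 5, 9, 3, 8, 6],
      [8, 2, 5, 7, 3, 6, 4, 1, 9],
      [6, 9, 3, 4, 8, 1, 7, 5, 2],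
      [2, 5, 9, 6, 1, 7, 8, 3, 4],
      [7, 3, 6, 8, 4, 2, 5, 9, 1],
      [4, 8, 1, 3, 9, 5, 2, 6, 7],
      [3, 7, 4, 1, 6, 8, 9, 2, 5],
      [5, 1, 8, 9, 2, 4, 6, 7, 3],
      [9, 6, 2, 5, 7, 3, 1, 4, 8]]"

definition DS_9_179 :: "nat \<Rightarrow> nat \<Rightarrow> nat" where
  "DS_9_179 = array_of_rows
     [[1, 4, 7, 2, 5, 9, 3, 8, 6],
      [8, 2, 5, 7, 3, 6, 4, 1, 9],
      [6, 9, 3, 4, 8, 1, 7, 5, 2],
      [2, 6, 8, 1, 9, 4, 5, 7, 3],
      [9, 3, 4, 5, 2, 7, 1, 6, 8],
      [5, 7, 1, 8, 6, 3, 9, 2, 4],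
      [3, 8, 6, 9, 1, 5, 2, 4, 7],
      [4, 1, 9, 6, 7, 2, 8, 3, 5],
      [7, 5, 2, 3, 4, 8, 6, 9, 1]]"

end

theory Submission
  imports Defs "HOL-Library.Product_Plus"
begin

text \<open>
  A latin square is a division sudoku with respect to a partition exactly when its set of 81
  triples \<open>(x, y, z)\<close> satisfies three bijectivity conditions, one for each pair of coordinates that
  is replaced by block numbers. Let \<open>L\<close> be a division sudoku with respect to two different
  partitions \<open>P\<close> and \<open>Q\<close>.

  First, \<open>P\<close> and \<open>Q\<close> are orthogonal: every block of \<open>P\<close> meets every block of \<open>Q\<close> in one point
  (\<open>distinct_division_partitions_orthogonal\<close>). Otherwise two blocks share exactly two points, up to
  the names of the nine points there are only three such pairs of partitions, and an exhaustive
  search finds no square for any of them. Consequently the blocks through a fixed point, one for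
  each partition, pairwise meet only in that point. Each of them uses up two of the other eight
  points, so there are at most four partitions (\<open>sigma_le_4\<close>).

  Secondly, orthogonality identifies the nine points with the plane over the field with three
  elements, \<open>P\<close> and \<open>Q\<close> being given by the two coordinates. Write \<open>(p, q)\<close>, \<open>(p', q')\<close>, \<open>(s, t)\<close> for
  a row, a column and a symbol. The 81 triples then form an orthogonal array of strength three in
  six ternary factors, in which, for fixed \<open>(p, p', s)\<close>, the three possible \<open>(q, q', t)\<close> are pairwise
  different in every coordinate. Such a set is a line of affine 3-space whose direction has no zero
  coordinate, and the heart of the proof is that this direction does not depend on \<open>(p, p', s)\<close>
  (\<open>slope_const\<close>). The same holds with the roles of the two groups of factors exchanged. After sign
  changes of the coordinates all directions are \<open>(1, 1, 1)\<close>, which says that the square is invariant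
  under all translations: it has the form \<open>L x y = x + \<theta> (y - x)\<close> with \<open>\<theta>\<close> and
  \<open>\<lambda>z. \<theta> z - z\<close> bijective (\<open>normal_form\<close>).

  Thirdly, there are only 148 such \<open>\<theta>\<close> with \<open>\<theta> 0 = 0\<close>, and for each of them an explicit isotopism onto
  one of the three squares of the claim is listed. Hence a standard division sudoku with a second
  partition lies in one of the three classes (\<open>two_partitions_isotopic\<close>), and in every other class
  \<open>\<sigma>\<close> is constantly 1.

  Finally, each of the three classes contains a square \<open>x + \<theta> (y - x)\<close> for which several of the four
  parallel classes of lines of the plane are division partitions: four, three and four of them,
  respectively. For the class of \<open>DS(9,175)\<close> four is impossible: pulled back to that square, the
  block through the first row of a nonstandard partition can be only one of two triples
  (\<open>sigma_175_le_3\<close>).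
\<close>

section \<open>The field with three elements\<close>

type_synonym f3 = Enum.finite_3
type_synonym pt = "f3 \<times> f3"

text \<open>
  The simplification rules for rings speak about 0 and 1, so these must not be unfolded to constructors.
\<close>

declare zero_finite_3_def [simp del] one_finite_3_def [simp del] two_finite_3 [simp del]

lemmas f3_table = zero_finite_3_def one_finite_3_def two_finite_3 plus_finite_3_def
  uminus_finite_3_def minus_finite_3_def times_finite_3_def

lemma f3_cases: "x = 0 \<or> x = 1 \<or> x = -1" for x :: f3
  by (cases x) (auto simp: f3_table)

lemma f3_neq [simp]: "(0::f3) \<noteq> 1" "(1::f3) \<noteq> 0" "(0::f3) \<noteq> -1" "(-1::f3) \<noteq> 0" "(1::f3) \<noteq> -1"
    "(-1::f3) \<noteq> 1"
  by (auto simp: f3_table)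

lemma f3_three: "x + x + x = (0::f3)" "(3::f3) = 0"
proof -
  show "x + x + x = (0::f3)" by (cases x) (auto simp: f3_table)
  have "(3::f3) = 2 + 1" by simp
  thus "(3::f3) = 0" by (simp only: f3_table) simp
qed

lemma f3_sum_distinct: "x \<noteq> y \<Longrightarrow> y \<noteq> z \<Longrightarrow> x \<noteq> z \<Longrightarrow> x + y + z = (0::f3)"
  by (cases x; cases y; cases z) (auto simp: f3_table)

definition is_sign :: "f3 \<Rightarrow> bool" where "is_sign m \<longleftrightarrow> m = 1 \<or> m = -1"

lemma is_sign_iff: "x \<noteq> 0 \<longleftrightarrow> is_sign x" for x :: f3
  using f3_cases[of x] by (auto simp: is_sign_def)

lemma f3_signs_sum: "is_sign x \<Longrightarrow> is_sign y \<Longrightarrow> is_sign z \<Longrightarrow> x + y + z = 0 \<Longrightarrow> x = y \<and> y = z"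
  unfolding is_sign_def by (cases x; cases y; cases z) (auto simp: f3_table)

text \<open>
  The six permutations of three elements are the six invertible affine maps of the field.
\<close>

lemma f3_inj_affine:
  fixes f :: "f3 \<Rightarrow> f3"
  assumes "inj f"
  shows "\<exists>m. is_sign m \<and> (\<forall>x. f x = f 0 + m * x)"
proof -
  have "f 0 \<noteq> f 1" "f 0 \<noteq> f (-1)" "f 1 \<noteq> f (-1)"
    using assms f3_neq by (metis injD)+
  hence "\<exists>m. is_sign m \<and> f 1 = f 0 + m \<and> f (-1) = f 0 - m"
    unfolding is_sign_def by (intro exI[of _ "f 1 - f 0"]) (cases "f 0"; cases "f 1"; cases "f
        (-1)"; simp add: f3_table)
  then obtain m where m: "is_sign m" "f 1 = f 0 + m" "f (-1) = f 0 - m" by blast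
  have "f x = f 0 + m * x" for x
    using f3_cases[of x] m(2,3) by (elim disjE) simp_all
  hence "\<forall>x. f x = f 0 + m * x" ..
  from conjI[OF m(1) this] show ?thesis ..
qed

section \<open>Labelling a square by the points of a plane\<close>

definition f3s :: "f3 list" where "f3s = [0, 1, 2]"

definition points :: "pt list" where "points = List.product f3s f3s"

definition f3_nat :: "f3 \<Rightarrow> nat" where "f3_nat i = (if i = 0 then 0 else if i = 1 then 1 else 2)"

text \<open>
  A list of length nine stands for a function on the plane, listed line by line.
\<close>

fun entry :: "'a list \<Rightarrow> pt \<Rightarrow> 'a" where "entry xs (i, j) = xs ! (3 * f3_nat i + f3_nat j)"

lemma set_f3s: "set f3s = UNIV"
  by (auto simp: f3s_def f3_table UNIV_finite_3)

lemma UNIV_f3: "(UNIV :: f3 set) = {0, 1, 2}"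
  using set_f3s by (simp add: f3s_def)

lemma set_points: "set points = UNIV"
  by (simp add: points_def set_f3s)

lemma f3_two_neq [simp]: "(2::f3) \<noteq> 0" "(2::f3) \<noteq> 1" "(0::f3) \<noteq> 2" "(1::f3) \<noteq> 2"
  by (auto simp: f3_table)

lemma f3_nat_simps [simp]: "f3_nat 0 = 0" "f3_nat 1 = 1" "f3_nat 2 = 2"
  by (auto simp: f3_nat_def)

lemma points_eq: "points = [(0,0),(0,1),(0,2),(1,0),(1,1),(1,2),(2,0),(2,1),(2,2)]"
  by (simp add: points_def f3s_def)

lemma UNIV_pt: "(UNIV :: pt set) = {(0,0),(0,1),(0,2),(1,0),(1,1),(1,2),(2,0),(2,1),(2,2)}"
  using set_points by (simp add: points_eq)

lemma entry_simps:
  "entry [x0,x1,x2,x3,x4,x5,x6,x7,x8] (0,0) = x0" "entry [x0,x1,x2,x3,x4,x5,x6,x7,x8] (0,1) = x1"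
  "entry [x0,x1,x2,x3,x4,x5,x6,x7,x8] (0,2) = x2" "entry [x0,x1,x2,x3,x4,x5,x6,x7,x8] (1,0) = x3"
  "entry [x0,x1,x2,x3,x4,x5,x6,x7,x8] (1,1) = x4" "entry [x0,x1,x2,x3,x4,x5,x6,x7,x8] (1,2) = x5"
  "entry [x0,x1,x2,x3,x4,x5,x6,x7,x8] (2,0) = x6" "entry [x0,x1,x2,x3,x4,x5,x6,x7,x8] (2,1) = x7"
  "entry [x0,x1,x2,x3,x4,x5,x6,x7,x8] (2,2) = x8"
  by (simp_all add: numeral_eq_Suc)

definition classes :: "(pt \<Rightarrow> nat) \<Rightarrow> (pt \<Rightarrow> f3) \<Rightarrow> nat set set" where
  "classes lam \<kappa> = range (\<lambda>c. lam ` (\<kappa> -` {c}))"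

definition triples :: "(pt \<Rightarrow> nat) \<Rightarrow> (nat \<Rightarrow> nat \<Rightarrow> nat) \<Rightarrow> (pt \<times> pt \<times> pt) set" where
  "triples lam L = {(i, j, k). L (lam i) (lam j) = lam k}"

definition latin_triples :: "(pt \<times> pt \<times> pt) set \<Rightarrow> bool" where
  "latin_triples T \<longleftrightarrow> bij_betw (\<lambda>(x, y, z). (x, y)) T UNIV \<and> bij_betw (\<lambda>(x, y, z). (x, z)) T UNIV \<and>
     bij_betw (\<lambda>(x, y, z). (y, z)) T UNIV"

text \<open>
  Here \<open>\<kappa>\<close> assigns to every point the number of its block. The three conditions say that in a
  division sudoku a band and a stack, a band and a pile, or a stack and a pile determine together
  with one value of the remaining coordinate a unique cell.
\<close>

definition divided_by :: "(pt \<Rightarrow> f3) \<Rightarrow> (pt \<times> pt \<times> pt) set \<Rightarrow> bool" where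
  "divided_by \<kappa> T \<longleftrightarrow> bij_betw (\<lambda>(x, y, z). (\<kappa> x, \<kappa> y, z)) T UNIV \<and>
      bij_betw (\<lambda>(x, y, z). (\<kappa> x, y, \<kappa> z)) T UNIV \<and>
     bij_betw (\<lambda>(x, y, z). (x, \<kappa> y, \<kappa> z)) T UNIV"

lemma card_f3: "card (UNIV :: f3 set) = 3" by (simp add: UNIV_f3)

lemma card_pairs: "card (UNIV :: ('a \<times> 'b) set) = card (UNIV :: 'a set) * card (UNIV :: 'b set)"
  by (metis UNIV_Times_UNIV card_cartesian_product)

lemma bij_betw_UNIV_if_card:
  assumes "finite T" "card T = card (UNIV :: 'b set)" "\<And>u :: 'b. \<exists>t\<in>T. f t = u"
  shows "bij_betw f T (UNIV :: 'b set)"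
proof -
  have "f ` T = UNIV" using assms(3) by (auto simp: image_iff) metis
  thus ?thesis using assms by (auto simp: bij_betw_def intro!: eq_card_imp_inj_on)
qed

text \<open>
  The definition of a division sudoku only asserts existence. As there are 81 triples and each of
  the six maps has a target with 81 elements, surjectivity gives uniqueness.
\<close>

lemma triples_latin_divided:
  assumes lam: "bij_betw lam UNIV {1..9}" and L: "division_sudoku (classes lam \<kappa>) L"
  shows "latin_triples (triples lam L) \<and> divided_by \<kappa> (triples lam L)"
proof -
  let ?T = "triples lam L"
  have inj: "lam i = lam j \<longleftrightarrow> i = j" for i j using lam by (metis UNIV_I bij_betw_def inj_onD)
  have rng: "lam i \<in> {1..9}" for i using lam by (metis UNIV_I bij_betwE)
  have ex: "\<exists>i. lam i = n" if "n \<in> {1..9}" for n using lam that by (metis bij_betw_def imageE)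
  have lat: "latin_square {1..9} L" using L by (simp add: division_sudoku_def)
  hence Lr: "L x y \<in> {1..9}" if "x \<in> {1..9}" "y \<in> {1..9}" for x y
    using that by (auto simp: latin_square_def PiE_iff)
  have 1: "bij_betw (\<lambda>(x, y, z). (x, y)) ?T UNIV"
  proof (rule bij_betwI')
    fix t u assume "t \<in> ?T" "u \<in> ?T"
    thus "((case t of (x, y, z) \<Rightarrow> (x, y)) = (case u of (x, y, z) \<Rightarrow> (x, y))) = (t = u)"
      by (cases t; cases u) (auto simp: triples_def inj)
  next
    fix v :: "pt \<times> pt" obtain x y where v: "v = (x, y)" by (cases v)
    obtain z where "lam z = L (lam x) (lam y)" using ex[OF Lr[OF rng rng]] by metis
    thus "\<exists>t\<in>?T. v = (case t of (x, y, z) \<Rightarrow> (x, y))"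
        by (intro bexI[of _ "(x, y, z)"]) (auto simp: triples_def v)
  qed simp
  have fin: "finite ?T" by (rule bij_betw_finite[THEN iffD2, OF 1]) simp
  have card: "card ?T = 81" using bij_betw_same_card[OF 1] by (simp add: card_f3 card_pairs)
  have blk: "\<exists>x y z. (x, y, z) \<in> ?T \<and> \<kappa> x = a \<and> \<kappa> y = b \<and> z = c"
            "\<exists>x y z. (x, y, z) \<in> ?T \<and> \<kappa> x = a \<and> y = c \<and> \<kappa> z = b"
            "\<exists>x y z. (x, y, z) \<in> ?T \<and> x = c \<and> \<kappa> y = a \<and> \<kappa> z = b" for a b c
  proof -
    let ?A = "lam ` (\<kappa> -` {a})" let ?B = "lam ` (\<kappa> -` {b})"
    have P: "?A \<in> classes lam \<kappa>" "?B \<in> classes lam \<kappa>" by (auto simp: classes_def)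
    note D = L[unfolded division_sudoku_def, THEN conjunct2, THEN conjunct2, rule_format, OF P]
    show "\<exists>x y z. (x, y, z) \<in> ?T \<and> \<kappa> x = a \<and> \<kappa> y = b \<and> z = c"
      using D[THEN conjunct1, rule_format, OF rng[of c]]
      by (auto simp: band_def stack_def orthogonal_array_def triples_def simp del: split_paired_Ex) metis
    show "\<exists>x y z. (x, y, z) \<in> ?T \<and> \<kappa> x = a \<and> y = c \<and> \<kappa> z = b"
      using D[THEN conjunct2, THEN conjunct1, rule_format, OF rng[of c]]
      by (auto simp: band_def pile_def orthogonal_array_def triples_def simp del: split_paired_Ex)
    show "\<exists>x y z. (x, y, z) \<in> ?T \<and> x = c \<and> \<kappa> y = a \<and> \<kappa> z = b"
      using D[THEN conjunct2, THEN conjunct2, rule_format, OF rng[of c]]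
      by (auto simp: stack_def pile_def orthogonal_array_def triples_def simp del: split_paired_Ex)
  qed
  have row: "\<exists>y. (x, y, z) \<in> ?T" and col: "\<exists>x'. (x', x, z) \<in> ?T" for x z
  proof -
    have "(\<lambda>y. L (lam x) y) ` {1..9} = {1..9}" "(\<lambda>y. L y (lam x)) ` {1..9} = {1..9}"
      using lat rng[of x] unfolding latin_square_def by blast+
    hence "lam z \<in> (\<lambda>y. L (lam x) y) ` {1..9}" "lam z \<in> (\<lambda>y. L y (lam x)) ` {1..9}"
      using rng[of z] by simp_all
    hence "\<exists>y. L (lam x) (lam y) = lam z" "\<exists>x'. L (lam x') (lam x) = lam z" using ex by (metis imageE)+
    thus "\<exists>y. (x, y, z) \<in> ?T" "\<exists>x'. (x', x, z) \<in> ?T" by (simp_all add: triples_def)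
  qed
  show ?thesis
    unfolding latin_triples_def divided_by_def
  proof (intro conjI)
    show "bij_betw (\<lambda>(x, y, z). (x, y)) ?T UNIV" by (rule 1)
    show "bij_betw (\<lambda>(x, y, z). (x, z)) ?T UNIV"
      by (rule bij_betw_UNIV_if_card[OF fin]) (use row in \<open>force simp: card card_f3 card_pairs\<close>)+
    show "bij_betw (\<lambda>(x, y, z). (y, z)) ?T UNIV"
      by (rule bij_betw_UNIV_if_card[OF fin]) (use col in \<open>force simp: card card_f3 card_pairs\<close>)+
    show "bij_betw (\<lambda>(x, y, z). (\<kappa> x, \<kappa> y, z)) ?T UNIV"
      by (rule bij_betw_UNIV_if_card[OF fin]) (use blk(1) in \<open>force simp: card card_f3 card_pairs\<close>)+
    show "bij_betw (\<lambda>(x, y, z). (\<kappa> x, y, \<kappa> z)) ?T UNIV"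
      by (rule bij_betw_UNIV_if_card[OF fin]) (use blk(2) in \<open>force simp: card card_f3 card_pairs\<close>)+
    show "bij_betw (\<lambda>(x, y, z). (x, \<kappa> y, \<kappa> z)) ?T UNIV"
      by (rule bij_betw_UNIV_if_card[OF fin]) (use blk(3) in \<open>force simp: card card_f3 card_pairs\<close>)+
  qed
qed

lemma bij_betw_UNIVD:
  assumes "bij_betw f T UNIV"
  shows "\<exists>t\<in>T. f t = u" "t \<in> T \<Longrightarrow> t' \<in> T \<Longrightarrow> f t = f t' \<Longrightarrow> t = t'"
  using assms by (auto simp: bij_betw_def inj_on_def image_iff set_eq_iff) metis

lemma latin_triplesD:
  assumes "latin_triples T"
  shows "\<exists>z. (x, y, z) \<in> T" "\<exists>y. (x, y, z) \<in> T" "\<exists>x. (x, y, z) \<in> T"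
    "(x, y, z) \<in> T \<Longrightarrow> (x, y, z') \<in> T \<Longrightarrow> z = z'"
    "(x, y, z) \<in> T \<Longrightarrow> (x, y', z) \<in> T \<Longrightarrow> y = y'"
    "(x, y, z) \<in> T \<Longrightarrow> (x', y, z) \<in> T \<Longrightarrow> x = x'"
proof -
  note b = assms[unfolded latin_triples_def]
  note b1 = b[THEN conjunct1] and b2 = b[THEN conjunct2, THEN conjunct1] and b3 =
      b[THEN conjunct2, THEN conjunct2]
  show "\<exists>z. (x, y, z) \<in> T" using bij_betw_UNIVD(1)[OF b1, of "(x, y)"]
      by (auto simp del: split_paired_Ex)
  show "\<exists>y. (x, y, z) \<in> T" using bij_betw_UNIVD(1)[OF b2, of "(x, z)"]
      by (auto simp del: split_paired_Ex)
  show "\<exists>x. (x, y, z) \<in> T" using bij_betw_UNIVD(1)[OF b3, of "(y, z)"]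
      by (auto simp del: split_paired_Ex)
  show "(x, y, z) \<in> T \<Longrightarrow> (x, y, z') \<in> T \<Longrightarrow> z = z'"
      using bij_betw_UNIVD(2)[OF b1, of "(x, y, z)" "(x, y, z')"] by simp
  show "(x, y, z) \<in> T \<Longrightarrow> (x, y', z) \<in> T \<Longrightarrow> y = y'"
      using bij_betw_UNIVD(2)[OF b2, of "(x, y, z)" "(x, y', z)"] by simp
  show "(x, y, z) \<in> T \<Longrightarrow> (x', y, z) \<in> T \<Longrightarrow> x = x'"
      using bij_betw_UNIVD(2)[OF b3, of "(x, y, z)" "(x', y, z)"] by simp
qed

lemma divided_byD:
  assumes "divided_by \<kappa> T"
  shows "\<exists>x y. (x, y, z) \<in> T \<and> \<kappa> x = a \<and> \<kappa> y = b" "\<exists>x z. (x, y, z) \<in> T \<and> \<kappa> x = a \<and> \<kappa> z = b"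
    "\<exists>y z. (x, y, z) \<in> T \<and> \<kappa> y = a \<and> \<kappa> z = b"
    "(x, y, z) \<in> T \<Longrightarrow> (x', y', z) \<in> T \<Longrightarrow> \<kappa> x = \<kappa> x' \<Longrightarrow> \<kappa> y = \<kappa> y' \<Longrightarrow> x = x' \<and> y = y'"
    "(x, y, z) \<in> T \<Longrightarrow> (x', y, z') \<in> T \<Longrightarrow> \<kappa> x = \<kappa> x' \<Longrightarrow> \<kappa> z = \<kappa> z' \<Longrightarrow> x = x' \<and> z = z'"
    "(x, y, z) \<in> T \<Longrightarrow> (x, y', z') \<in> T \<Longrightarrow> \<kappa> y = \<kappa> y' \<Longrightarrow> \<kappa> z = \<kappa> z' \<Longrightarrow> y = y' \<and> z = z'"
proof -
  note b = assms[unfolded divided_by_def]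
  note b1 = b[THEN conjunct1] and b2 = b[THEN conjunct2, THEN conjunct1] and b3 =
      b[THEN conjunct2, THEN conjunct2]
  show "\<exists>x y. (x, y, z) \<in> T \<and> \<kappa> x = a \<and> \<kappa> y = b" using bij_betw_UNIVD(1)[OF b1, of "(a, b, z)"]
      by (auto simp del: split_paired_Ex)
  show "\<exists>x z. (x, y, z) \<in> T \<and> \<kappa> x = a \<and> \<kappa> z = b" using bij_betw_UNIVD(1)[OF b2, of "(a, y, b)"]
      by (auto simp del: split_paired_Ex)
  show "\<exists>y z. (x, y, z) \<in> T \<and> \<kappa> y = a \<and> \<kappa> z = b" using bij_betw_UNIVD(1)[OF b3, of "(x, a, b)"]
      by (auto simp del: split_paired_Ex)
  show "(x, y, z) \<in> T \<Longrightarrow> (x', y', z) \<in> T \<Longrightarrow> \<kappa> x = \<kappa> x' \<Longrightarrow> \<kappa> y = \<kappa> y' \<Longrightarrow> x = x' \<and> y = y'"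
    using bij_betw_UNIVD(2)[OF b1, of "(x, y, z)" "(x', y', z)"] by simp
  show "(x, y, z) \<in> T \<Longrightarrow> (x', y, z') \<in> T \<Longrightarrow> \<kappa> x = \<kappa> x' \<Longrightarrow> \<kappa> z = \<kappa> z' \<Longrightarrow> x = x' \<and> z = z'"
    using bij_betw_UNIVD(2)[OF b2, of "(x, y, z)" "(x', y, z')"] by simp
  show "(x, y, z) \<in> T \<Longrightarrow> (x, y', z') \<in> T \<Longrightarrow> \<kappa> y = \<kappa> y' \<Longrightarrow> \<kappa> z = \<kappa> z' \<Longrightarrow> y = y' \<and> z = z'"
    using bij_betw_UNIVD(2)[OF b3, of "(x, y, z)" "(x, y', z')"] by simp
qed

section \<open>Common labellings of two sudoku partitions\<close>

lemma bij_betw_entry: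
  assumes "distinct [x0,x1,x2,x3,x4,x5,x6,x7,x8]" "set [x0,x1,x2,x3,x4,x5,x6,x7,x8] = X"
  shows "bij_betw (entry [x0,x1,x2,x3,x4,x5,x6,x7,x8]) UNIV X"
proof -
  have "entry [x0,x1,x2,x3,x4,x5,x6,x7,x8] ` UNIV = X"
    using assms(2) by (simp add: UNIV_pt entry_simps del: entry.simps)
  moreover have "card X = 9" using distinct_card[OF assms(1)] unfolding assms(2) by simp
  moreover have "card (UNIV :: pt set) = 9" by (simp add: card_pairs card_f3)
  ultimately show ?thesis by (auto simp: bij_betw_def intro!: eq_card_imp_inj_on)
qed

lemma classes_eq: "classes lam \<kappa> = {lam ` {z \<in> set points. \<kappa> z = 0}, lam ` {z \<in> set points. \<kappa> z =
    1}, lam ` {z \<in> set points. \<kappa> z = 2}}"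
proof -
  have "\<kappa> -` {c} = {z \<in> set points. \<kappa> z = c}" for c by (auto simp: set_points)
  thus ?thesis by (simp add: classes_def UNIV_f3)
qed

lemma collect_points: "{z \<in> set points. P z} = set (filter P points)" by simp

text \<open>
  Besides the two coordinates, the block functions listed here describe the three ways in which a
  second partition can contain a block that shares exactly two points with a block of the first
  partition: the two partitions have another block in common, or the table of their intersection
  numbers is the sum of twice a permutation matrix and another permutation matrix disjoint from it,
  or one block of the second partition meets all blocks of the first.
\<close>

lemma classes_fst: "classes (entry [x0,x1,x2,x3,x4,x5,x6,x7,x8]) fst =
    {{x0,x1,x2},{x3,x4,x5},{x6,x7,x8}}"
  and classes_snd: "classes (entry [x0,x1,x2,x3,x4,x5,x6,x7,x8]) snd =
      {{x0,x3,x6},{x1,x4,x7},{x2,x5,x8}}"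
  and classes_common_block: "classes (entry [x0,x1,x2,x3,x4,x5,x6,x7,x8]) (entry
      [0,0,1,0,1,1,2,2,2]) = {{x0,x1,x3},{x2,x4,x5},{x6,x7,x8}}"
  and classes_cyclic: "classes (entry [x0,x1,x2,x3,x4,x5,x6,x7,x8]) (entry [0,0,1,0,2,2,2,1,1]) =
      {{x0,x1,x3},{x2,x7,x8},{x4,x5,x6}}"
  and classes_one_transversal: "classes (entry [x0,x1,x2,x3,x4,x5,x6,x7,x8]) (entry
      [0,0,1,0,2,1,2,2,1]) = {{x0,x1,x3},{x2,x5,x8},{x4,x6,x7}}"
  unfolding classes_eq collect_points by (simp_all add: points_eq entry_simps del: entry.simps)

lemma sudoku_partition_blocks:
  assumes "sudoku_partition P" "A \<in> P" "B \<in> P" "A \<noteq> B"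
  obtains C where "P = {A, B, C}" "A \<inter> B = {}" "A \<inter> C = {}" "B \<inter> C = {}" "A \<union> B \<union> C = {1..9}"
      "card C = 3"
proof -
  have part: "partition_on {1..9} P" and P3: "card P = 3" and c: "\<And>X. X \<in> P \<Longrightarrow> card X = 3"
    using assms(1) by (auto simp: sudoku_partition_def)
  obtain C where P: "P = {A, B, C}" and ne: "C \<noteq> A" "C \<noteq> B"
  proof -
    have "finite P" using P3 by (metis card.infinite zero_neq_numeral)
    hence "card (P - {A, B}) = 1" using P3 assms by (simp add: card_Diff_subset)
    then obtain C where "P - {A, B} = {C}" by (auto simp: card_1_singleton_iff)
    thus thesis using assms by (intro that[of C]) auto
  qed
  have dj: "X \<inter> Y = {}" if "X \<in> P" "Y \<in> P" "X \<noteq> Y" for X Y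
    using partition_onD2[OF part] that by (auto simp: disjoint_def)
  show thesis
    by (rule that[of C, OF P]) (use dj P ne assms c partition_onD1[OF part] in auto)
qed

text \<open>
  Let \<open>A = {a, a', u}\<close> and \<open>A' = {a, a', x}\<close> be the two blocks, let \<open>{x, b, b'}\<close> be the block of \<open>P\<close>
  through \<open>x\<close>, and let \<open>W\<close> be the block of \<open>Q\<close> that contains neither \<open>x\<close> nor \<open>u\<close>. The three shapes
  correspond to \<open>W\<close> containing none, both or exactly one of the points \<open>b\<close>, \<open>b'\<close>.
\<close>

lemma common_pair_labels:
  assumes P: "sudoku_partition P" and Q: "sudoku_partition Q" and AB: "A \<in> P"
      "A' \<in> Q" and two: "card (A \<inter> A') = 2"
  shows "\<exists>x0 x1 x2 x3 x4 x5 x6 x7 x8. distinct [x0,x1,x2,x3,x4,x5,x6,x7,x8] \<and>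
      set [x0,x1,x2,x3,x4,x5,x6,x7,x8] = {1..9} \<and>
    P = {{x0,x1,x2},{x3,x4,x5},{x6,x7,x8}} \<and>
    (Q = {{x0,x1,x3},{x2,x4,x5},{x6,x7,x8}} \<or> Q = {{x0,x1,x3},{x2,x7,x8},{x4,x5,x6}} \<or>
        Q = {{x0,x1,x3},{x2,x5,x8},{x4,x6,x7}})"
proof -
  have cP: "card X = 3" "X \<subseteq> {1..9}" if "X \<in> P" for X using P that
      by (auto simp: sudoku_partition_def partition_on_def)
  have cQ: "card X = 3" "X \<subseteq> {1..9}" if "X \<in> Q" for X using Q that
      by (auto simp: sudoku_partition_def partition_on_def)
  have UP: "\<Union>P = {1..9}" and UQ: "\<Union>Q = {1..9}" using P Q
      by (auto simp: sudoku_partition_def partition_on_def)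
  have fin: "finite A" "finite A'" using cP(1)[OF AB(1)] cQ(1)[OF AB(2)]
      by (metis card.infinite zero_neq_numeral)+
  obtain a a' where aa: "A \<inter> A' = {a, a'}" "a \<noteq> a'" using two by (auto simp: card_2_iff)
  have "card (A - A') = 1" "card (A' - A) = 1"
    using card_Diff_subset_Int[of A A'] card_Diff_subset_Int[of A' A] fin two cP(1)[OF AB(1)]
        cQ(1)[OF AB(2)] by (simp_all add: Int_commute)
  then obtain u x where ux: "A - A' = {u}" "A' - A = {x}" by (auto simp: card_1_singleton_iff)
  have A: "A = {a, a', u}" "A' = {a, a', x}" using aa ux by auto
  have dis1: "distinct [a, a', u, x]" using aa ux by auto
  have "x \<in> {1..9}" "u \<in> {1..9}" using cQ(2)[OF AB(2)] cP(2)[OF AB(1)] A by auto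
  then obtain B U where BU: "B \<in> P" "x \<in> B" "U \<in> Q" "u \<in> U" using UP UQ by blast
  have "A \<noteq> B" "A' \<noteq> U" using BU A dis1 by auto
  obtain C where C: "P = {A, B, C}" "A \<inter> B = {}" "A \<inter> C = {}" "B \<inter> C = {}" "A \<union> B \<union> C = {1..9}"
      "card C = 3"
    using sudoku_partition_blocks[OF P AB(1) BU(1) \<open>A \<noteq> B\<close>] .
  obtain W where W: "Q = {A', U, W}" "A' \<inter> U = {}" "A' \<inter> W = {}" "U \<inter> W = {}" "A' \<union> U \<union> W = {1..9}"
      "card W = 3"
    using sudoku_partition_blocks[OF Q AB(2) BU(3) \<open>A' \<noteq> U\<close>] .
  have "card (B - {x}) = 2" using cP(1)[OF BU(1)] BU(2) by simp
  then obtain b b' where "B - {x} = {b, b'}" "b \<noteq> b'" by (auto simp: card_2_iff)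
  hence B: "B = {x, b, b'}" "distinct [x, b, b']" using BU(2) by auto
  have finC: "finite C" "finite W" using C(6) W(6) by (metis card.infinite zero_neq_numeral)+
  have U: "U = {1..9} - A' - W" using W(2,4,5) by blast
  have WBC: "W \<subseteq> {b, b'} \<union> C"
  proof
    fix y assume y: "y \<in> W"
    hence "y \<in> A \<union> B \<union> C" unfolding C(5) W(5)[symmetric] by blast
    moreover have "y \<notin> A'" "y \<noteq> u" using y W(3,4) BU(4) by blast+
    ultimately show "y \<in> {b, b'} \<union> C" unfolding A B(1) by blast
  qed
  have shape: ?thesis if dd': "d = b \<and> d' = b' \<or> d = b' \<and> d' = b" and dW: "d \<in> W" "d' \<notin> W" for d d'
  proof -
    have dd: "d \<noteq> d'" using dW by blast
    have B': "B = {x, d, d'}" "{b, b'} = {d, d'}" "distinct [x, d, d']" using dd' B by auto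
    have Wd: "W = insert d (W \<inter> C)" using WBC dW unfolding B'(2) by blast
    have dC: "d \<notin> W \<inter> C" using C(4) unfolding B'(1) by blast
    have "card (insert d (W \<inter> C)) = Suc (card (W \<inter> C))" using dC finC by simp
    hence "card (W \<inter> C) = 2" using W(6) unfolding Wd[symmetric] by simp
    then obtain c1 c2 where c: "W \<inter> C = {c1, c2}" "c1 \<noteq> c2" by (auto simp: card_2_iff)
    have "card (C - W) = 1" using card_Diff_subset_Int[of C W] finC c C(6) by (simp add: Int_commute)
    then obtain c3 where c3: "C - W = {c3}" by (auto simp: card_1_singleton_iff)
    have Ceq: "C = {c1, c2, c3}" using c(1) c3 by blast
    have Weq: "W = {d, c1, c2}" using Wd unfolding c(1) .
    note Beq = B'(1)
    have cdist: "c1 \<noteq> c3" "c2 \<noteq> c3" using c(1) c3 by blast+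
    have dis: "distinct [a, a', u, x, d, d', c1, c2, c3]"
      using dis1 dd c(2) cdist B'(3) C(2-4) unfolding Ceq Beq A by auto
    have all: "{1..9} = {a, a', u, x, d, d', c1, c2, c3}" using C(5) unfolding Ceq Beq A by auto
    have Ueq: "U = {u, d', c3}" unfolding U all A Weq using dis by auto
    show ?thesis
      by (rule exI[of _ a], rule exI[of _ a'], rule exI[of _ u], rule exI[of _ x],
          rule exI[of _ d], rule exI[of _ d'],
          rule exI[of _ c1], rule exI[of _ c2], rule exI[of _ c3])
        (use dis all in \<open>simp add: C(1) W(1) A Beq Ceq Weq Ueq insert_commute\<close>)
  qed
  consider "b \<in> W" "b' \<notin> W" | "b \<notin> W" "b' \<in> W" | "b \<notin> W" "b' \<notin> W" | "b \<in> W" "b' \<in> W" by blast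
  thus ?thesis
  proof cases
    case 1 thus ?thesis by (intro shape[of b b']) auto
  next
    case 2 thus ?thesis by (intro shape[of b' b]) auto
  next
    case 3
    hence "W \<subseteq> C" using WBC by blast
    hence WC: "W = C" using C(6) W(6) finC by (intro card_subset_eq) auto
    obtain c1 c2 c3 where Ceq: "C = {c1, c2, c3}" "c1 \<noteq> c2" "c2 \<noteq> c3" "c1 \<noteq> c3" using C(6)
        by (auto simp: card_3_iff)
    have dis: "distinct [a, a', u, x, b, b', c1, c2, c3]"
      using dis1 Ceq(2-4) B(2) C(2-4) unfolding Ceq(1) B(1) A by auto
    have all: "{1..9} = {a, a', u, x, b, b', c1, c2, c3}" using C(5) unfolding Ceq(1) B(1) A by auto
    have Ueq: "U = {u, b, b'}" unfolding U all A WC Ceq(1) using dis by auto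
    show ?thesis
      by (rule exI[of _ a], rule exI[of _ a'], rule exI[of _ u], rule exI[of _ x],
          rule exI[of _ b], rule exI[of _ b'],
          rule exI[of _ c1], rule exI[of _ c2], rule exI[of _ c3])
        (use dis all in \<open>simp add: C(1) W(1) A B(1) WC Ceq(1) Ueq insert_commute\<close>)
  next
    case 4
    have Wi: "W = insert b (insert b' (W \<inter> C))" using WBC 4 by blast
    have "b \<notin> W \<inter> C" "b' \<notin> W \<inter> C" using C(4) unfolding B(1) by blast+
    hence "card (insert b (insert b' (W \<inter> C))) = 2 + card (W \<inter> C)" using B(2) finC by simp
    hence "card (W \<inter> C) = 1" using W(6) unfolding Wi[symmetric] by simp
    then obtain c1 where c: "W \<inter> C = {c1}" by (auto simp: card_1_singleton_iff)
    have "card (C - W) = 2" using card_Diff_subset_Int[of C W] finC c C(6) by (simp add: Int_commute)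
    then obtain c2 c3 where c3: "C - W = {c2, c3}" "c2 \<noteq> c3" by (auto simp: card_2_iff)
    have Ceq: "C = {c1, c2, c3}" using c c3(1) by blast
    have Weq: "W = {b, b', c1}" using Wi unfolding c .
    have cdist: "c1 \<noteq> c3" "c1 \<noteq> c2" using c c3(1) by blast+
    have dis: "distinct [a, a', u, x, b, b', c1, c2, c3]"
      using dis1 B(2) c3(2) cdist C(2-4) unfolding Ceq B(1) A by auto
    have all: "{1..9} = {a, a', u, x, b, b', c1, c2, c3}" using C(5) unfolding Ceq B(1) A by auto
    have Ueq: "U = {u, c2, c3}" unfolding U all A Weq using dis by auto
    show ?thesis
      by (rule exI[of _ a], rule exI[of _ a'], rule exI[of _ u], rule exI[of _ x],
          rule exI[of _ b], rule exI[of _ b'],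
          rule exI[of _ c1], rule exI[of _ c2], rule exI[of _ c3])
        (use dis all in \<open>simp add: C(1) W(1) A B(1) Ceq Weq Ueq insert_commute\<close>)
  qed
qed

lemma card_partition_sum:
  assumes Q: "sudoku_partition Q" and A: "A \<subseteq> {1..9}"
  shows "(\<Sum>B\<in>Q. card (A \<inter> B)) = card A"
proof -
  have part: "partition_on {1..9} Q" "finite Q" using Q card.infinite
      by (force simp: sudoku_partition_def)+
  have "card (\<Union>B\<in>Q. A \<inter> B) = (\<Sum>B\<in>Q. card (A \<inter> B))"
  proof (rule card_UN_disjoint)
    have "B \<inter> B' = {}" if "B \<in> Q" "B' \<in> Q" "B \<noteq> B'" for B B'
      using partition_onD2[OF part(1)] that by (rule disjointD)
    thus "\<forall>B\<in>Q. \<forall>B'\<in>Q. B \<noteq> B' \<longrightarrow> A \<inter> B \<inter> (A \<inter> B') = {}" by blast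
  qed (use part(2) finite_subset[OF A] in auto)
  moreover have "(\<Union>B\<in>Q. A \<inter> B) = A" using part A by (auto simp: partition_on_def)
  ultimately show ?thesis by simp
qed

text \<open>
  If no intersection has two elements, then each row of the table of intersection numbers, having
  sum three, is constantly 1 or contains a 3. One entry 3 is a common block, and it forces every
  other row to contain a 3 as well, so that the partitions are equal.
\<close>

lemma orthogonal_if_no_common_pair:
  assumes P: "sudoku_partition P" and Q: "sudoku_partition Q" and ne: "P \<noteq> Q"
    and no2: "\<And>A B. A \<in> P \<Longrightarrow> B \<in> Q \<Longrightarrow> card (A \<inter> B) \<noteq> 2"
  shows "\<forall>A\<in>P. \<forall>B\<in>Q. card (A \<inter> B) = 1"
proof (rule ccontr)
  have cP: "card X = 3" "X \<subseteq> {1..9}" if "X \<in> P" for X using P that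
      by (auto simp: sudoku_partition_def partition_on_def)
  have cQ: "card X = 3" "X \<subseteq> {1..9}" if "X \<in> Q" for X using Q that
      by (auto simp: sudoku_partition_def partition_on_def)
  have fP: "finite X" if "X \<in> P" for X using cP(2)[OF that] finite_subset by blast
  have fQ: "finite X" if "X \<in> Q" for X using cQ(2)[OF that] finite_subset by blast
  have Q3: "card Q = 3" "finite Q" and P3: "card P = 3" using P Q card.infinite
      by (force simp: sudoku_partition_def)+
  have le: "card (A \<inter> B) \<le> 3" if "A \<in> P" "B \<in> Q" for A B
      using cP(1)[OF that(1)] card_mono[OF fP[OF that(1)], of "A \<inter> B"] by simp
  have eq3: "A = B" if "A \<in> P" "B \<in> Q" "card (A \<inter> B) = 3" for A B
    using that cP(1) cQ(1) fP fQ by (metis card_subset_eq inf_le1 inf_le2)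
  assume "\<not> (\<forall>A\<in>P. \<forall>B\<in>Q. card (A \<inter> B) = 1)"
  then obtain A B where AB: "A \<in> P" "B \<in> Q" "card (A \<inter> B) \<noteq> 1" by blast
  \<comment> \<open>A row of the intersection table that is not constantly one has an entry three.\<close>
  have three: "\<exists>B\<in>Q. card (A \<inter> B) = 3" if A: "A \<in> P" and ex: "\<exists>B\<in>Q. card (A \<inter> B) \<noteq> 1" for A
  proof (rule ccontr)
    assume "\<not> ?thesis"
    hence le1: "card (A \<inter> B) \<le> 1" if "B \<in> Q" for B
      using le[OF A that] no2[OF A that] that by force
    have "(\<Sum>B\<in>Q. card (A \<inter> B)) < (\<Sum>B\<in>Q. 1)"
      by (rule sum_strict_mono_ex1) (use Q3 le1 ex le_neq_implies_less in blast)+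
    thus False using card_partition_sum[OF Q cP(2)[OF A]] cP(1)[OF A] Q3 by simp
  qed
  then obtain B0 where B0: "B0 \<in> Q" "A = B0" using AB eq3 by metis
  have "A' \<in> Q" if A': "A' \<in> P" for A'
  proof (cases "A' = A")
    case False
    hence "A' \<inter> B0 = {}" using P A' AB(1) B0 by (auto simp: sudoku_partition_def partition_on_def
        disjoint_def)
    hence "\<exists>B\<in>Q. card (A' \<inter> B) \<noteq> 1" using B0(1) by (intro bexI[of _ B0]) simp_all
    thus ?thesis using three[OF A'] eq3[OF A'] by metis
  qed (use B0 in simp)
  hence "P \<subseteq> Q" by blast
  hence "P = Q" using Q3 P3 by (metis card_subset_eq)
  thus False using ne by simp
qed

lemma orthogonal_labels:
  assumes P: "sudoku_partition P" and Q: "sudoku_partition Q" and one: "\<forall>A\<in>P. \<forall>B\<in>Q. card (A \<inter> B) = 1"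
  shows "\<exists>x0 x1 x2 x3 x4 x5 x6 x7 x8. distinct [x0,x1,x2,x3,x4,x5,x6,x7,x8] \<and>
      set [x0,x1,x2,x3,x4,x5,x6,x7,x8] = {1..9} \<and>
    P = {{x0,x1,x2},{x3,x4,x5},{x6,x7,x8}} \<and> Q = {{x0,x3,x6},{x1,x4,x7},{x2,x5,x8}}"
proof -
  obtain A0 A1 A2 where A: "P = {A0, A1, A2}" "A0 \<noteq> A1" using P
      by (auto simp: sudoku_partition_def card_3_iff)
  obtain B0 B1 B2 where B: "Q = {B0, B1, B2}" "B0 \<noteq> B1" using Q
      by (auto simp: sudoku_partition_def card_3_iff)
  have AP: "A0 \<in> P" "A1 \<in> P" and BQ: "B0 \<in> Q" "B1 \<in> Q" using A B by simp_all
  obtain A2' where A': "P = {A0, A1, A2'}" "A0 \<inter> A1 = {}" "A0 \<inter> A2' = {}" "A1 \<inter> A2' = {}"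
      "A0 \<union> A1 \<union> A2' = {1..9}" "card A2' = 3"
    using sudoku_partition_blocks[OF P AP A(2)] .
  obtain B2' where B': "Q = {B0, B1, B2'}" "B0 \<inter> B1 = {}" "B0 \<inter> B2' = {}" "B1 \<inter> B2' = {}"
      "B0 \<union> B1 \<union> B2' = {1..9}" "card B2' = 3"
    using sudoku_partition_blocks[OF Q BQ B(2)] .
  define g where "g S R = the_elem (S \<inter> R)" for S R :: "nat set"
  have g: "S \<inter> R = {g S R}" if "S \<in> P" "R \<in> Q" for S R
  proof -
    have "card (S \<inter> R) = 1" using one that by blast
    then obtain v where "S \<inter> R = {v}" by (rule card_1_singletonE)
    thus ?thesis by (simp add: g_def)
  qed
  have mem: "A2' \<in> P" "B2' \<in> Q" using A'(1) B'(1) by simp_all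
  define x0 x1 x2 where xA0: "x0 = g A0 B0" "x1 = g A0 B1" "x2 = g A0 B2'"
  define x3 x4 x5 where xA1: "x3 = g A1 B0" "x4 = g A1 B1" "x5 = g A1 B2'"
  define x6 x7 x8 where xA2: "x6 = g A2' B0" "x7 = g A2' B1" "x8 = g A2' B2'"
  note x = g[OF AP(1) BQ(1)] g[OF AP(1) BQ(2)] g[OF AP(1) mem(2)] g[OF AP(2) BQ(1)] g[OF AP(2)
      BQ(2)] g[OF AP(2) mem(2)]
    g[OF mem(1) BQ(1)] g[OF mem(1) BQ(2)] g[OF mem(1) mem(2)]
  note x = x[folded xA0 xA1 xA2]
  have "A0 = (A0 \<inter> B0) \<union> (A0 \<inter> B1) \<union> (A0 \<inter> B2')" "A1 = (A1 \<inter> B0) \<union> (A1 \<inter> B1) \<union> (A1 \<inter> B2')"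
    "A2' = (A2' \<inter> B0) \<union> (A2' \<inter> B1) \<union> (A2' \<inter> B2')" using A'(5) B'(5) by blast+
  note a = this[unfolded x, unfolded Un_insert_left Un_empty_left]
  have "B0 = (A0 \<inter> B0) \<union> (A1 \<inter> B0) \<union> (A2' \<inter> B0)" "B1 = (A0 \<inter> B1) \<union> (A1 \<inter> B1) \<union> (A2' \<inter> B1)"
    "B2' = (A0 \<inter> B2') \<union> (A1 \<inter> B2') \<union> (A2' \<inter> B2')" using A'(5) B'(5) by blast+
  note b = this[unfolded x, unfolded Un_insert_left Un_empty_left]
  have "distinct [x0,x1,x2,x3,x4,x5,x6,x7,x8]" using A'(2-4) B'(2-4) unfolding a b by auto
  moreover have "set [x0,x1,x2,x3,x4,x5,x6,x7,x8] = {1..9}" using A'(5) unfolding a by auto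
  ultimately show ?thesis using A'(1) B'(1) unfolding a b by blast
qed

section \<open>Exhaustive search for a square with two partitions\<close>

definition pt_of_nat :: "nat \<Rightarrow> pt" where "pt_of_nat n = points ! n"

text \<open>
  Two different triples clash if a latin square that is a division sudoku with respect to both
  partitions cannot contain both of them.
\<close>

fun clash :: "(pt \<Rightarrow> f3) \<Rightarrow> pt\<times>pt\<times>pt \<Rightarrow> pt\<times>pt\<times>pt \<Rightarrow> bool" where
 "clash k (x,y,z) (x',y',z') = ((x,y,z) \<noteq> (x',y',z') \<and>
    (if x = x' then y = y' \<or> z = z' \<or> (fst y = fst y' \<and> fst z = fst z') \<or> (k y = k y' \<and> k z = k z')
     else if y = y' then z = z' \<or> (fst x = fst x' \<and> fst z = fst z') \<or> (k x = k x' \<and> k z = k z')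
     else z = z' \<and> (fst x = fst x' \<and> fst y = fst y' \<or> k x = k x' \<and> k y = k y')))"

text \<open>
  A search tree. The four numbers at a node name a condition that demands one triple from a list of
  nine, see \<open>candidates\<close>. The subtrees belong, in order, to those candidates that do not clash with
  the triples chosen on the way to the node. A node without subtrees is a dead end.
\<close>

datatype tree = Branch nat nat nat nat "tree list"

text \<open>
  The quotient \<open>n div 3\<close> selects latin square (0), first partition (1) or second partition (2). The
  remainder selects which coordinate is left free or, for a partition, is prescribed as a point while
  the other two only have prescribed block numbers.
\<close>

definition candidates :: "(pt \<Rightarrow> f3) \<Rightarrow> nat \<Rightarrow> nat \<Rightarrow> nat \<Rightarrow> nat \<Rightarrow> (pt\<times>pt\<times>pt) list" where
 "candidates k n a b c = map (\<lambda>(u,v,w). if n mod 3 = 0 then (u,v,w) else if n mod 3 =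
     1 then (u,w,v) else (w,u,v))
   (if n div 3 = 0 then map (\<lambda>w. (pt_of_nat a, pt_of_nat b, w)) points
    else let \<kappa> = (if n div 3 = 1 then fst else k) in
      map (\<lambda>(u,v). (u,v,pt_of_nat c))
        (List.product (filter (\<lambda>x. \<kappa> x = f3s ! a) points) (filter (\<lambda>x. \<kappa> x = f3s ! b) points)))"

text \<open>
  The triples in \<open>ch\<close> are the choices made so far.
\<close>

fun closes and closes_all where
 "closes k ch (Branch n a b c ts) = closes_all k ch (filter (\<lambda>t. list_all (\<lambda>t'. \<not> clash k t t') ch) (candidates k n a b c)) ts"
|"closes_all k ch [] ts = (ts = [])"
|"closes_all k ch (t#us) ts = (case ts of [] \<Rightarrow> False | r#rs \<Rightarrow> closes k (t#ch) r \<and> closes_all k ch us rs)"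

lemma no_clash:
  assumes L: "latin_triples T" and P: "divided_by fst T" and Q: "divided_by k T"
    and "t \<in> T" "t' \<in> T"
  shows "\<not> clash k t t'"
proof -
  obtain x y z x' y' z' where t: "t = (x, y, z)" "t' = (x', y', z')" by (cases t; cases t')
  show ?thesis
    using assms(4,5) latin_triplesD(4-6)[OF L, of x y z] divided_byD(4-6)[OF P,
        of x y z] divided_byD(4-6)[OF Q, of x y z]
    unfolding t clash.simps by (smt (verit, ccfv_threshold))
qed

lemma candidate_exists:
  assumes L: "latin_triples T" and P: "divided_by fst T" and Q: "divided_by k T"
  shows "\<exists>t\<in>set (candidates k n a b c). t \<in> T"
proof -
  define \<kappa> where "\<kappa> = (if n div 3 = 1 then fst else k)"
  have K: "divided_by \<kappa> T" using P Q by (simp add: \<kappa>_def)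
  consider "n mod 3 = 0" | "n mod 3 = 1" | "n mod 3 = 2" by linarith
  thus ?thesis
  proof cases
    case 1
    thus ?thesis using latin_triplesD(1)[OF L, of "pt_of_nat a"
        "pt_of_nat b"] divided_byD(1)[OF K, of "pt_of_nat c" "f3s ! a" "f3s ! b"]
      unfolding candidates_def \<kappa>_def[symmetric] Let_def by (force simp: set_points)
  next
    case 2
    thus ?thesis using latin_triplesD(2)[OF L, of "pt_of_nat a"
        "pt_of_nat b"] divided_byD(2)[OF K, of "pt_of_nat c" "f3s ! a" "f3s ! b"]
      unfolding candidates_def \<kappa>_def[symmetric] Let_def by (force simp: set_points)
  next
    case 3
    thus ?thesis using latin_triplesD(3)[OF L, of "pt_of_nat a"
        "pt_of_nat b"] divided_byD(3)[OF K, of "pt_of_nat c" "f3s ! a" "f3s ! b"]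
      unfolding candidates_def \<kappa>_def[symmetric] Let_def by (force simp: set_points)
  qed
qed

text \<open>
  A node demands a triple of the square among its candidates. Such a triple clashes with none of the
  choices made so far, so it survives the filter and the square continues into one of the subtrees;
  a finite tree cannot accommodate it.
\<close>

lemma closes_sound:
  assumes T: "latin_triples T" "divided_by fst T"
  shows "closes k ch r \<Longrightarrow> divided_by k T \<Longrightarrow> set ch \<subseteq> T \<Longrightarrow> False"
    and "closes_all k ch us rs \<Longrightarrow> divided_by k T \<Longrightarrow> set ch \<subseteq> T \<Longrightarrow> set us \<inter> T = {}"
proof (induction k ch r and k ch us rs rule: closes_closes_all.induct)
  case (1 k ch n a b c ts)
  obtain t where "t \<in> set (candidates k n a b c)" "t \<in> T" using candidate_exists[OF T 1(3)] by blast
  moreover from this no_clash[OF T 1(3)] 1(4) have "list_all (\<lambda>t'. \<not> clash k t t') ch"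
    unfolding list_all_iff by blast
  ultimately show ?case using 1 by auto
next
  case (3 k ch t us ts)
  thus ?case by (auto split: list.splits)
qed simp

definition tree_common_block :: tree where
  "tree_common_block =
    Branch 2 2 3 0 [Branch 3 0 0 5 [Branch 3 0 0 4 [Branch 6 0 0 4 [Branch 5 1 1 1 [],Branch 6 1 0 5 []]],
    Branch 4 0 1 0 [Branch 7 0 1 0 [Branch 5 0 0 1 [],Branch 7 1 1 1 []]],Branch 3 0 0 4 [Branch 7 0 1 0 [
    Branch 5 0 0 1 [],Branch 7 1 1 1 []]],Branch 4 0 1 0 [Branch 6 0 0 5 [Branch 5 1 1 1 [],Branch 6 1 0 4 []]]],
    Branch 4 0 1 0 [Branch 3 0 0 5 [Branch 6 0 0 5 [Branch 5 1 1 0 [],Branch 6 1 0 4 []]],Branch 3 0 0 4 [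
    Branch 6 0 0 4 [Branch 5 1 1 0 [],Branch 6 1 0 5 []]],Branch 5 0 1 0 [Branch 7 0 1 0 [Branch 5 0 0 0 [],
    Branch 7 1 1 1 []]],Branch 5 0 1 0 [Branch 7 0 1 0 [Branch 5 0 0 0 [],Branch 7 1 1 1 []]]],Branch 7 0 1 2 [
    Branch 8 0 0 0 [Branch 3 0 1 1 [Branch 5 0 0 1 [],Branch 5 0 0 1 []],Branch 3 0 1 0 [Branch 5 0 0 1 [],
    Branch 5 0 0 1 []],Branch 8 0 1 2 [Branch 6 0 0 2 [Branch 4 0 1 0 [],Branch 4 0 1 1 []]]],Branch 8 0 0 1 [
    Branch 5 0 0 0 [Branch 5 1 0 0 [],Branch 5 1 0 0 []],Branch 5 0 0 0 [Branch 3 0 1 0 [],Branch 3 0 1 0 []],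
    Branch 8 0 1 2 [Branch 6 0 0 2 [Branch 4 0 1 0 [],Branch 4 0 1 1 []]]],Branch 4 0 1 0 [Branch 3 0 0 5 [
    Branch 6 0 0 2 []],Branch 3 0 0 4 [Branch 6 0 0 2 []],Branch 5 0 1 0 [Branch 6 0 0 2 []],Branch 5 0 1 0 [
    Branch 6 0 0 2 []]],Branch 6 1 0 4 [Branch 6 0 0 3 [Branch 4 0 0 3 [Branch 3 0 0 2 [],Branch 3 0 0 2 []]],
    Branch 6 1 0 5 [Branch 3 1 1 5 [],Branch 3 1 1 5 []],Branch 6 1 0 5 [Branch 3 1 1 5 [],Branch 3 1 1 5 []]],
    Branch 6 1 0 5 [Branch 6 0 0 3 [Branch 4 0 0 3 [Branch 3 0 0 2 [],Branch 3 0 0 2 []]],Branch 6 1 0 4 [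
    Branch 3 1 1 4 [],Branch 3 1 1 4 []],Branch 6 1 0 4 [Branch 3 1 1 4 [],Branch 3 1 1 4 []]]],Branch 8 0 1 3 [
    Branch 7 1 0 0 [Branch 3 0 0 1 [Branch 7 1 0 1 [],Branch 7 1 0 1 []],Branch 3 0 0 0 [Branch 7 1 0 1 [],
    Branch 7 1 0 1 []],Branch 7 1 1 2 [Branch 6 0 0 3 [Branch 5 0 0 0 [],Branch 4 0 0 3 []]]],Branch 7 1 0 1 [
    Branch 4 0 0 0 [Branch 7 1 0 0 [],Branch 7 1 0 0 []],Branch 3 0 0 0 [Branch 7 1 0 0 [],Branch 7 1 0 0 []],
    Branch 7 1 1 2 [Branch 6 0 0 3 [Branch 5 0 0 0 [],Branch 4 0 0 3 []]]],Branch 7 0 1 0 [Branch 6 0 0 5 [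
    Branch 3 0 0 3 []],Branch 6 0 0 4 [Branch 3 0 0 3 []],Branch 8 0 1 0 [Branch 3 0 0 3 []],Branch 8 0 1 0 [
    Branch 3 0 0 3 []]],Branch 6 1 1 4 [Branch 6 1 0 3 [Branch 4 0 0 2 [Branch 6 0 0 2 [],Branch 6 0 0 2 []]],
    Branch 3 0 1 5 [Branch 6 1 1 5 [],Branch 6 1 1 5 []],Branch 3 0 1 5 [Branch 6 1 1 5 [],Branch 6 1 1 5 []]],
    Branch 6 1 1 5 [Branch 6 1 0 3 [Branch 4 0 0 2 [Branch 6 0 0 2 [],Branch 6 0 0 2 []]],Branch 3 0 1 4 [
    Branch 6 1 1 4 [],Branch 6 1 1 4 []],Branch 3 0 1 4 [Branch 6 1 1 4 [],Branch 6 1 1 4 []]]],Branch 7 1 0 4 [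
    Branch 6 1 1 1 [Branch 3 1 1 0 [Branch 3 0 1 1 [],Branch 8 0 0 5 []]],Branch 7 1 0 5 [Branch 3 1 1 1 [
    Branch 3 0 1 0 [],Branch 8 0 0 5 []]],Branch 8 1 0 2 [Branch 3 1 1 1 [Branch 3 0 1 0 [],Branch 8 0 0 5 []]],
    Branch 6 1 1 0 [Branch 3 1 1 0 [Branch 3 0 1 1 [],Branch 8 0 0 5 []]]],Branch 6 1 1 1 [Branch 6 1 1 0 [
    Branch 3 1 1 1 [Branch 3 0 1 0 [],Branch 8 0 0 4 []]],Branch 6 1 1 0 [Branch 3 1 1 1 [Branch 3 0 1 0 [],
    Branch 8 0 0 4 []]],Branch 6 1 1 0 [Branch 3 1 1 0 [Branch 3 0 1 1 [],Branch 8 0 0 4 []]],Branch 6 1 1 0 [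
    Branch 3 1 1 0 [Branch 3 0 1 1 [],Branch 8 0 0 4 []]]],Branch 6 2 0 3 [Branch 4 2 0 2 [Branch 8 0 1 6 [
    Branch 4 2 2 2 [Branch 6 2 0 6 [],Branch 6 2 0 7 [],Branch 6 2 0 8 []]],Branch 5 0 0 7 []],Branch 4 2 0 2 [
    Branch 8 0 0 7 [],Branch 8 0 1 6 [Branch 4 2 2 2 [Branch 6 2 0 6 [],Branch 6 2 0 7 [],Branch 6 2 0 8 []]]]],
    Branch 6 2 0 3 [Branch 4 2 0 2 [Branch 8 0 1 7 [Branch 4 2 2 2 [Branch 6 2 0 6 [],Branch 6 2 0 7 [],
    Branch 6 2 0 8 []]],Branch 5 0 0 6 []],Branch 4 2 0 2 [Branch 8 0 0 6 [],Branch 8 0 1 7 [Branch 1 6 2 0 [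
    Branch 7 2 0 6 [],Branch 7 2 0 7 [],Branch 7 2 0 8 []]]]],Branch 6 2 0 3 [Branch 4 2 0 2 [Branch 8 0 1 8 [
    Branch 4 2 2 2 [Branch 6 2 0 6 [],Branch 6 2 0 7 [],Branch 6 2 0 8 []]],Branch 5 0 0 6 []],Branch 4 2 0 2 [
    Branch 8 0 0 6 [],Branch 8 0 1 8 [Branch 1 6 2 0 [Branch 7 2 0 6 [],Branch 7 2 0 7 [],Branch 7 2 0 8 []]]]]]"

lemma closed_common_block: "closes (entry [0,0,1,0,1,1,2,2,2]) [] tree_common_block"
  by code_simp

definition tree_cyclic :: tree where
  "tree_cyclic =
    Branch 2 2 0 0 [Branch 1 1 0 0 [Branch 8 0 0 0 [Branch 6 0 0 1 [Branch 3 0 0 1 [Branch 3 0 0 2 [Branch 4 0 2 0 [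
    Branch 5 0 2 0 []]]]],Branch 7 0 0 0 [Branch 3 0 0 1 [Branch 4 0 0 0 [Branch 0 0 0 0 [Branch 4 0 2 1 []]]]]],
    Branch 1 0 1 0 [Branch 3 0 1 2 [Branch 6 0 0 0 [Branch 6 0 0 3 [Branch 4 0 0 1 [Branch 2 0 1 0 [Branch 2 1 0 0 []]]],
    Branch 7 0 0 0 [Branch 4 0 0 0 [Branch 2 0 0 0 [Branch 2 1 1 0 []]]]]],Branch 4 0 0 3 [Branch 6 0 2 3 [
    Branch 6 0 0 0 [Branch 6 0 0 1 [Branch 4 0 0 0 []],Branch 6 0 0 1 [Branch 3 0 0 2 []],Branch 6 0 0 1 [
    Branch 3 0 0 2 [],Branch 4 0 0 0 []]]]],Branch 8 2 0 3 [Branch 3 0 2 0 [Branch 3 0 2 2 [Branch 7 0 0 8 [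
    Branch 2 7 1 0 [Branch 2 8 0 0 []]]],Branch 3 0 2 2 [Branch 7 0 0 7 [Branch 2 7 0 0 [Branch 2 8 1 0 []]]]]]],
    Branch 1 0 1 0 [Branch 4 0 0 4 [Branch 6 0 0 0 [Branch 7 0 0 1 [Branch 4 0 0 1 [Branch 2 0 1 0 [Branch 2 1 0 0 []]]],
    Branch 7 0 0 0 [Branch 4 0 0 0 [Branch 2 0 0 0 [Branch 2 1 1 0 []]]]]],Branch 4 0 0 3 [Branch 6 0 2 3 [
    Branch 6 0 0 0 [Branch 6 0 0 1 [Branch 4 0 0 0 []],Branch 6 0 0 1 [Branch 3 0 0 2 []],Branch 6 0 0 1 [
    Branch 3 0 0 2 [],Branch 4 0 0 0 []]]]],Branch 7 0 0 4 [Branch 3 0 2 0 [Branch 3 0 2 2 [Branch 7 0 0 8 [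
    Branch 2 7 1 0 [Branch 2 8 0 0 []]]],Branch 3 0 2 2 [Branch 7 0 0 7 [Branch 2 7 0 0 [Branch 2 8 1 0 []]]]]]],
    Branch 6 0 1 1 [Branch 6 0 1 3 [Branch 3 0 2 1 [Branch 5 2 0 0 [Branch 8 1 2 0 [Branch 7 0 2 7 []]]]],
    Branch 6 0 1 3 [Branch 3 0 2 1 [Branch 5 2 0 0 [Branch 8 1 2 0 [Branch 7 0 2 8 []]]]]]],Branch 7 0 0 7 [
    Branch 8 1 0 3 [Branch 5 2 0 1 [Branch 3 0 2 0 [Branch 6 0 1 2 [Branch 8 1 2 3 [Branch 6 0 0 0 [Branch 6 0 0 1 [],
    Branch 6 0 0 1 []]],Branch 7 0 0 6 [Branch 1 0 0 0 [Branch 7 0 2 6 [Branch 2 7 0 0 [Branch 3 0 1 2 [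
    Branch 4 0 2 6 [],Branch 4 0 2 6 []]]]]]]],Branch 5 2 0 2 [Branch 8 1 0 2 [Branch 2 7 3 0 [Branch 7 0 0 0 [
    Branch 7 0 0 1 [],Branch 7 0 0 1 []]],Branch 7 0 0 6 [Branch 6 0 0 1 [Branch 2 6 3 0 [Branch 4 0 2 7 [
    Branch 2 2 3 0 [Branch 8 1 2 3 [],Branch 8 1 2 3 []]]]]]]]]],Branch 7 0 0 8 [Branch 3 0 2 0 [
    Branch 3 0 2 1 [Branch 3 0 2 2 [Branch 5 2 2 0 [Branch 4 0 2 7 []]]],Branch 3 0 2 1 [],Branch 2 7 1 0 [
    Branch 2 8 0 0 []],Branch 4 0 0 7 [Branch 4 0 0 6 [Branch 1 0 0 0 [Branch 6 0 0 1 []]]]]],Branch 8 1 0 0 [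
    Branch 3 0 2 0 [Branch 3 0 2 1 [Branch 3 0 2 2 [Branch 5 2 2 0 [Branch 4 0 2 8 []]]],Branch 3 0 2 1 [],
    Branch 4 0 0 8 [Branch 4 0 0 6 [Branch 1 0 0 0 [Branch 6 0 0 1 []]]],Branch 2 7 0 0 [Branch 2 8 1 0 []]]],
    Branch 7 0 0 8 [Branch 8 1 0 2 [Branch 3 0 2 0 [Branch 3 0 2 2 [Branch 2 8 3 0 [Branch 7 0 0 0 [Branch 7 0 0 1 [],
    Branch 7 0 0 1 []]]]],Branch 4 0 0 6 [Branch 6 0 1 2 [Branch 8 1 2 3 [Branch 6 0 0 0 [Branch 6 0 0 1 [],
    Branch 6 0 0 1 []]],Branch 7 0 0 6 [Branch 1 0 0 0 [Branch 7 0 2 6 [Branch 2 8 0 0 [Branch 3 0 1 2 [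
    Branch 4 0 2 6 [],Branch 4 0 2 6 []]]]]]]],Branch 3 0 2 0 [Branch 7 0 0 6 [Branch 6 0 0 1 [Branch 3 0 2 2 [
    Branch 4 0 2 8 [Branch 2 6 3 0 [Branch 2 2 3 0 [Branch 8 1 2 3 [],Branch 8 1 2 3 []]]]]]]]]]],
    Branch 4 2 0 2 [Branch 7 0 0 2 [Branch 8 0 0 2 [Branch 6 0 0 0 [Branch 2 0 1 0 [],Branch 2 1 1 0 [],
    Branch 6 0 0 3 []],Branch 6 1 0 1 []],Branch 8 0 0 2 [Branch 6 0 0 0 [Branch 2 0 1 0 [],Branch 2 1 1 0 [],
    Branch 6 0 0 3 []],Branch 6 1 0 1 []],Branch 2 2 2 0 [Branch 4 1 2 2 [Branch 6 2 0 2 [Branch 8 0 0 4 [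
    Branch 8 0 0 6 []],Branch 8 0 1 5 []]],Branch 4 1 2 2 [Branch 6 2 0 2 [Branch 8 0 0 5 [Branch 8 0 0 6 []],
    Branch 8 0 1 4 []]]]],Branch 1 2 1 0 [Branch 3 2 0 1 [],Branch 6 1 0 2 [Branch 3 2 1 1 [Branch 3 2 1 0 []],
    Branch 3 2 1 1 [Branch 3 2 1 0 []]],Branch 6 1 0 2 [Branch 3 2 1 1 [Branch 3 2 1 0 []],Branch 3 2 1 1 [
    Branch 3 2 1 0 []]],Branch 6 1 1 1 [Branch 6 1 1 2 [Branch 6 1 1 3 []],Branch 6 1 1 2 [Branch 6 1 1 3 []],
    Branch 6 1 1 2 [Branch 6 1 1 3 []],Branch 6 1 1 2 [Branch 6 1 1 3 []]]],Branch 5 2 0 2 [Branch 8 0 0 2 [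
    Branch 8 0 0 7 [Branch 6 1 2 0 [],Branch 1 7 0 0 []],Branch 8 0 0 7 [Branch 6 1 2 0 [],Branch 1 7 0 0 []],
    Branch 8 0 0 7 []],Branch 6 1 0 2 [Branch 1 7 0 0 [Branch 5 1 0 6 [Branch 1 2 1 0 [Branch 3 2 0 1 []]],
    Branch 5 1 0 6 [Branch 1 2 1 0 [Branch 3 2 0 1 []]],Branch 1 7 1 0 []]]],Branch 6 1 0 2 [Branch 5 2 0 2 [
    Branch 1 8 0 0 [Branch 6 1 2 0 [],Branch 6 1 2 3 [Branch 7 1 0 3 [Branch 6 1 0 0 []]],Branch 7 1 0 4 [
    Branch 7 1 0 3 [Branch 6 1 0 0 []]]]],Branch 1 6 2 0 [Branch 3 2 2 0 [],Branch 3 2 2 0 [Branch 6 1 0 0 [],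
    Branch 1 8 1 0 []],Branch 3 2 2 0 [Branch 6 1 0 0 [],Branch 1 8 1 0 []]]]],Branch 5 2 0 3 [Branch 8 0 0 3 [
    Branch 7 2 0 2 [Branch 6 2 0 0 [Branch 1 4 1 0 [],Branch 1 5 1 0 [],Branch 6 2 0 3 []],Branch 6 2 1 1 []],
    Branch 7 2 0 2 [Branch 6 2 0 0 [Branch 1 4 1 0 [],Branch 1 5 1 0 [],Branch 6 2 0 3 []],Branch 6 2 1 1 []],
    Branch 1 3 2 0 [Branch 5 1 2 3 [Branch 4 0 0 6 [Branch 3 0 1 1 [Branch 3 0 1 2 []],Branch 3 0 2 0 []]],
    Branch 5 1 2 3 [Branch 4 0 0 6 [Branch 3 0 1 1 [Branch 3 0 1 2 []],Branch 3 0 2 0 []]]]],Branch 2 2 1 0 [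
    Branch 8 1 0 0 [Branch 6 0 1 2 [Branch 6 0 1 3 []],Branch 6 0 1 1 [Branch 6 0 1 2 []],Branch 6 0 1 2 [
    Branch 6 0 1 3 []],Branch 6 0 1 1 [Branch 6 0 1 2 []]],Branch 3 1 2 1 [],Branch 6 2 1 2 [Branch 3 2 2 1 [
    Branch 3 2 2 0 []],Branch 3 2 2 1 [Branch 3 2 2 0 []]],Branch 6 2 1 2 [Branch 3 2 2 1 [Branch 3 2 2 0 []],
    Branch 3 2 2 1 [Branch 3 2 2 0 []]]],Branch 6 2 1 2 [Branch 4 0 0 2 [Branch 2 7 0 0 [Branch 2 8 0 0 [],
    Branch 6 1 1 3 [Branch 2 8 2 0 [Branch 7 0 0 8 []]],Branch 6 1 1 3 [Branch 2 8 2 0 [Branch 7 0 0 8 []]]]],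
    Branch 2 6 2 0 [Branch 3 0 2 0 [Branch 2 7 1 0 [],Branch 2 7 0 0 []],Branch 3 0 2 0 [Branch 2 7 1 0 [],
    Branch 2 7 0 0 []],Branch 3 0 2 0 []]],Branch 6 2 1 2 [Branch 4 0 0 2 [Branch 2 8 0 0 [Branch 2 7 0 0 [],
    Branch 6 1 1 3 [Branch 2 7 2 0 [Branch 7 0 0 7 []]],Branch 6 1 1 3 [Branch 2 7 2 0 [Branch 7 0 0 7 []]]]],
    Branch 2 6 2 0 [Branch 3 0 2 0 [Branch 2 8 0 0 [],Branch 2 8 1 0 []],Branch 3 0 2 0 [Branch 2 8 0 0 [],
    Branch 2 8 1 0 []],Branch 3 0 2 0 []]]],Branch 6 2 0 0 [Branch 3 1 0 1 [Branch 3 1 0 2 [Branch 6 2 0 1 [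
    Branch 7 2 0 0 [Branch 4 1 2 0 [Branch 5 0 2 4 []]]]],Branch 4 1 0 0 [Branch 6 2 0 1 [Branch 8 0 0 4 [
    Branch 4 1 2 1 [Branch 0 4 0 0 []]]]]],Branch 7 2 0 1 [Branch 6 2 0 1 [Branch 1 4 1 0 [Branch 6 2 2 0 []]],
    Branch 6 2 0 3 [Branch 3 1 0 2 [Branch 3 1 0 3 [Branch 3 0 0 0 [Branch 8 0 2 3 [Branch 4 1 0 3 [Branch 6 2 2 0 [
    Branch 3 0 0 2 [Branch 5 0 2 3 [],Branch 5 0 2 3 []]]]]],Branch 5 0 2 3 [Branch 3 1 2 0 [Branch 3 1 2 1 [],
    Branch 5 2 0 3 []]]]]],Branch 5 0 0 5 [Branch 5 0 0 3 [Branch 3 0 0 0 [Branch 4 0 0 0 []]]]],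
    Branch 3 1 0 1 [Branch 2 0 0 0 [Branch 2 1 1 0 []],Branch 4 1 0 0 [Branch 7 2 0 0 [Branch 6 2 0 1 [
    Branch 3 1 2 1 [Branch 6 2 2 0 []]]]],Branch 3 1 0 2 [Branch 7 2 0 3 [Branch 3 1 0 3 [Branch 2 0 0 0 [
    Branch 8 0 2 3 [Branch 0 5 3 0 [Branch 6 2 2 0 [Branch 3 0 0 2 [Branch 5 0 2 3 [],Branch 5 0 2 3 []]]]]],
    Branch 0 3 0 0 [Branch 3 1 2 0 [Branch 3 1 2 1 [],Branch 5 2 0 3 []]]]]]],Branch 5 0 0 6 [Branch 3 1 0 2 [
    Branch 2 3 2 0 [Branch 2 3 1 0 [Branch 4 1 0 0 [Branch 3 1 2 1 [Branch 8 0 0 4 [Branch 0 4 0 0 [Branch 3 0 0 2 [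
    Branch 5 0 2 3 [],Branch 5 0 2 3 []]]]]]]]],Branch 3 1 0 2 [Branch 2 3 2 0 [Branch 2 3 1 0 [Branch 3 1 0 1 [
    Branch 3 1 2 1 [Branch 7 2 0 0 [Branch 5 0 2 4 [Branch 7 0 0 0 [Branch 2 1 0 0 [],Branch 2 1 0 0 []]]]]]]]],
    Branch 5 2 0 4 [Branch 5 2 0 5 [],Branch 6 2 0 1 [Branch 5 2 0 5 [],Branch 5 2 0 5 []]]]],Branch 1 5 1 0 [
    Branch 3 1 0 1 [Branch 3 1 0 2 [Branch 8 0 0 4 [Branch 6 2 0 0 [Branch 2 0 0 0 [Branch 4 0 0 1 []]]]],
    Branch 4 1 0 0 [Branch 8 0 0 4 [Branch 6 2 0 0 [Branch 3 0 0 0 [Branch 4 0 0 0 []]]]]],Branch 1 4 0 0 [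
    Branch 5 1 0 3 [Branch 6 2 0 1 [Branch 4 1 0 0 [Branch 6 2 0 3 [Branch 7 2 2 0 [Branch 8 0 2 4 []]]],
    Branch 4 1 0 1 [Branch 7 2 0 0 [Branch 0 4 0 0 [Branch 7 2 2 1 []]]]]],Branch 4 1 0 3 [Branch 6 2 2 3 [
    Branch 1 3 0 0 [Branch 3 1 2 1 [Branch 6 2 1 3 [],Branch 6 2 1 3 []],Branch 3 1 2 1 [Branch 3 1 2 3 []],
    Branch 3 1 2 1 [Branch 3 1 2 3 []]]]],Branch 7 2 0 5 [Branch 3 1 2 1 [Branch 3 1 2 2 [Branch 7 2 0 7 [
    Branch 4 1 2 7 [Branch 5 2 2 4 []]]],Branch 3 1 2 2 [Branch 7 2 0 8 [Branch 4 1 2 8 [Branch 5 2 2 4 []]]]]]],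
    Branch 1 4 0 0 [Branch 4 1 0 4 [Branch 6 2 0 1 [Branch 4 1 0 0 [Branch 6 2 0 3 [Branch 7 2 2 0 [Branch 8 0 2 4 []]]],
    Branch 4 1 0 1 [Branch 7 2 0 0 [Branch 0 4 0 0 [Branch 7 2 2 1 []]]]]],Branch 4 1 0 3 [Branch 6 2 2 3 [
    Branch 1 3 0 0 [Branch 3 1 2 1 [Branch 6 2 1 3 [],Branch 6 2 1 3 []],Branch 3 1 2 1 [Branch 3 1 2 3 []],
    Branch 3 1 2 1 [Branch 3 1 2 3 []]]]],Branch 6 2 2 3 [Branch 3 1 2 1 [Branch 3 1 2 2 [Branch 7 2 0 7 [
    Branch 4 1 2 7 [Branch 5 2 2 4 []]]],Branch 3 1 2 2 [Branch 7 2 0 8 [Branch 4 1 2 8 [Branch 5 2 2 4 []]]]]]],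
    Branch 3 1 2 0 [Branch 3 1 2 2 [Branch 8 1 0 4 [Branch 6 2 1 1 [Branch 3 0 2 1 [Branch 2 8 0 0 []]]]],
    Branch 3 1 2 2 [Branch 8 1 0 4 [Branch 6 2 1 1 [Branch 3 0 2 1 [Branch 2 7 0 0 []]]]]]],Branch 7 1 0 2 [
    Branch 7 0 0 2 [Branch 8 0 0 2 [Branch 6 0 0 1 [Branch 2 0 0 0 [],Branch 2 1 0 0 [],Branch 6 0 0 3 []],
    Branch 6 1 0 0 []],Branch 8 0 0 2 [Branch 6 0 0 1 [Branch 2 0 0 0 [],Branch 2 1 0 0 [],Branch 6 0 0 3 []],
    Branch 6 1 0 0 []],Branch 2 2 2 0 [Branch 4 1 2 2 [Branch 6 2 0 2 [Branch 8 0 0 4 [Branch 8 0 0 6 []],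
    Branch 8 0 1 5 []]],Branch 4 1 2 2 [Branch 6 2 0 2 [Branch 8 0 0 5 [Branch 8 0 0 6 []],Branch 8 0 1 4 []]]]],
    Branch 1 6 1 0 [Branch 4 2 0 0 [Branch 3 2 0 2 [Branch 3 2 0 3 []],Branch 3 2 0 1 [Branch 3 2 0 3 []],
    Branch 3 2 0 2 [Branch 3 2 0 3 []],Branch 3 2 0 1 [Branch 3 2 0 3 []]],Branch 3 2 2 3 [Branch 7 1 0 4 [
    Branch 6 1 2 1 []],Branch 7 1 0 4 [Branch 6 1 2 1 []]],Branch 3 2 2 3 [Branch 6 1 2 1 [Branch 6 1 2 0 []],
    Branch 6 1 2 1 [Branch 6 1 2 0 []]],Branch 6 1 1 1 []],Branch 8 0 0 6 [Branch 1 6 2 0 [Branch 5 2 0 7 [],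
    Branch 5 2 0 7 [Branch 3 2 1 0 [],Branch 1 7 0 0 []],Branch 5 2 0 7 [Branch 3 2 1 0 [],Branch 1 7 0 0 []]],
    Branch 3 2 2 3 [Branch 1 7 0 0 [Branch 1 7 1 0 [],Branch 8 2 0 2 [Branch 7 1 0 3 [Branch 6 1 1 1 []]],
    Branch 7 1 0 4 [Branch 7 1 0 3 [Branch 6 1 1 1 []]]]]],Branch 8 0 0 6 [Branch 1 6 2 0 [Branch 5 2 0 8 [],
    Branch 5 2 0 8 [Branch 3 2 1 0 [],Branch 1 8 0 0 []],Branch 5 2 0 8 [Branch 3 2 1 0 [],Branch 1 8 0 0 []]],
    Branch 3 2 2 3 [Branch 1 8 0 0 [Branch 1 8 1 0 [],Branch 8 2 0 2 [Branch 7 1 0 3 [Branch 6 1 1 1 []]],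
    Branch 7 1 0 4 [Branch 7 1 0 3 [Branch 6 1 1 1 []]]]]]],Branch 3 2 2 0 [Branch 8 1 0 6 [Branch 8 0 0 7 [
    Branch 8 0 0 8 [],Branch 3 2 2 1 [Branch 8 0 0 8 [],Branch 8 0 0 8 []]],Branch 6 1 1 3 [Branch 2 6 3 0 [
    Branch 2 6 1 0 [Branch 6 1 1 1 [Branch 6 1 0 1 [Branch 3 2 2 2 [Branch 4 2 2 7 [Branch 2 2 3 0 [Branch 8 1 2 2 [],
    Branch 8 1 2 2 []]]]]]]]],Branch 6 1 1 3 [Branch 2 6 3 0 [Branch 2 6 1 0 [Branch 6 1 1 1 [Branch 6 1 0 1 [
    Branch 3 2 2 2 [Branch 4 2 2 8 [Branch 2 2 3 0 [Branch 8 1 2 2 [],Branch 8 1 2 2 []]]]]]]]]],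
    Branch 7 1 0 8 [Branch 6 0 1 0 [Branch 2 7 1 0 []],Branch 6 1 1 1 [],Branch 8 1 0 2 [Branch 3 2 2 2 [
    Branch 6 1 1 2 [Branch 8 1 2 2 [Branch 6 1 0 0 [Branch 6 1 0 1 [],Branch 8 0 0 2 []]],Branch 6 0 1 0 [
    Branch 0 2 6 0 [Branch 7 1 0 6 [Branch 3 2 1 0 [Branch 6 0 1 3 [Branch 0 2 2 0 [],Branch 0 2 2 0 []]]]]]]]],
    Branch 4 2 0 8 [Branch 4 2 0 6 [Branch 3 2 1 0 [Branch 1 7 1 0 []]]]],Branch 3 2 2 1 [Branch 3 2 2 2 [
    Branch 8 1 0 8 [Branch 8 1 0 2 [Branch 6 0 1 0 [Branch 7 0 0 8 []]]]],Branch 3 2 1 0 [Branch 1 7 1 0 []],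
    Branch 4 2 0 6 [Branch 8 1 0 2 [Branch 6 1 1 2 [Branch 8 1 2 2 [Branch 6 1 0 0 [Branch 6 1 0 1 [],
    Branch 8 0 0 2 []]],Branch 6 0 1 0 [Branch 0 2 6 0 [Branch 7 1 0 6 [Branch 3 2 1 0 [Branch 6 0 1 3 [
    Branch 0 2 2 0 [],Branch 0 2 2 0 []]]]]]]]]],Branch 6 1 1 1 [Branch 6 1 1 3 [Branch 3 2 2 1 [
    Branch 3 2 2 2 [Branch 7 1 2 7 [Branch 4 2 2 8 []]]]],Branch 6 1 1 3 [Branch 3 2 2 1 [Branch 3 2 2 2 [
    Branch 7 1 2 8 [Branch 4 2 2 7 []]]]]]],Branch 1 7 0 0 [Branch 6 1 0 1 [Branch 6 1 0 3 [Branch 3 2 0 1 [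
    Branch 4 2 0 0 [Branch 7 1 2 0 [Branch 4 2 2 1 []]]]],Branch 7 1 0 0 [Branch 3 2 0 1 [Branch 3 2 0 2 [
    Branch 7 1 2 1 [Branch 4 2 2 0 []]]]]],Branch 1 8 1 0 [Branch 5 1 0 6 [Branch 1 2 0 0 [Branch 6 1 0 3 [
    Branch 4 2 0 1 [Branch 2 0 1 0 [Branch 2 1 0 0 []]]],Branch 7 1 0 0 [Branch 4 2 0 0 [Branch 2 0 0 0 [
    Branch 6 0 0 1 []]]]]],Branch 8 2 0 2 [Branch 4 2 0 3 [Branch 1 2 0 0 [Branch 6 1 0 1 [Branch 6 1 0 2 []],
    Branch 6 1 0 1 [Branch 6 1 0 2 []],Branch 6 1 0 1 [Branch 5 0 0 6 [],Branch 4 2 0 0 []]]]],Branch 8 2 0 2 [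
    Branch 1 6 0 0 [Branch 3 2 2 2 [Branch 7 1 0 8 [Branch 6 0 1 0 [Branch 2 7 1 0 []]]],Branch 3 2 2 2 [
    Branch 7 1 0 7 [Branch 6 0 1 0 [Branch 2 8 1 0 []]]]]]],Branch 1 8 1 0 [Branch 5 1 0 6 [Branch 8 0 0 7 [
    Branch 1 2 0 0 [Branch 4 2 0 0 [Branch 2 0 0 0 [Branch 6 0 0 1 []]]],Branch 1 2 0 0 [Branch 4 2 0 1 [
    Branch 2 0 1 0 [Branch 2 1 0 0 []]]]]],Branch 8 2 0 2 [Branch 4 2 0 3 [Branch 1 2 0 0 [Branch 6 1 0 1 [
    Branch 6 1 0 2 []],Branch 6 1 0 1 [Branch 6 1 0 2 []],Branch 6 1 0 1 [Branch 5 0 0 6 [],Branch 4 2 0 0 []]]]],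
    Branch 7 1 0 4 [Branch 1 6 0 0 [Branch 3 2 2 2 [Branch 7 1 0 8 [Branch 6 0 1 0 [Branch 2 7 1 0 []]]],
    Branch 3 2 2 2 [Branch 7 1 0 7 [Branch 6 0 1 0 [Branch 2 8 1 0 []]]]]]],Branch 6 1 1 1 [Branch 6 1 1 3 [
    Branch 3 2 2 1 [Branch 3 2 2 2 [Branch 7 1 2 7 [Branch 4 2 2 8 []]]]],Branch 6 1 1 3 [Branch 3 2 2 1 [
    Branch 3 2 2 2 [Branch 7 1 2 8 [Branch 4 2 2 7 []]]]]]]]"

lemma closed_cyclic: "closes (entry [0,0,1,0,2,2,2,1,1]) [] tree_cyclic"
  by code_simp

definition tree_one_transversal :: tree where
  "tree_one_transversal =
    Branch 7 0 1 2 [Branch 3 0 0 1 [Branch 5 0 0 2 [Branch 6 1 0 1 [Branch 6 0 0 0 [Branch 5 1 0 1 [Branch 3 0 1 1 [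
    Branch 3 0 0 3 [Branch 7 0 0 5 [Branch 3 1 1 2 []]]]]],Branch 7 1 0 0 [Branch 7 0 0 1 [Branch 5 0 1 1 [
    Branch 4 0 1 0 [Branch 4 0 0 3 [Branch 6 0 0 5 [Branch 3 1 0 4 []]]]]]]]],Branch 3 0 0 0 [Branch 7 1 0 1 [
    Branch 8 0 0 8 [Branch 7 0 0 0 [Branch 5 0 1 1 [Branch 3 0 0 5 [Branch 4 0 0 3 [Branch 6 0 0 5 [Branch 3 1 0 4 []]]]]]],
    Branch 8 0 0 5 [Branch 6 0 0 0 [Branch 5 1 0 1 [Branch 3 0 1 1 [Branch 3 0 0 3 [Branch 7 0 0 5 [Branch 3 1 1 2 []]]]]]]]],
    Branch 3 0 0 0 [Branch 7 1 0 1 [Branch 7 0 0 0 [Branch 5 0 1 1 [Branch 3 0 0 5 [Branch 4 0 0 3 [Branch 6 0 0 5 [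
    Branch 3 1 0 4 []]]]]],Branch 8 0 0 5 [Branch 6 0 0 1 [Branch 5 1 0 1 [Branch 3 0 1 0 [Branch 3 0 0 3 [
    Branch 7 0 0 5 [Branch 3 1 1 2 []]]]]]]]],Branch 3 0 0 0 [Branch 6 0 0 1 [Branch 6 0 0 3 [Branch 5 1 0 1 [
    Branch 3 0 1 0 [Branch 3 0 0 3 [Branch 7 1 0 0 [Branch 7 0 0 5 [Branch 6 1 0 0 [Branch 3 1 1 2 []]]]]]]],
    Branch 8 0 0 0 [Branch 5 0 1 1 [Branch 4 0 1 0 [Branch 4 0 0 3 [Branch 6 0 0 5 [Branch 6 1 0 0 [Branch 7 1 0 0 [
    Branch 3 1 0 4 []]]]]]]]]]],Branch 8 1 1 3 [Branch 7 0 1 8 [Branch 8 1 2 1 [Branch 7 0 2 5 [Branch 6 0 1 7 [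
    Branch 6 0 2 8 [Branch 1 1 7 0 [Branch 8 0 2 0 []],Branch 8 2 1 0 [Branch 6 0 2 5 [Branch 0 1 6 0 []],
    Branch 6 0 2 5 [Branch 5 2 0 1 []]]]],Branch 1 1 7 0 []],Branch 1 1 6 0 [Branch 8 0 2 0 [],Branch 6 0 1 6 [
    Branch 6 0 1 4 [Branch 6 0 2 8 [Branch 7 0 2 3 [Branch 1 0 6 0 [],Branch 6 0 0 7 []]]]]],Branch 8 1 2 0 [],
    Branch 8 1 2 0 [Branch 7 0 2 2 [Branch 8 2 2 1 [Branch 8 1 2 2 [Branch 6 0 0 6 [Branch 6 0 0 4 []]]]]],
    Branch 8 1 2 0 [Branch 7 0 2 2 [Branch 8 2 2 1 [Branch 8 1 2 2 [Branch 6 0 0 7 [Branch 6 0 0 4 []]]]]]]],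
    Branch 6 0 1 2 [Branch 7 0 0 2 [Branch 1 1 1 0 [Branch 8 0 0 0 [],Branch 6 0 1 1 [Branch 6 0 1 3 [
    Branch 6 0 2 2 [Branch 7 0 0 3 [Branch 1 0 1 0 [],Branch 6 0 0 0 []]]]]],Branch 1 1 0 0 [Branch 8 0 0 0 [],
    Branch 6 0 1 0 [Branch 6 0 1 3 [Branch 6 0 2 2 [Branch 7 0 0 3 [Branch 1 0 0 0 [],Branch 6 0 0 1 []]]]]],
    Branch 7 0 0 8 [Branch 6 0 1 1 [Branch 8 2 0 1 [Branch 8 1 0 2 [Branch 6 0 0 1 [Branch 6 0 0 3 []]]]]],
    Branch 7 0 0 8 [Branch 6 0 1 0 [Branch 8 2 0 1 [Branch 8 1 0 2 [Branch 6 0 0 0 [Branch 6 0 0 3 []]]]]],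
    Branch 7 0 0 8 []]],Branch 7 0 1 5 [Branch 4 1 0 6 [Branch 3 1 2 1 [Branch 6 1 2 0 [Branch 6 1 2 3 [
    Branch 7 2 0 7 []],Branch 6 2 2 1 []]],Branch 3 1 2 0 [Branch 6 1 2 1 [Branch 6 1 2 3 [Branch 7 2 0 7 []],
    Branch 6 2 2 0 []]],Branch 3 1 2 1 [Branch 6 1 2 1 [Branch 6 1 2 3 [Branch 7 2 0 6 []],Branch 6 2 2 0 []]],
    Branch 3 1 2 0 [Branch 6 1 2 0 [Branch 6 1 2 3 [Branch 7 2 0 6 []],Branch 6 2 2 1 []]]]],Branch 7 0 1 5 [
    Branch 3 1 2 6 [Branch 3 1 2 7 [Branch 6 1 2 6 [Branch 6 1 2 4 [Branch 7 2 2 7 []],Branch 6 2 2 7 []]],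
    Branch 4 1 2 6 [Branch 6 1 2 6 [Branch 6 1 2 4 [Branch 7 2 2 6 []],Branch 6 2 2 7 []]],Branch 3 1 2 7 [
    Branch 6 1 2 7 [Branch 6 1 2 4 [Branch 7 2 2 6 []],Branch 6 2 2 6 []]],Branch 4 1 2 6 [Branch 6 1 2 7 [
    Branch 6 1 2 4 [Branch 7 2 2 7 []],Branch 6 2 2 6 []]]]]],Branch 4 0 2 0 [Branch 5 0 2 2 [Branch 7 1 2 0 [
    Branch 7 0 2 1 [Branch 8 0 2 8 [Branch 5 0 1 1 [Branch 4 0 1 0 [Branch 4 0 2 3 [Branch 6 0 0 5 [Branch 3 1 0 3 []]]]]]],
    Branch 8 0 2 5 [Branch 6 0 0 7 [Branch 5 1 2 1 [Branch 3 0 1 6 [Branch 3 0 0 4 [Branch 7 0 2 5 [Branch 3 1 1 8 []]]]]]]]],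
    Branch 3 0 0 6 [Branch 8 0 2 5 [Branch 7 0 2 1 [Branch 5 0 1 1 [Branch 4 0 1 0 [Branch 4 0 2 3 [Branch 6 0 0 5 [
    Branch 3 1 0 3 []]]]]],Branch 7 1 2 0 [],Branch 6 0 0 6 [Branch 5 1 2 1 [Branch 3 0 1 7 [Branch 3 0 0 4 [
    Branch 7 0 2 5 [Branch 3 1 1 8 []]]]]]]],Branch 3 0 0 7 [Branch 6 1 0 7 [Branch 6 0 0 6 [Branch 5 1 2 1 [
    Branch 3 0 1 7 [Branch 3 0 0 4 [Branch 7 0 2 5 [Branch 3 1 1 8 []]]]]],Branch 6 1 0 4 [Branch 7 0 2 0 [
    Branch 5 0 1 1 [Branch 3 0 0 5 [Branch 4 0 2 3 [Branch 6 0 0 5 [Branch 3 1 0 3 []]]]]]]]],Branch 3 0 0 6 [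
    Branch 8 0 2 8 [Branch 6 1 0 6 [Branch 6 0 0 7 [Branch 5 1 2 1 [Branch 5 1 2 2 [Branch 3 0 0 4 [Branch 7 0 2 5 [
    Branch 3 1 1 8 []]]]]]],Branch 6 1 0 6 [],Branch 6 1 0 4 [Branch 7 0 2 0 [Branch 5 0 1 1 [Branch 3 0 0 5 [
    Branch 4 0 2 3 [Branch 6 0 0 5 [Branch 3 1 0 3 []]]]]]]]]],Branch 5 0 0 0 [Branch 5 0 0 2 [Branch 7 1 0 0 [
    Branch 7 0 0 1 [Branch 5 0 1 0 [Branch 3 0 0 5 [Branch 4 0 0 3 [Branch 6 0 0 5 [Branch 3 1 0 4 []]]]]],
    Branch 6 1 0 0 [Branch 6 0 0 1 [Branch 5 1 0 0 [Branch 3 0 1 0 [Branch 3 0 0 3 [Branch 7 0 0 5 [Branch 3 1 1 2 []]]]]]]]],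
    Branch 3 0 0 0 [Branch 6 1 0 1 [Branch 6 0 0 0 [Branch 5 1 0 0 [Branch 4 0 0 5 [Branch 3 0 0 3 [Branch 7 0 0 5 [
    Branch 3 1 1 2 []]]]]],Branch 7 1 0 0 [Branch 7 0 0 1 [Branch 5 0 1 0 [Branch 3 0 0 5 [Branch 4 0 0 3 [
    Branch 6 0 0 5 [Branch 3 1 0 4 []]]]]]]]],Branch 5 0 0 2 [Branch 6 1 0 0 [Branch 6 0 0 1 [Branch 5 1 0 0 [
    Branch 3 0 1 0 [Branch 3 0 0 3 [Branch 7 0 0 5 [Branch 3 1 1 2 []]]]]],Branch 6 1 0 3 [Branch 7 0 0 0 [
    Branch 5 0 1 0 [Branch 3 0 0 5 [Branch 4 0 0 3 [Branch 6 0 0 5 [Branch 3 1 0 4 []]]]]]]]],Branch 3 0 0 0 [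
    Branch 7 1 0 1 [Branch 7 0 0 0 [Branch 5 0 1 0 [Branch 3 0 0 5 [Branch 4 1 1 2 [Branch 4 0 0 3 [Branch 6 0 0 5 []]]]]],
    Branch 8 0 0 5 [Branch 6 0 0 0 [Branch 5 1 0 0 [Branch 3 0 1 1 [Branch 3 0 0 3 [Branch 7 0 0 5 [Branch 3 1 1 2 []]]]]]]]]],
    Branch 8 1 1 3 [Branch 8 1 1 0 [Branch 6 0 1 7 [Branch 1 0 6 0 [Branch 8 0 2 1 [],Branch 6 0 1 6 [
    Branch 6 0 1 4 [Branch 6 0 2 8 [Branch 7 0 2 3 [Branch 6 0 0 6 [],Branch 1 0 4 0 []]]]]],Branch 8 1 2 1 [
    Branch 7 0 2 2 [Branch 8 2 2 0 [Branch 8 1 2 2 [Branch 6 0 0 7 [Branch 6 0 0 4 []]]]]],Branch 8 1 2 0 [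
    Branch 1 0 7 0 []],Branch 7 0 2 8 [Branch 8 1 2 0 [Branch 8 2 2 0 [Branch 8 1 2 2 [Branch 6 0 0 6 [
    Branch 6 0 0 4 []]]]]],Branch 7 0 2 2 [Branch 6 0 1 4 [Branch 1 0 7 0 [Branch 8 0 2 1 [],Branch 6 0 2 8 [
    Branch 7 0 2 3 [Branch 6 0 0 7 [],Branch 1 0 4 0 []]]]]]]],Branch 6 0 1 2 [Branch 8 1 0 0 [Branch 1 0 1 0 [
    Branch 8 0 0 1 [],Branch 7 0 0 5 [Branch 6 0 1 1 [Branch 6 0 2 2 [Branch 7 0 0 3 [Branch 6 0 0 1 [],
    Branch 6 0 0 0 []]]]]],Branch 1 0 0 0 [Branch 8 0 0 1 [],Branch 6 0 1 0 [Branch 6 0 1 3 [Branch 6 0 2 2 [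
    Branch 7 0 0 3 [Branch 6 0 0 0 [],Branch 8 0 0 0 []]]]]],Branch 8 1 0 1 [Branch 7 0 0 2 [Branch 8 2 0 0 [
    Branch 8 1 0 2 [Branch 6 0 0 0 [Branch 6 0 0 3 []]]]]],Branch 8 1 0 1 [Branch 6 0 1 0 [Branch 8 2 0 0 [
    Branch 8 1 0 2 [Branch 6 0 0 1 [Branch 6 0 0 3 []]]]]],Branch 8 1 0 1 []]],Branch 8 1 1 0 [Branch 3 1 2 0 [
    Branch 3 1 2 1 [Branch 6 1 2 0 [Branch 6 1 2 3 [Branch 7 2 0 7 []],Branch 6 2 2 1 []]],Branch 4 1 0 6 [
    Branch 6 1 2 0 [Branch 6 1 2 3 [Branch 7 2 0 6 []],Branch 6 2 2 1 []]],Branch 3 1 2 1 [Branch 6 1 2 1 [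
    Branch 6 1 2 3 [Branch 7 2 0 6 []],Branch 6 2 2 0 []]],Branch 4 1 0 6 [Branch 6 1 2 1 [Branch 6 1 2 3 [
    Branch 7 2 0 7 []],Branch 6 2 2 0 []]]]],Branch 7 0 1 5 [Branch 3 1 2 6 [Branch 3 1 2 7 [Branch 6 1 2 6 [
    Branch 6 1 2 4 [Branch 7 2 2 7 []],Branch 6 2 2 7 []]],Branch 4 1 2 6 [Branch 6 1 2 6 [Branch 6 1 2 4 [
    Branch 7 2 2 6 []],Branch 6 2 2 7 []]],Branch 3 1 2 7 [Branch 6 1 2 7 [Branch 6 1 2 4 [Branch 7 2 2 6 []],
    Branch 6 2 2 6 []]],Branch 4 1 2 6 [Branch 6 1 2 7 [Branch 6 1 2 4 [Branch 7 2 2 7 []],Branch 6 2 2 6 []]]]]],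
    Branch 5 0 2 0 [Branch 3 0 0 7 [Branch 7 1 2 0 [Branch 7 0 2 1 [Branch 6 0 0 7 [Branch 5 0 1 0 [Branch 4 0 1 0 [
    Branch 4 0 2 3 [Branch 6 0 0 5 [Branch 3 1 0 3 []]]]]]],Branch 7 1 2 3 [Branch 6 0 0 7 [Branch 5 1 2 0 [
    Branch 3 0 1 6 [Branch 3 0 0 4 [Branch 7 0 2 5 [Branch 3 1 1 8 []]]]]]]]],Branch 3 0 0 6 [Branch 7 1 2 0 [
    Branch 6 1 0 7 [Branch 7 0 2 1 [Branch 5 0 1 0 [Branch 4 0 1 0 [Branch 4 0 2 3 [Branch 6 0 0 5 [Branch 3 1 0 3 []]]]]]],
    Branch 6 1 0 7 [Branch 6 0 0 6 [Branch 5 1 2 0 [Branch 3 0 1 7 [Branch 3 0 0 4 [Branch 7 0 2 5 [Branch 3 1 1 8 []]]]]]]]],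
    Branch 4 0 2 0 [Branch 6 1 0 6 [Branch 7 1 2 1 [Branch 6 0 0 7 [Branch 5 1 2 0 [Branch 3 0 1 6 [Branch 3 0 0 4 [
    Branch 7 0 2 5 [Branch 3 1 1 8 []]]]]]],Branch 6 1 0 4 [Branch 7 0 2 0 [Branch 5 0 1 0 [Branch 3 0 0 5 [
    Branch 4 0 2 3 [Branch 6 0 0 5 [Branch 3 1 0 3 []]]]]]]]],Branch 4 0 2 0 [Branch 6 1 0 7 [Branch 6 1 0 4 [
    Branch 6 0 0 6 [Branch 5 1 2 0 [Branch 3 0 1 7 [Branch 3 0 0 4 [Branch 7 0 2 5 [Branch 3 1 1 8 []]]]]]],
    Branch 8 0 2 5 [Branch 7 0 2 0 [Branch 5 0 1 0 [Branch 3 0 0 5 [Branch 4 0 2 3 [Branch 6 0 0 5 [Branch 3 1 0 3 []]]]]]]]]],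
    Branch 3 1 0 0 [Branch 3 1 0 1 [Branch 6 1 0 0 [Branch 7 1 0 0 [Branch 7 2 0 1 []],Branch 6 2 0 1 []]],
    Branch 4 1 0 0 [Branch 6 1 0 0 [Branch 6 1 0 3 [Branch 7 2 0 0 []],Branch 6 2 0 1 []]],Branch 3 1 0 1 [
    Branch 6 1 0 1 [Branch 6 1 0 3 [Branch 7 2 0 0 []],Branch 6 2 0 0 []]],Branch 4 1 0 0 [Branch 7 1 0 0 [
    Branch 6 1 0 1 [Branch 6 2 0 0 []],Branch 7 2 0 1 []]]],Branch 3 1 0 4 [Branch 4 1 1 1 [Branch 4 2 1 0 [
    Branch 7 2 1 0 [Branch 4 2 0 1 [],Branch 3 2 0 5 [Branch 3 2 0 4 [Branch 5 0 2 4 [Branch 7 2 0 2 [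
    Branch 3 2 0 2 [],Branch 3 2 0 2 []]]]]],Branch 4 2 1 1 [Branch 3 2 0 3 [Branch 4 2 2 0 [Branch 4 2 1 3 [
    Branch 5 0 0 6 [Branch 4 2 2 2 []]]]]],Branch 7 2 1 0 [Branch 4 2 0 1 [],Branch 5 0 1 6 [Branch 5 0 2 4 [
    Branch 3 2 0 5 [Branch 7 2 0 2 [Branch 3 2 0 2 [],Branch 3 2 0 2 []]]]]],Branch 4 2 1 1 [Branch 3 2 0 3 [
    Branch 4 2 2 0 [Branch 4 2 1 3 [Branch 5 0 0 7 [Branch 4 2 2 2 []]]]]],Branch 4 2 1 1 []]],Branch 3 1 0 3 [
    Branch 5 0 1 6 [Branch 4 2 1 1 [Branch 7 2 1 1 []],Branch 7 2 1 1 [Branch 4 2 0 0 [],Branch 3 2 0 5 [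
    Branch 3 2 0 4 [Branch 5 0 2 4 [Branch 7 2 0 2 [Branch 3 2 0 2 [],Branch 3 2 0 2 []]]]]],Branch 4 2 1 0 [
    Branch 3 2 0 3 [Branch 4 2 2 1 [Branch 4 2 1 3 [Branch 5 0 0 6 [Branch 4 2 2 2 []]]]]],Branch 3 2 0 4 [
    Branch 3 2 0 5 [Branch 4 2 2 1 [Branch 4 2 1 3 [Branch 5 0 0 7 [Branch 4 2 2 2 []]]]]],Branch 3 2 0 3 [
    Branch 5 0 1 8 [Branch 7 2 1 1 [Branch 4 2 0 0 [],Branch 5 0 2 4 [Branch 7 2 0 2 [Branch 3 2 0 2 [],
    Branch 3 2 0 2 []]]]]]]],Branch 3 1 0 3 [Branch 4 2 1 1 [Branch 7 2 1 1 [Branch 3 2 0 5 [Branch 3 2 0 3 [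
    Branch 5 0 0 4 [Branch 7 2 2 2 [Branch 3 2 0 8 [],Branch 3 2 0 8 []]]]],Branch 4 2 2 0 []],Branch 4 2 1 0 [
    Branch 3 2 0 4 [Branch 4 2 0 1 [Branch 4 2 1 3 [Branch 5 0 2 6 [Branch 4 2 0 2 []]]]]],Branch 7 2 1 1 [
    Branch 5 0 1 6 [Branch 5 0 0 4 [Branch 4 2 1 0 [Branch 7 2 2 2 [Branch 3 2 0 8 [],Branch 3 2 0 8 []]]]],
    Branch 4 2 2 0 []],Branch 4 2 1 0 [Branch 5 0 1 6 [Branch 4 2 0 1 [Branch 4 2 1 3 [Branch 5 0 2 7 [
    Branch 4 2 0 2 []]]]]],Branch 4 2 1 0 []]],Branch 3 1 0 3 [Branch 4 2 1 0 [Branch 7 2 1 0 [Branch 3 2 0 5 [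
    Branch 3 2 0 3 [Branch 5 0 0 4 [Branch 7 2 2 2 [Branch 3 2 0 8 [],Branch 3 2 0 8 []]]]],Branch 4 2 2 1 []],
    Branch 4 2 1 1 [Branch 4 2 0 0 [Branch 3 2 0 4 [Branch 4 2 1 3 [Branch 5 0 2 6 [Branch 4 2 0 2 []]]]]],
    Branch 7 2 1 0 [Branch 5 0 1 6 [Branch 5 0 0 4 [Branch 3 2 0 5 [Branch 7 2 2 2 [Branch 3 2 0 8 [],
    Branch 3 2 0 8 []]]]],Branch 4 2 2 1 []],Branch 4 2 1 1 [Branch 4 2 0 0 [Branch 5 0 1 6 [Branch 4 2 1 3 [
    Branch 5 0 2 7 [Branch 4 2 0 2 []]]]]],Branch 4 2 1 1 []]]],Branch 3 1 0 6 [Branch 3 1 0 7 [Branch 7 1 2 0 [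
    Branch 6 1 0 6 [Branch 6 2 0 7 []],Branch 7 2 2 1 []]],Branch 4 1 2 0 [Branch 6 1 0 6 [Branch 6 1 0 4 [
    Branch 7 2 2 0 []],Branch 6 2 0 7 []]],Branch 3 1 0 7 [Branch 6 1 0 7 [Branch 6 1 0 4 [Branch 7 2 2 0 []],
    Branch 6 2 0 6 []]],Branch 4 1 2 0 [Branch 7 1 2 0 [Branch 6 1 0 7 [Branch 6 2 0 6 []],Branch 7 2 2 1 []]]]]"

lemma closed_one_transversal: "closes (entry [0,0,1,0,2,1,2,2,1]) [] tree_one_transversal"
  by code_simp

text \<open>
  The search trees exclude the three shapes of a pair of partitions with two blocks that share
  exactly two points.
\<close>

lemma distinct_division_partitions_orthogonal:
  assumes P: "division_sudoku P L" and Q: "division_sudoku Q L" and ne: "P \<noteq> Q"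
  shows "\<forall>A\<in>P. \<forall>B\<in>Q. card (A \<inter> B) = 1"
proof -
  have sP: "sudoku_partition P" and sQ: "sudoku_partition Q" using P Q
      by (auto simp: division_sudoku_def)
  have "card (A \<inter> B) \<noteq> 2" if AB: "A \<in> P" "B \<in> Q" for A B
  proof
    assume "card (A \<inter> B) = 2"
    from common_pair_labels[OF sP sQ AB this]
    obtain x0 x1 x2 x3 x4 x5 x6 x7 x8 where x: "distinct [x0,x1,x2,x3,x4,x5,x6,x7,x8]"
      "set [x0,x1,x2,x3,x4,x5,x6,x7,x8] = {1..9}" "P = {{x0,x1,x2},{x3,x4,x5},{x6,x7,x8}}"
      "Q = {{x0,x1,x3},{x2,x4,x5},{x6,x7,x8}} \<or> Q = {{x0,x1,x3},{x2,x7,x8},{x4,x5,x6}} \<or>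
          Q = {{x0,x1,x3},{x2,x5,x8},{x4,x6,x7}}"
      by (elim exE conjE) (rule that)
    let ?lam = "entry [x0,x1,x2,x3,x4,x5,x6,x7,x8]"
    have lam: "bij_betw ?lam UNIV {1..9}" by (rule bij_betw_entry[OF x(1,2)])
    have T: "latin_triples (triples ?lam L)" "divided_by fst (triples ?lam L)"
      using triples_latin_divided[OF lam, of fst L] P unfolding x(3) classes_fst by auto
    have no: False if "Q = classes ?lam \<kappa>" "closes \<kappa> [] r" for \<kappa> r
    proof -
      have "divided_by \<kappa> (triples ?lam L)" using triples_latin_divided[OF lam, of \<kappa> L] Q that(1) by simp
      thus False using closes_sound(1)[OF T that(2)] by simp
    qed
    from x(4) show False
      by (elim disjE) (erule no[OF _ closed_common_block, unfolded classes_common_block],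
          erule no[OF _ closed_cyclic, unfolded classes_cyclic],
        erule no[OF _ closed_one_transversal, unfolded classes_one_transversal])
  qed
  thus ?thesis by (rule orthogonal_if_no_common_pair[OF sP sQ ne])
qed

section \<open>Squares with two orthogonal partitions are diagonally cyclic\<close>

text \<open>
  In this section \<open>R a b c d e f\<close> says that the row \<open>(a, d)\<close>, the column \<open>(b, e)\<close> and the symbol
  \<open>(c, f)\<close> form a triple of the square. The block numbers with respect to the first partition are
  \<open>a, b, c\<close>, those with respect to the second are \<open>d, e, f\<close>; flipping exchanges the partitions.
\<close>

definition flip where "flip R = (\<lambda>a b c d e f. R d e f a b c)"

text \<open>
  Three points, pairwise different in each coordinate. As every permutation of the field is affine,
  these are the lines of affine 3-space whose direction has no zero coordinate.
\<close>

definition skew_line :: "(f3 \<Rightarrow> f3 \<Rightarrow> f3 \<Rightarrow> bool) \<Rightarrow> bool" where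
  "skew_line S \<longleftrightarrow> (\<forall>d. \<exists>e f. S d e f) \<and> (\<forall>e. \<exists>d f. S d e f) \<and> (\<forall>f. \<exists>d e. S d e f) \<and>
    (\<forall>d e f e' f'. S d e f \<longrightarrow> S d e' f' \<longrightarrow> e = e' \<and> f = f') \<and>
    (\<forall>d e f d' f'. S d e f \<longrightarrow> S d' e f' \<longrightarrow> d = d' \<and> f = f') \<and>
    (\<forall>d e f d' e'. S d e f \<longrightarrow> S d' e' f \<longrightarrow> d = d' \<and> e = e')"

lemma skew_lineD:
  assumes "skew_line S"
  shows "\<exists>e f. S d e f" "\<exists>d f. S d e f" "\<exists>d e. S d e f"
    "S d e f \<Longrightarrow> S d e' f' \<Longrightarrow> e = e' \<and> f = f'"
    "S d e f \<Longrightarrow> S d' e f' \<Longrightarrow> d = d' \<and> f = f'"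
    "S d e f \<Longrightarrow> S d' e' f \<Longrightarrow> d = d' \<and> e = e'"
  using assms unfolding skew_line_def by blast+

lemma skew_lineI:
  assumes "\<And>d. \<exists>e f. S d e f" "\<And>e. \<exists>d f. S d e f" "\<And>f. \<exists>d e. S d e f"
    "\<And>d e f e' f'. S d e f \<Longrightarrow> S d e' f' \<Longrightarrow> e = e' \<and> f = f'"
    "\<And>d e f d' f'. S d e f \<Longrightarrow> S d' e f' \<Longrightarrow> d = d' \<and> f = f'"
    "\<And>d e f d' e'. S d e f \<Longrightarrow> S d' e' f \<Longrightarrow> d = d' \<and> e = e'"
  shows "skew_line S"
  unfolding skew_line_def by (intro conjI allI impI) (use assms in metis)+

lemma skew_line_perm:
  assumes "skew_line S"
  shows "skew_line (\<lambda>d e f. S e d f)" "skew_line (\<lambda>d e f. S d f e)"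
  using skew_lineD[OF assms] by (auto intro!: skew_lineI) metis+

definition skew_lines :: "(f3 \<Rightarrow> f3 \<Rightarrow> f3 \<Rightarrow> f3 \<Rightarrow> f3 \<Rightarrow> f3 \<Rightarrow> bool) \<Rightarrow> bool" where
  "skew_lines R \<longleftrightarrow> (\<forall>a b c. skew_line (R a b c))"

text \<open>
  The latin property for rows and columns; permuting the three coordinate pairs of \<open>R\<close> expresses the
  other two latin properties.
\<close>

definition determines_third :: "(f3 \<Rightarrow> f3 \<Rightarrow> f3 \<Rightarrow> f3 \<Rightarrow> f3 \<Rightarrow> f3 \<Rightarrow> bool) \<Rightarrow> bool" where
  "determines_third R \<longleftrightarrow> (\<forall>a b d e. \<exists>c f. R a b c d e f) \<and>
    (\<forall>a b c d e f c' f'. R a b c d e f \<longrightarrow> R a b c' d e f' \<longrightarrow> c = c' \<and> f = f')"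

definition latin_relation where
  "latin_relation R \<longleftrightarrow> determines_third R \<and> determines_third (\<lambda>a b c d e f. R a c b d f e) \<and>
      determines_third (\<lambda>a b c d e f. R c a b f d e)"

lemma determines_third_swap: "determines_third R \<Longrightarrow> determines_third (\<lambda>a b c d e f. R b a c e d f)"
  unfolding determines_third_def by blast

lemma determines_third_flip: "determines_third R \<Longrightarrow> determines_third (\<lambda>a b c d e f. R d e f a b c)"
  unfolding determines_third_def by blast

text \<open>
  The description of a latin square with two orthogonal division partitions that is symmetric in the
  two partitions and in rows, columns and symbols. It is an orthogonal array of strength three: any
  three of the six coordinates take each value combination exactly three times.
\<close>

definition six_factor_array where "six_factor_array R \<longleftrightarrow>
    skew_lines R \<and> skew_lines (flip R) \<and> latin_relation R"

lemma latin_relation_flip: "latin_relation R \<Longrightarrow> latin_relation (flip R)"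
  unfolding latin_relation_def flip_def
  using determines_third_flip[of R] determines_third_flip[of "\<lambda>a b c d e f. R a c b d f e"]
      determines_third_flip[of "\<lambda>a b c d e f. R c a b f d e"]
  by simp

lemma six_factor_array_flip: "six_factor_array R \<Longrightarrow> six_factor_array (flip R)"
  unfolding six_factor_array_def using latin_relation_flip by (auto simp: flip_def)

lemma skew_lines_perm: "skew_lines R \<Longrightarrow> skew_lines (\<lambda>a b c d e f. R b a c e d f)"
    "skew_lines R \<Longrightarrow> skew_lines (\<lambda>a b c d e f. R a c b d f e)"
  unfolding skew_lines_def using skew_line_perm by blast+

lemma latin_relation_perm: "latin_relation R \<Longrightarrow> latin_relation (\<lambda>a b c d e f. R b a c e d f)"
    "latin_relation R \<Longrightarrow> latin_relation (\<lambda>a b c d e f. R a c b d f e)"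
  using determines_third_swap[of R] determines_third_swap[of "\<lambda>a b c d e f. R c a b f d e"]
      by (simp_all add: latin_relation_def)

lemma six_factor_array_perm:
  assumes "six_factor_array R"
  shows "six_factor_array (\<lambda>a b c d e f. R b a c e d f)" "six_factor_array (\<lambda>a b c d e f. R a c b d f e)"
  using assms skew_lines_perm(1)[of "flip R"] skew_lines_perm(2)[of "flip R"]
      unfolding six_factor_array_def
  by (auto intro: skew_lines_perm latin_relation_perm simp: flip_def)

lemma skew_linesD: "skew_lines R \<Longrightarrow> skew_line (R a b c)"
  unfolding skew_lines_def by blast

lemma latin_relationD:
  assumes "latin_relation R"
  shows "\<exists>c f. R a b c d e f" "R a b c d e f \<Longrightarrow> R a b c' d e f' \<Longrightarrow> c = c' \<and> f = f'"
  using assms by (auto simp: latin_relation_def determines_third_def)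

text \<open>
  For fixed \<open>a, b\<close> the three values of \<open>c\<close> give three skew lines. By the latin property their
  projections to the \<open>(d, e)\<close>-plane are disjoint, hence parallel. So the slope in this plane depends
  on \<open>a, b\<close> only.
\<close>

lemma slope_exists:
  assumes R: "six_factor_array R"
  shows "\<exists>m. \<forall>a b. is_sign (m a b) \<and> (\<forall>c d e f d' e' f'. R a b c d e f \<longrightarrow> R a b c d' e' f' \<longrightarrow>
      e' - e = m a b * (d' - d))"
proof -
  have L: "skew_lines R" and Pl: "latin_relation R" using R by (auto simp: six_factor_array_def)
  have "\<exists>m. is_sign m \<and> (\<forall>c d e f d' e' f'. R a b c d e f \<longrightarrow> R a b c d' e' f' \<longrightarrow>
      e' - e = m * (d' - d))" for a b
  proof -
    obtain g where g: "\<And>c d. \<exists>f. R a b c d (g c d) f" using skew_lineD(1)[OF skew_linesD[OF L]] by metis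
    have inj: "inj (g c)" for c
      unfolding inj_def using g skew_lineD(5)[OF skew_linesD[OF L]] by metis
    obtain m where m: "\<And>c. is_sign (m c)" "\<And>c x. g c x = g c 0 + m c * x"
      using f3_inj_affine[OF inj] by metis
    have same: "m c = m c'" for c c'
    proof (rule ccontr)
      assume ne: "m c \<noteq> m c'"
      \<comment> \<open>Lines of different slopes would meet at this \<open>d\<close>.\<close>
      define d where "d = (g c' 0 - g c 0) / (m c - m c')"
      have "g c d = g c' d"
        unfolding m(2)[of c d] m(2)[of c' d] using ne by (simp add: d_def field_simps)
      hence "c = c'" using g[of c d] g[of c' d] latin_relationD(2)[OF Pl] by metis
      thus False using ne by simp
    qed
    have "e' - e = m 0 * (d' - d)" if "R a b c d e f" "R a b c d' e' f'" for c d e f d' e' f'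
    proof -
      have "e = g c d" "e' = g c d'" using g[of c d] g[of c d'] that skew_lineD(4)[OF
          skew_linesD[OF L]] by metis+
      thus ?thesis using same[of c 0] m(2)[of c d] m(2)[of c d'] by (simp add: algebra_simps)
    qed
    thus ?thesis using m(1) by blast
  qed
  thus ?thesis by metis
qed

lemma slopeE:
  assumes "six_factor_array R"
  obtains m where "\<And>a b. is_sign (m a b)"
    "\<And>a b c d e f d' e' f'. R a b c d e f \<Longrightarrow> R a b c d' e' f' \<Longrightarrow> e' - e = m a b * (d' - d)"
proof -
  obtain m where m: "\<forall>a b. is_sign (m a b) \<and> (\<forall>c d e f d' e' f'. R a b c d e f \<longrightarrow> R a b c d' e' f' \<longrightarrow>
      e' - e = m a b * (d' - d))"
    using slope_exists[OF assms] by (rule exE)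
  show thesis by (rule that[of m]) (use m in blast)+
qed

text \<open>
  The parallel lines of \<open>slope_exists\<close> are the level sets of \<open>c\<close> as a function on the
  \<open>(d, e)\<close>-plane, so \<open>c\<close> is an affine function there.
\<close>

lemma affine_in_plane:
  assumes R: "six_factor_array R" and m: "\<And>a b c d e f d' e' f'. R a b c d e f \<Longrightarrow> R a b c d' e' f' \<Longrightarrow>
      e' - e = m a b * (d' - d)"
  shows "\<exists>u k. \<forall>a b. is_sign (u a b) \<and> (\<forall>c d e f. R a b c d e f \<longrightarrow> c = u a b * (e - m a b * d) + k a b)"
proof -
  have L: "skew_lines R" and Pl: "latin_relation R" using R by (auto simp: six_factor_array_def)
  have "\<exists>u k. is_sign u \<and> (\<forall>c d e f. R a b c d e f \<longrightarrow> c = u * (e - m a b * d) + k)" for a b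
  proof -
    \<comment> \<open>It suffices to know \<open>c\<close> on the axis \<open>d = 0\<close>, which meets every level line once.\<close>
    obtain h where h: "\<And>x. \<exists>f. R a b (h x) 0 x f" using latin_relationD(1)[OF Pl] by metis
    have "inj h"
    proof (rule injI)
      fix x y assume "h x = h y"
      thus "x = y" using h[of x] h[of y] skew_lineD(4)[OF skew_linesD[OF L]] by metis
    qed
    then obtain u where u: "is_sign u" "\<And>x. h x = h 0 + u * x" using f3_inj_affine by metis
    have "c = u * (e - m a b * d) + h 0" if "R a b c d e f" for c d e f
    proof -
      obtain e0 f0 where 0: "R a b c 0 e0 f0" using skew_lineD(1)[OF skew_linesD[OF L]] by blast
      have "e - e0 = m a b * (d - 0)" by (rule m[OF 0 that])
      moreover have "c = h e0" using h[of e0] 0 latin_relationD(2)[OF Pl] by blast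
      ultimately have "c = h 0 + u * e0" "e0 = e - m a b * d" using u(2)[of e0]
          by (auto simp: algebra_simps)
      thus ?thesis by simp
    qed
    thus ?thesis using u(1) by blast
  qed
  thus ?thesis by metis
qed

text \<open>
  Each row of a \<open>3 \<times> 3\<close> table of signs has a majority sign, and two of the three rows have the same
  one. This yields three points of equal sign that do not lie on a line.
\<close>

lemma majority:
  fixes \<sigma> :: "f3 \<Rightarrow> f3 \<Rightarrow> f3"
  assumes "\<And>x y. is_sign (\<sigma> x y)"
  shows "\<exists>D x x' y y' z. is_sign D \<and> x \<noteq> x' \<and> y \<noteq> y' \<and> \<sigma> x y = D \<and> \<sigma> x y' = D \<and> \<sigma> x' z = D"
proof -
  have "\<exists>D y y'. y \<noteq> y' \<and> \<sigma> x y = D \<and> \<sigma> x y' = D" for x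
    using assms[of x 0] assms[of x 1] assms[of x "-1"] f3_neq unfolding is_sign_def by metis
  hence "\<forall>x. \<exists>D. \<exists>y y'. y \<noteq> y' \<and> \<sigma> x y = D \<and> \<sigma> x y' = D" by blast
  then obtain D where D: "\<forall>x. \<exists>y y'. y \<noteq> y' \<and> \<sigma> x y = D x \<and> \<sigma> x y' = D x"
    by (rule choice[THEN exE])
  have s: "is_sign (D x)" for x using assms D by metis
  then obtain x x' where "x \<noteq> x'" "D x = D x'"
    using f3_neq unfolding is_sign_def by metis
  thus ?thesis using D s by metis
qed

text \<open>
  For a point \<open>(d, e)\<close> let \<open>n d e\<close> be the slope in the \<open>(a, b)\<close>-plane. Along a line of this slope the
  symbol block \<open>c\<close> takes three different values, which add up to 0. By \<open>affine_in_plane\<close> the sum is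
  an affine function of \<open>(d, e)\<close>. For the majority slope \<open>D\<close> it vanishes at three points that are not
  collinear, hence identically. Its coefficients are sums of three signs; such a sum is 0 only if
  the signs agree, and this makes the slope \<open>m\<close> constant along the lines of slope \<open>D\<close>.
\<close>

lemma slope_diagonal:
  assumes R: "six_factor_array R" and m: "\<And>a b c d e f d' e' f'. R a b c d e f \<Longrightarrow> R a b c d' e' f' \<Longrightarrow>
      e' - e = m a b * (d' - d)"
    and sm: "\<And>a b. is_sign (m a b)"
  shows "\<exists>D. is_sign D \<and> (\<forall>a b. m (a + 1) (b + D) = m a b)"
proof -
  have L: "skew_lines (flip R)" and Pl: "latin_relation R" using R by (auto simp: six_factor_array_def)
  obtain n where n: "\<And>d e. is_sign (n d e)" "\<And>d e f a b c a' b' c'. R a b c d e f \<Longrightarrow>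
      R a' b' c' d e f \<Longrightarrow> b' - b = n d e * (a' - a)"
    by (rule slopeE[OF six_factor_array_flip[OF R], unfolded flip_def]) blast
  have "\<exists>u k. \<forall>a b. is_sign (u a b) \<and> (\<forall>c d e f. R a b c d e f \<longrightarrow> c = u a b * (e - m a b * d) + k a b)"
    by (rule affine_in_plane[OF R]) (rule m)
  then obtain u k where uk: "\<forall>a b. is_sign (u a b) \<and> (\<forall>c d e f. R a b c d e f \<longrightarrow>
      c = u a b * (e - m a b * d) + k a b)"
    by (elim exE)
  have u: "is_sign (u a b)" "R a b c d e f \<Longrightarrow> c = u a b * (e - m a b * d) + k a b" for a b c d e f
    using uk by meson+
  obtain D x x' y y' z where D: "is_sign D" "x \<noteq> x'" "y \<noteq> y'" "n x y = D" "n x y' = D" "n x' z = D"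
    using majority[of n, OF n(1)] by (elim exE conjE) (rule that)
  have "m (a + 1) (b + D) = m a b" for a b
  proof -
    define s where "s d e a b = u a b * (e - m a b * d) + k a b" for d e a b
    have line: "s d e a b + s d e (a + 1) (b + D) + s d e (a - 1) (b - D) = 0" if "n d e = D" for d e
    proof -
      obtain c f where 0: "R a b c d e f" using latin_relationD(1)[OF Pl] by metis
      obtain b1 c1 where 1: "R (a + 1) b1 c1 d e f"
          using skew_lineD(1)[OF skew_linesD[OF L]] unfolding flip_def by metis
      obtain b2 c2 where 2: "R (a - 1) b2 c2 d e f"
          using skew_lineD(1)[OF skew_linesD[OF L]] unfolding flip_def by metis
      have b: "b1 = b + D" "b2 = b - D" using n(2)[OF 0 1] n(2)[OF 0 2] that
          by (auto simp: algebra_simps)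
      have ne: "a + 1 \<noteq> a" "a - 1 \<noteq> a" "a + 1 \<noteq> a - 1" by (cases a; simp add: f3_table)+
      have dist: "c1 = c2 \<Longrightarrow> a + 1 = a - 1" "c1 = c \<Longrightarrow> a + 1 = a" "c2 = c \<Longrightarrow> a - 1 = a"
        using skew_lineD(6)[OF skew_linesD[OF L]] 0 1 2 unfolding flip_def by metis+
      have "c + c1 + c2 = 0" by (rule f3_sum_distinct) (use dist ne in metis)+
      moreover have "c = s d e a b" "c1 = s d e (a + 1) (b + D)" "c2 = s d e (a - 1) (b - D)"
        using u(2)[OF 0] u(2)[OF 1] u(2)[OF 2] by (simp_all add: s_def b)
      ultimately show ?thesis by simp
    qed
    \<comment> \<open>The three values of \<open>c\<close> along the line add up to \<open>A * e - B * d + C\<close>.\<close>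
    define A where "A = u a b + u (a+1) (b+D) + u (a-1) (b-D)"
    define B where "B = u a b * m a b + u (a+1) (b+D) * m (a+1) (b+D) + u (a-1) (b-D) * m (a-1) (b-D)"
    define C where "C = k a b + k (a+1) (b+D) + k (a-1) (b-D)"
    have AB: "A * e - B * d + C = 0" if "n d e = D" for d e
      using line[OF that] by (simp add: s_def A_def B_def C_def algebra_simps)
    have "A * (y - y') = (A * y - B * x + C) - (A * y' - B * x + C)" by (simp add: algebra_simps)
    hence "A * (y - y') = 0" unfolding AB[OF D(4)] AB[OF D(5)] by simp
    hence A: "A = 0" using D(3) by simp
    have "B * (x - x') = (A * z - B * x' + C) - (A * y - B * x + C)" unfolding A
        by (simp add: algebra_simps)
    hence "B * (x - x') = 0" unfolding AB[OF D(4)] AB[OF D(6)] by simp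
    hence B: "B = 0" using D(2) by simp
    have eq: "u a b = u (a+1) (b+D)" using A u(1) f3_signs_sum unfolding A_def by metis
    have sg: "is_sign (u a b * m a b)" for a b using u(1)[of a b] sm[of a b]
        by (simp add: is_sign_iff[symmetric])
    have "u a b * m a b = u (a+1) (b+D) * m (a+1) (b+D)" using B sg f3_signs_sum unfolding B_def by metis
    thus ?thesis using eq u(1)[of a b] by (simp add: is_sign_iff[symmetric])
  qed
  thus ?thesis using D(1) by blast
qed

text \<open>
  Comparing \<open>(0, b)\<close> with its translate shows \<open>\<beta> b = r * \<beta> (b + D)\<close> for a fixed ratio \<open>r\<close>, and
  similarly \<open>\<alpha> (a + 1) = r * \<alpha> a\<close>. Going once around the field gives \<open>r\<^sup>3 = 1\<close>, so the sign \<open>r\<close> is 1.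
\<close>

lemma sign_product_const:
  fixes \<alpha> \<beta> :: "f3 \<Rightarrow> f3"
  assumes "\<And>a b. m a b = \<alpha> a * \<beta> b" "\<And>a b. m (a + 1) (b + D) = m a b" "is_sign D"
      "\<And>a. is_sign (\<alpha> a)" "\<And>b. is_sign (\<beta> b)"
  shows "m a b = m 0 (0::f3)"
proof -
  have eq: "\<alpha> (a + 1) * \<beta> (b + D) = \<alpha> a * \<beta> b" for a b using assms(1,2) by metis
  have nz: "\<alpha> a \<noteq> 0" "\<beta> a \<noteq> 0" for a using assms(4,5) is_sign_iff by blast+
  define r where "r = \<alpha> 1 / \<alpha> 0"
  have h: "\<alpha> 1 * \<beta> (b + D) = \<alpha> 0 * \<beta> b" for b using eq[of 0 b] by simp
  have \<beta>: "\<beta> b = r * \<beta> (b + D)" for b by (simp add: r_def h nz)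
  have \<alpha>: "\<alpha> (a + 1) = r * \<alpha> a" for a
  proof -
    have "\<alpha> (a + 1) * \<beta> (a + D) = (r * \<alpha> a) * \<beta> (a + D)"
      using eq[of a a] unfolding \<beta>[of a] by (simp add: ac_simps)
    thus ?thesis using nz by simp
  qed
  have "\<alpha> (a + 1 + 1 + 1) = r * (r * (r * \<alpha> a))" for a by (simp only: \<alpha>)
  hence "\<alpha> 0 = r * r * r * \<alpha> 0" using f3_three(1)[of 1] by (metis add.left_neutral mult.assoc)
  hence "r * r * r = 1" using nz by simp
  hence r: "r = 1" by (cases r) (auto simp: f3_table)
  have "\<alpha> a = \<alpha> 0" for a using \<alpha>[of 0] \<alpha>[of 1] f3_cases[of a] r f3_three(1)[of 1] \<alpha>[of "-1"] by auto
  moreover have "\<beta> b = \<beta> 0" for b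
    using \<beta>[of 0] \<beta>[of 1] \<beta>[of "-1"] f3_cases[of b] r assms(3) by (auto simp: is_sign_def)
  ultimately show ?thesis using assms(1) by metis
qed

text \<open>
  The three slopes of a skew line in the three coordinate planes satisfy one relation. Since each of
  them depends on two of \<open>a, b, c\<close> only, fixing \<open>c = 0\<close> writes \<open>m a b\<close> as a product of a sign
  depending on \<open>a\<close> and a sign depending on \<open>b\<close>. Together with the invariance of \<open>m\<close> along a diagonal
  this makes \<open>m\<close> constant.
\<close>

lemma slope_const:
  assumes R: "six_factor_array R"
  shows "\<exists>m. is_sign m \<and> (\<forall>a b c d e f d' e' f'. R a b c d e f \<longrightarrow> R a b c d' e' f' \<longrightarrow>
      e' - e = m * (d' - d))"
proof -
  have L: "skew_lines R" and Pl: "latin_relation R" using R by (auto simp: six_factor_array_def)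
  obtain m where m: "\<And>a b. is_sign (m a b)" "\<And>a b c d e f d' e' f'. R a b c d e f \<Longrightarrow>
      R a b c d' e' f' \<Longrightarrow> e' - e = m a b * (d' - d)"
    by (rule slopeE[OF R]) blast
  obtain \<alpha> where \<alpha>: "\<And>a c. is_sign (\<alpha> a c)" "\<And>a c b d f e d' f' e'. R a b c d e f \<Longrightarrow>
      R a b c d' e' f' \<Longrightarrow> f' - f = \<alpha> a c * (d' - d)"
    by (rule slopeE[OF six_factor_array_perm(2)[OF R]]) blast
  obtain \<beta> where \<beta>: "\<And>b c. is_sign (\<beta> b c)" "\<And>b c a e f d e' f' d'. R a b c d e f \<Longrightarrow>
      R a b c d' e' f' \<Longrightarrow> f' - f = \<beta> b c * (e' - e)"
    by (rule slopeE[OF six_factor_array_perm(2)[OF six_factor_array_perm(1)[OF R]]]) blast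
  have "m a b = \<alpha> a 0 * \<beta> b 0" for a b
  proof -
    obtain e f e' f' where x: "R a b 0 0 e f" "R a b 0 1 e' f'"
        using skew_lineD(1)[OF skew_linesD[OF L]] by metis
    have "\<alpha> a 0 = \<beta> b 0 * m a b" using m(2)[OF x] \<alpha>(2)[OF x] \<beta>(2)[OF x] by simp
    moreover have "\<beta> b 0 * \<beta> b 0 = 1" using \<beta>(1)[of b 0] by (auto simp: is_sign_def)
    ultimately show ?thesis by (simp add: algebra_simps)
  qed
  moreover obtain D where "is_sign D" "\<And>a b. m (a + 1) (b + D) = m a b"
  proof -
    have "\<exists>D. is_sign D \<and> (\<forall>a b. m (a + 1) (b + D) = m a b)"
      by (rule slope_diagonal[OF R]) (rule m(2), assumption, assumption, rule m(1))
    thus thesis using that by blast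
  qed
  ultimately have "m a b = m 0 0" for a b using sign_product_const[of m "\<lambda>a. \<alpha> a 0"
      "\<lambda>b. \<beta> b 0" D] \<alpha>(1) \<beta>(1) by metis
  thus ?thesis using m by metis
qed

text \<open>
  The conditions on two values \<open>w = \<theta> z\<close>, \<open>w' = \<theta> z'\<close> under which \<open>x + \<theta> (y - x)\<close> is a latin square
  that is a division sudoku with respect to both coordinates. The first two make its rows and
  columns injective.
\<close>

definition compatible :: "pt \<times> pt \<Rightarrow> pt \<times> pt \<Rightarrow> bool" where
  "compatible zw zw' \<longleftrightarrow> (case (zw, zw') of ((z, w), (z', w')) \<Rightarrow>
     w \<noteq> w' \<and> w - z \<noteq> w' - z' \<and> (fst z = fst z' \<longrightarrow> fst w \<noteq> fst w') \<and> (snd z = snd z' \<longrightarrow> snd w \<noteq> snd w'))"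

definition coordinates where "coordinates T = (\<lambda>a b c d e f. ((a, d), (b, e), (c, f)) \<in> T)"

lemma sign_square: "is_sign m \<Longrightarrow> m * m = 1" "is_sign m \<Longrightarrow> m * (m * x) = x"
  by (auto simp: is_sign_def)

lemma f3_shift_induct:
  fixes P :: "f3 \<Rightarrow> bool"
  assumes "\<And>g. P g \<Longrightarrow> P (g + 1)" "P 0"
  shows "P g"
proof -
  have "P 1" "P (-1)" using assms(1)[of 0] assms(1)[of 1] assms(2) by (auto simp: f3_table)
  thus ?thesis using f3_cases[of g] assms(2) by auto
qed

text \<open>
  All slopes are constant signs. Multiplying columns and symbols by these signs turns all directions
  into \<open>(1, 1, 1)\<close>, so that the set of triples is invariant under translation of the first and,
  independently, of the second coordinates. It is therefore determined by the triples with row 0.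
  A translation of the symbols achieves \<open>\<theta> 0 = 0\<close>.
\<close>

lemma normal_form:
  assumes R: "six_factor_array (coordinates T)"
  obtains B G \<theta> where "bij B" "bij G" "\<And>x y :: pt. fst (B x) = fst (B y) \<longleftrightarrow> fst x = fst y"
    "\<And>x y :: pt. fst (G x) = fst (G y) \<longleftrightarrow> fst x = fst y" "\<theta> 0 = 0"
    "\<And>x y z. (x, B y, G z) \<in> T \<longleftrightarrow> z = x + \<theta> (y - x)"
    "\<And>z z'. z \<noteq> z' \<Longrightarrow> compatible (z, \<theta> z) (z', \<theta> z')"
proof -
  define R where "R = coordinates T"
  have bi: "six_factor_array R" using R by (simp add: R_def)
  hence L: "skew_lines R" and Lf: "skew_lines (flip R)" and Pl: "latin_relation R"
      by (auto simp: six_factor_array_def)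
  obtain m where m: "is_sign m" "\<forall>a b c d e f d' e' f'. R a b c d e f \<longrightarrow> R a b c d' e' f' \<longrightarrow>
      e' - e = m * (d' - d)"
    using slope_const[OF bi] by (elim exE conjE) (rule that)
  obtain n where n: "is_sign n" "\<forall>a c b d f e d' f' e'. R a b c d e f \<longrightarrow> R a b c d' e' f' \<longrightarrow>
      f' - f = n * (d' - d)"
    using slope_const[OF six_factor_array_perm(2)[OF bi]] by (elim exE conjE) (rule that)
  obtain m' where m': "is_sign m'" "\<forall>d e f a b c a' b' c'. R a b c d e f \<longrightarrow> R a' b' c' d e f \<longrightarrow>
      b' - b = m' * (a' - a)"
    using slope_const[OF six_factor_array_flip[OF bi]] unfolding flip_def by (elim exE conjE) (rule that)
  obtain n' where n': "is_sign n'" "\<forall>d f e a c b a' c' b'. R a b c d e f \<longrightarrow> R a' b' c' d e f \<longrightarrow>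
      c' - c = n' * (a' - a)"
    using slope_const[OF six_factor_array_perm(2)[OF six_factor_array_flip[OF bi]]]
        unfolding flip_def by (elim exE conjE) (rule that)
  \<comment> \<open>The square after multiplication of columns and symbols by the signs: all slopes become 1.\<close>
  define S where "S a b c d e f = R a (m' * b) (n' * c) d (m * e) (n * f)" for a b c d e f
  note sq = sign_square[OF m(1)] sign_square[OF n(1)] sign_square[OF m'(1)] sign_square[OF n'(1)]
  have inj: "m * x = m * y \<Longrightarrow> x = y" "n * x = n * y \<Longrightarrow> x = y" "m' * x = m' * y \<Longrightarrow> x = y"
      "n' * x = n' * y \<Longrightarrow> x = y" for x y
    using sq by metis+
  have up1: "S a b c (d + 1) (e + 1) (f + 1)" if "S a b c d e f" for a b c d e f
  proof -
    obtain e' f' where 1: "R a (m' * b) (n' * c) (d + 1) e' f'"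
        using skew_lineD(1)[OF skew_linesD[OF L]] by metis
    have "e' - m * e = m * (d + 1 - d)" "f' - n * f = n * (d + 1 - d)"
      using m(2) n(2) that 1 unfolding S_def by metis+
    hence "e' = m * (e + 1)" "f' = n * (f + 1)" by (simp_all add: algebra_simps)
    thus ?thesis using 1 by (simp add: S_def)
  qed
  have up2: "S (a + 1) (b + 1) (c + 1) d e f" if "S a b c d e f" for a b c d e f
  proof -
    obtain b' c' where 1: "R (a + 1) b' c' d (m * e) (n * f)"
      using skew_lineD(1)[OF skew_linesD[OF Lf]] unfolding flip_def by metis
    have "b' - m' * b = m' * (a + 1 - a)" "c' - n' * c = n' * (a + 1 - a)"
      using m'(2) n'(2) that 1 unfolding S_def by metis+
    hence "b' = m' * (b + 1)" "c' = n' * (c + 1)" by (simp_all add: algebra_simps)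
    thus ?thesis using 1 by (simp add: S_def)
  qed
  have up: "S (a + g) (b + g) (c + g) (d + h) (e + h) (f + h)" if "S a b c d e f" for a b c d e f g h
  proof -
    have *: "S (a + g) (b + g) (c + g) d e f"
      by (rule f3_shift_induct[of "\<lambda>g. S (a + g) (b + g) (c + g) d e f"]) (use that up2 in \<open>auto
          simp: add.assoc[symmetric]\<close>)
    show ?thesis
      by (rule f3_shift_induct[of "\<lambda>h. S (a + g) (b + g) (c + g) (d + h) (e + h) (f + h)"]) (use *
          up1 in \<open>auto simp: add.assoc[symmetric]\<close>)
  qed
  have "\<exists>c f. S 0 b c 0 e f" for b e
  proof -
    obtain c f where "R 0 (m' * b) c 0 (m * e) f" using latin_relationD(1)[OF Pl] by metis
    hence "S 0 b (n' * c) 0 e (n * f)" by (simp add: S_def sq)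
    thus ?thesis by blast
  qed
  then obtain c f where cf: "\<And>b e. S 0 b (c b e) 0 e (f b e)" by metis
  define \<phi> where "\<phi> = (\<lambda>(b, e). (c b e, f b e))"
  define \<theta> where "\<theta> z = \<phi> z - \<phi> 0" for z
  have uniq: "c1 = c2 \<and> f1 = f2" if "S a b c1 d e f1" "S a b c2 d e f2" for a b d e c1 c2 f1 f2
    using latin_relationD(2)[OF Pl that[unfolded S_def]] inj by blast
  \<comment> \<open>Translate the row to 0.\<close>
  have S_iff: "S a b c d e f \<longleftrightarrow> (c, f) = (a, d) + \<phi> (b - a, e - d)" for a b c d e f
  proof
    assume "S a b c d e f"
    from up[OF this, of "- a" "- d"] have "S 0 (b - a) (c - a) 0 (e - d) (f - d)" by simp
    hence "c - a = fst (\<phi> (b - a, e - d))" "f - d = snd (\<phi> (b - a, e - d))"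
      using uniq[OF _ cf[of "b - a" "e - d"]] by (simp_all add: \<phi>_def)
    thus "(c, f) = (a, d) + \<phi> (b - a, e - d)" by (simp add: prod_eq_iff algebra_simps)
  next
    assume "(c, f) = (a, d) + \<phi> (b - a, e - d)"
    thus "S a b c d e f" using up[OF cf[of "b - a" "e - d"], of a d] by (simp add: \<phi>_def algebra_simps)
  qed
  define B where "B = (\<lambda>(b, e). (m' * b, m * e))"
  define G where "G z = (case z + \<phi> 0 of (c, f) \<Rightarrow> (n' * c, n * f))" for z
  have nz: "m' \<noteq> 0" "n' \<noteq> 0" using m'(1) n'(1) is_sign_iff by blast+
  show thesis
  proof (rule that[of B G \<theta>])
    show "bij B" by (rule o_bij[of B]) (auto simp: B_def sq fun_eq_iff)
    have "bij ((\<lambda>(c, f). (n' * c, n * f)) :: pt \<Rightarrow> pt)"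
        by (rule o_bij[of "\<lambda>(c, f). (n' * c, n * f)"]) (auto simp: sq fun_eq_iff)
    moreover have "bij (\<lambda>z. z + \<phi> 0)" by (rule o_bij[of "\<lambda>z. z - \<phi> 0"]) (auto simp: fun_eq_iff)
    ultimately have "bij ((\<lambda>(c, f). (n' * c, n * f)) \<circ> (\<lambda>z. z + \<phi> 0))" by (intro bij_comp)
    thus "bij G" by (simp add: G_def[abs_def] comp_def)
    show "fst (B x) = fst (B y) \<longleftrightarrow> fst x = fst y" for x y
      using nz by (simp add: B_def case_prod_beta)
    show "fst (G x) = fst (G y) \<longleftrightarrow> fst x = fst y" for x y
      using nz by (simp add: G_def case_prod_beta)
    show "\<theta> 0 = 0" by (simp add: \<theta>_def)
    have T_iff: "(x, B y, G z) \<in> T \<longleftrightarrow> z + \<phi> 0 = x + \<phi> (y - x)" for x y z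
      using S_iff[of "fst x" "fst y" "fst (z + \<phi> 0)" "snd x" "snd y" "snd (z + \<phi> 0)"]
      by (cases x; cases y; cases "z + \<phi> 0") (simp add: S_def R_def coordinates_def B_def G_def
          minus_prod_def)
    show "(x, B y, G z) \<in> T \<longleftrightarrow> z = x + \<theta> (y - x)" for x y z
      unfolding T_iff \<theta>_def by (auto simp: algebra_simps)
    show "compatible (z, \<theta> z) (z', \<theta> z')" if "z \<noteq> z'" for z z'
    proof -
      obtain b e b' e' where z: "z = (b, e)" "z' = (b', e')" by (cases z, cases z')
      define c0 f0 c1 f1 where d: "c0 = c b e" "f0 = f b e" "c1 = c b' e'" "f1 = f b' e'"
      have 0: "S 0 b c0 0 e f0" and 1: "S 0 b' c1 0 e' f1" using cf by (auto simp: d)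
      have "\<not> (c0 = c1 \<and> f0 = f1)"
      proof
        assume "c0 = c1 \<and> f0 = f1"
        hence "b = b' \<and> e = e'" using 0 1 latin_relationD(2)[OF latin_relation_perm(2)[OF Pl]] inj
            unfolding S_def by metis
        thus False using that z by simp
      qed
      moreover have "\<not> (c0 - b = c1 - b' \<and> f0 - e = f1 - e')"
      proof
        assume "c0 - b = c1 - b' \<and> f0 - e = f1 - e'"
        moreover have "S (-b) 0 (c0 - b) (-e) 0 (f0 - e)" "S (-b') 0 (c1 - b') (-e') 0 (f1 - e')"
          using up[OF 0, of "-b" "-e"] up[OF 1, of "-b'" "-e'"] by simp_all
        ultimately have "-b = -b' \<and> -e = -e'" using latin_relationD(2)[OF
            latin_relation_perm(2)[OF latin_relation_perm(1)[OF Pl]]] unfolding S_def by metis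
        thus False using that z by simp
      qed
      moreover have "\<not> (b = b' \<and> c0 = c1)"
      proof
        assume "b = b' \<and> c0 = c1"
        hence "e = e'" using 0 1 skew_lineD(4)[OF skew_linesD[OF L]] inj unfolding S_def by metis
        thus False using that z \<open>b = b' \<and> c0 = c1\<close> by simp
      qed
      moreover have "\<not> (e = e' \<and> f0 = f1)"
      proof
        assume "e = e' \<and> f0 = f1"
        hence "b = b'" using 0 1 skew_lineD(4)[OF skew_linesD[OF Lf]] inj unfolding S_def flip_def
            by metis
        thus False using that z \<open>e = e' \<and> f0 = f1\<close> by simp
      qed
      ultimately show ?thesis
        by (auto simp: compatible_def \<theta>_def \<phi>_def z d algebra_simps)
    qed
  qed
qed

lemma six_factor_array_coordinates:
  assumes L: "latin_triples T" and P: "divided_by fst T" and Q: "divided_by snd T"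
  shows "six_factor_array (coordinates T)"
  unfolding six_factor_array_def skew_lines_def flip_def latin_relation_def determines_third_def
      coordinates_def
proof (intro conjI allI impI)
  show "skew_line (\<lambda>d e f. ((a, d), (b, e), (c, f)) \<in> T)" for a b c
  proof (rule skew_lineI)
    show "\<exists>e f. ((a, d), (b, e), (c, f)) \<in> T" for d using divided_byD(3)[OF P, of "(a, d)" b c]
        by (metis prod.collapse)
    show "\<exists>d f. ((a, d), (b, e), (c, f)) \<in> T" for e using divided_byD(2)[OF P, of "(b, e)" a c]
        by (metis prod.collapse)
    show "\<exists>d e. ((a, d), (b, e), (c, f)) \<in> T" for f using divided_byD(1)[OF P, of "(c, f)" a b]
        by (metis prod.collapse)
  qed (use divided_byD(4-6)[OF P] in \<open>metis fst_conv snd_conv\<close>)+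
  show "skew_line (\<lambda>d e f. ((d, a), (e, b), (f, c)) \<in> T)" for a b c
  proof (rule skew_lineI)
    show "\<exists>e f. ((d, a), (e, b), (f, c)) \<in> T" for d using divided_byD(3)[OF Q, of "(d, a)" b c]
        by (metis prod.collapse)
    show "\<exists>d f. ((d, a), (e, b), (f, c)) \<in> T" for e using divided_byD(2)[OF Q, of "(e, b)" a c]
        by (metis prod.collapse)
    show "\<exists>d e. ((d, a), (e, b), (f, c)) \<in> T" for f using divided_byD(1)[OF Q, of "(f, c)" a b]
        by (metis prod.collapse)
  qed (use divided_byD(4-6)[OF Q] in \<open>metis fst_conv snd_conv\<close>)+
next
  show "\<exists>c f. ((a, d), (b, e), (c, f)) \<in> T" for a b d e
      using latin_triplesD(1)[OF L, of "(a, d)" "(b, e)"] by simp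
  show "\<exists>c f. ((a, d), (c, f), (b, e)) \<in> T" for a b d e
      using latin_triplesD(2)[OF L, of "(a, d)" "(b, e)"] by simp
  show "\<exists>c f. ((c, f), (a, d), (b, e)) \<in> T" for a b d e
      using latin_triplesD(3)[OF L, of "(a, d)" "(b, e)"] by simp
qed (use latin_triplesD(4-6)[OF L] in blast)+

section \<open>Labellings and ds-isotopisms\<close>

definition same_block :: "nat \<Rightarrow> nat \<Rightarrow> bool" where
  "same_block a b \<longleftrightarrow> (\<exists>A\<in>standard_partition. a \<in> A \<and> b \<in> A)"

text \<open>
  A labelling that identifies the standard partition with the first coordinate.
\<close>

definition block_labelling :: "(pt \<Rightarrow> nat) \<Rightarrow> bool" where
  "block_labelling lam \<longleftrightarrow> bij_betw lam UNIV {1..9} \<and> (\<forall>x y. same_block (lam x) (lam y) \<longleftrightarrow> fst x = fst y)"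

definition block_index :: "nat \<Rightarrow> nat" where "block_index n =
    (if n \<le> 3 then 1 else if n \<le> 6 then 2 else 3)"

lemma interval_1_9: "{1..9::nat} = {1,2,3,4,5,6,7,8,9}"
  by auto

lemma same_block_iff:
  assumes "a \<in> {1..9}" "b \<in> {1..9}"
  shows "same_block a b \<longleftrightarrow> block_index a = block_index b"
  using assms unfolding interval_1_9 same_block_def standard_partition_def block_index_def by auto

fun block_list :: "nat list \<Rightarrow> bool" where
  "block_list [a,b,c,d,e,f,g,h,i] \<longleftrightarrow> list_all (\<lambda>n. n \<in> set [a,b,c,d,e,f,g,h,i]) [1,2,3,4,5,6,7,8,9] \<and>
     map block_index [b,c,e,f,h,i] = map block_index [a,a,d,d,g,g] \<and> distinct (map block_index [a,d,g])"
| "block_list _ \<longleftrightarrow> False"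

lemma block_list_labelling:
  assumes "block_list xs"
  shows "block_labelling (entry xs)"
proof -
  obtain a b c d e f g h i where xs: "xs = [a,b,c,d,e,f,g,h,i]" using assms
      by (cases xs rule: block_list.cases) auto
  have sub: "{1..9} \<subseteq> set xs" using assms unfolding xs interval_1_9 by (auto simp: list_all_iff)
  have len: "length xs = 9" by (simp add: xs)
  have "set xs = {1..9}"
    using sub card_length[of xs] len by (metis List.finite_set card_atLeastAtMost card_seteq
        diff_Suc_1 diff_Suc_Suc plus_1_eq_Suc add_diff_cancel_left' Suc_eq_plus1)
  moreover from this have "distinct xs" using len by (intro card_distinct) simp
  ultimately have bij: "bij_betw (entry xs) UNIV {1..9}" unfolding xs by (intro bij_betw_entry)
  have rng: "entry xs x \<in> {1..9}" for x using bij by (metis UNIV_I bij_betwE)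
  have idx: "map block_index [b,c,e,f,h,i] = map block_index [a,a,d,d,g,g]"
      "distinct (map block_index [a,d,g])"
    using assms unfolding xs by auto
  have "block_index (entry xs x) = block_index (entry xs y) \<longleftrightarrow> fst x = fst y" for x y
  proof -
    have "x \<in> set points" "y \<in> set points" by (simp_all add: set_points)
    thus ?thesis using idx unfolding points_eq xs by (auto simp: entry_simps simp del: entry.simps)
  qed
  thus ?thesis using bij same_block_iff[OF rng rng] by (simp add: block_labelling_def)
qed

lemma labelling_of_standard_partition:
  assumes "bij_betw lam UNIV {1..9}" "classes lam fst = standard_partition"
  shows "block_labelling lam"
proof -
  have "lam x \<in> lam ` S \<longleftrightarrow> x \<in> S" for x S using assms(1) by (auto simp: bij_betw_def dest: injD)
  hence "same_block (lam x) (lam y) \<longleftrightarrow> fst x = fst y" for x y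
    unfolding same_block_def assms(2)[symmetric] classes_def by auto
  thus ?thesis using assms(1) by (simp add: block_labelling_def)
qed

lemma block_labelling_comp:
  assumes "block_labelling lam" "bij B" "\<And>x y. fst (B x) = fst (B y) \<longleftrightarrow> fst x = fst y"
  shows "block_labelling (lam \<circ> B)"
proof -
  have "bij_betw lam UNIV {1..9}" and same: "\<And>x y. same_block (lam x) (lam y) \<longleftrightarrow> fst x = fst y"
    using assms(1) by (auto simp only: block_labelling_def)
  hence "bij_betw (lam \<circ> B) UNIV {1..9}" by (intro bij_betw_trans[OF assms(2)])
  thus ?thesis by (simp only: block_labelling_def same assms(3) comp_apply simp_thms)
qed

lemma block_permutation_between:
  assumes "block_labelling lam" "block_labelling mu"
  obtains \<alpha> where "block_permutation \<alpha>" "\<And>x. \<alpha> (lam x) = mu x"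
proof -
  have bl: "bij_betw lam UNIV {1..9}" and bm: "bij_betw mu UNIV {1..9}" using assms
      by (auto simp: block_labelling_def)
  define \<alpha> where "\<alpha> n = (if n \<in> {1..9} then mu (inv lam n) else n)" for n
  have inv: "inv lam (lam x) = x" for x using bl by (simp add: bij_betw_def)
  have rng: "lam x \<in> {1..9}" for x using bl by (metis UNIV_I bij_betwE)
  have \<alpha>: "\<alpha> (lam x) = mu x" for x using rng[of x] inv[of x] by (simp add: \<alpha>_def)
  have ex: "\<exists>x. n = lam x" if "n \<in> {1..9}" for n using that bl by (metis bij_betw_def imageE)
  have "bij_betw (mu \<circ> the_inv_into UNIV lam) {1..9} {1..9}"
    by (rule bij_betw_trans[OF bij_betw_the_inv_into[OF bl] bm])
  moreover have "\<alpha> n = (mu \<circ> the_inv_into UNIV lam) n" if "n \<in> {1..9}" for n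
    using ex[OF that] \<alpha> bl by (auto simp: bij_betw_def the_inv_into_f_f)
  ultimately have b: "bij_betw \<alpha> {1..9} {1..9}" by (subst bij_betw_cong) auto
  have "block_permutation \<alpha>"
    unfolding block_permutation_def
  proof (intro conjI ballI)
    show "\<alpha> permutes {1..9}" by (rule bij_imp_permutes[OF b]) (auto simp: \<alpha>_def)
    fix A assume A: "A \<in> standard_partition"
    have std: "\<Union>standard_partition = {1..9}" unfolding interval_1_9
        by (auto simp: standard_partition_def)
    obtain a where a: "a \<in> A" using A by (auto simp: standard_partition_def)
    have A9: "A \<subseteq> {1..9}" using A std by blast
    have same: "same_block (\<alpha> m) (\<alpha> n) \<longleftrightarrow> same_block m n" if "m \<in> {1..9}" "n \<in> {1..9}" for m n
      using ex[OF that(1)] ex[OF that(2)] assms by (auto simp: \<alpha> block_labelling_def)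
    have dj: "X = Y" if "X \<in> standard_partition" "Y \<in> standard_partition" "x \<in> X" "x \<in> Y" for X Y x
      using that by (auto simp: standard_partition_def)
    have "\<alpha> a \<in> {1..9}" using bij_betwE[OF b] a A9 by blast
    then obtain A' where A': "A' \<in> standard_partition" "\<alpha> a \<in> A'" using std by blast
    have "\<alpha> ` A = A'"
    proof (intro equalityI subsetI)
      fix y assume "y \<in> \<alpha> ` A"
      then obtain n where n: "n \<in> A" "y = \<alpha> n" by blast
      hence "same_block a n" using a A by (auto simp: same_block_def)
      hence "same_block (\<alpha> a) y" using same[of a n] a n A9 by blast
      then obtain X where "X \<in> standard_partition" "\<alpha> a \<in> X" "y \<in> X" by (auto simp: same_block_def)
      thus "y \<in> A'" using dj[OF _ A'(1) _ A'(2)] by blast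
    next
      fix y assume y: "y \<in> A'"
      hence "y \<in> {1..9}" using A'(1) std by blast
      then obtain n where n: "n \<in> {1..9}" "y = \<alpha> n" using b by (metis bij_betw_def imageE)
      have "same_block (\<alpha> a) (\<alpha> n)" using A' y n by (auto simp: same_block_def)
      hence "same_block a n" using same[of a n] a n(1) A9 by blast
      then obtain X where "X \<in> standard_partition" "a \<in> X" "n \<in> X" by (auto simp: same_block_def)
      thus "y \<in> \<alpha> ` A" using dj[OF _ A _ a] n by blast
    qed
    thus "\<alpha> ` A \<in> standard_partition" using A' by simp
  qed
  thus thesis using that \<alpha> by blast
qed

text \<open>
  Relabelling rows, columns and symbols independently by labellings that respect the standard
  partition does not leave the ds-isotopism class.
\<close>

lemma ds_isotopicI:
  assumes "block_labelling l1" "block_labelling l2" "block_labelling l3"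
    and "block_labelling m1" "block_labelling m2" "block_labelling m3"
    and eq: "\<And>x y. \<exists>z. L (l1 x) (l2 y) = l3 z \<and> M (m1 x) (m2 y) = m3 z"
  shows "ds_isotopic L M"
proof -
  obtain \<alpha> where \<alpha>: "block_permutation \<alpha>" "\<And>x. \<alpha> (l1 x) = m1 x"
      using block_permutation_between[OF assms(1,4)] by blast
  obtain \<beta> where \<beta>: "block_permutation \<beta>" "\<And>x. \<beta> (l2 x) = m2 x"
      using block_permutation_between[OF assms(2,5)] by blast
  obtain \<gamma> where \<gamma>: "block_permutation \<gamma>" "\<And>x. \<gamma> (l3 x) = m3 x"
      using block_permutation_between[OF assms(3,6)] by blast
  have ex1: "\<exists>x. n = l1 x" and ex2: "\<exists>x. n = l2 x" if "n \<in> {1..9}" for n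
    using that assms(1,2) unfolding block_labelling_def by (metis bij_betw_def imageE)+
  have "M (\<alpha> m) (\<beta> n) = \<gamma> (L m n)" if "m \<in> {1..9}" "n \<in> {1..9}" for m n
    using ex1[OF that(1)] ex2[OF that(2)] eq \<alpha>(2) \<beta>(2) \<gamma>(2) by metis
  thus ?thesis using \<alpha>(1) \<beta>(1) \<gamma>(1) unfolding ds_isotopic_def by blast
qed

lemma block_permutation_inv:
  assumes "block_permutation \<alpha>"
  shows "block_permutation (inv \<alpha>)"
  unfolding block_permutation_def
proof (intro conjI ballI)
  have p: "\<alpha> permutes {1..9}" and im: "\<And>A. A \<in> standard_partition \<Longrightarrow> \<alpha> ` A \<in> standard_partition"
    using assms by (auto simp: block_permutation_def)
  show "inv \<alpha> permutes {1..9}" by (rule permutes_inv[OF p])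
  fix A assume A: "A \<in> standard_partition"
  have inj: "inj \<alpha>" by (rule permutes_inj[OF p])
  have "(`) \<alpha> ` standard_partition = standard_partition"
  proof (rule endo_inj_surj)
    show "finite standard_partition" by (simp add: standard_partition_def)
    show "(`) \<alpha> ` standard_partition \<subseteq> standard_partition" using im by blast
    show "inj_on ((`) \<alpha>) standard_partition" by (rule inj_on_image) (rule inj_on_subset[OF inj
        subset_UNIV])
  qed
  then obtain A' where "A' \<in> standard_partition" "A = \<alpha> ` A'" using A by blast
  thus "inv \<alpha> ` A \<in> standard_partition" using inj by (simp add: image_inv_f_f)
qed

lemma block_permutation_comp: "block_permutation \<alpha> \<Longrightarrow> block_permutation \<beta> \<Longrightarrow> block_permutation (\<alpha> \<circ> \<beta>)"
  unfolding block_permutation_def image_comp[symmetric] by (simp add: permutes_compose)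

lemma block_permutation_id: "block_permutation id"
  by (simp add: block_permutation_def permutes_id)

lemma ds_isotopic_sym:
  assumes "ds_isotopic L M"
  shows "ds_isotopic M L"
proof -
  obtain \<alpha> \<beta> \<gamma> where b: "block_permutation \<alpha>" "block_permutation \<beta>" "block_permutation \<gamma>"
    and eq: "\<forall>x\<in>{1..9}. \<forall>y\<in>{1..9}. M (\<alpha> x) (\<beta> y) = \<gamma> (L x y)"
        using assms unfolding ds_isotopic_def by blast
  have p: "\<alpha> permutes {1..9}" "\<beta> permutes {1..9}" "\<gamma> permutes {1..9}" using b
      by (auto simp: block_permutation_def)
  have "L (inv \<alpha> x) (inv \<beta> y) = inv \<gamma> (M x y)" if "x \<in> {1..9}" "y \<in> {1..9}" for x y
  proof -
    have "inv \<alpha> x \<in> {1..9}" "inv \<beta> y \<in> {1..9}"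
        using that permutes_in_image[OF permutes_inv[OF p(1)]] permutes_in_image[OF
        permutes_inv[OF p(2)]] by blast+
    hence "M (\<alpha> (inv \<alpha> x)) (\<beta> (inv \<beta> y)) = \<gamma> (L (inv \<alpha> x) (inv \<beta> y))" using eq by blast
    thus ?thesis by (simp add: permutes_inverses[OF p(1)] permutes_inverses[OF p(2)]
        permutes_inverses[OF p(3)])
  qed
  thus ?thesis unfolding ds_isotopic_def using b[THEN block_permutation_inv] by blast
qed

lemma ds_isotopic_trans:
  assumes "ds_isotopic L M" "ds_isotopic M N"
  shows "ds_isotopic L N"
proof -
  obtain \<alpha> \<beta> \<gamma> where b: "block_permutation \<alpha>" "block_permutation \<beta>" "block_permutation \<gamma>"
    and eq: "\<forall>x\<in>{1..9}. \<forall>y\<in>{1..9}. M (\<alpha> x) (\<beta> y) = \<gamma> (L x y)"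
        using assms(1) unfolding ds_isotopic_def by blast
  obtain \<alpha>' \<beta>' \<gamma>' where b': "block_permutation \<alpha>'" "block_permutation \<beta>'" "block_permutation \<gamma>'"
    and eq': "\<forall>x\<in>{1..9}. \<forall>y\<in>{1..9}. N (\<alpha>' x) (\<beta>' y) = \<gamma>' (M x y)"
        using assms(2) unfolding ds_isotopic_def by blast
  have "\<alpha> permutes {1..9}" "\<beta> permutes {1..9}" using b(1,2) by (simp_all add: block_permutation_def)
  hence "\<alpha> x \<in> {1..9} \<longleftrightarrow> x \<in> {1..9}" "\<beta> x \<in> {1..9} \<longleftrightarrow> x \<in> {1..9}" for x
    by (simp_all only: permutes_in_image)
  hence "\<forall>x\<in>{1..9}. \<forall>y\<in>{1..9}. N ((\<alpha>' \<circ> \<alpha>) x) ((\<beta>' \<circ> \<beta>) y) = (\<gamma>' \<circ> \<gamma>) (L x y)"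
    unfolding comp_def by (metis eq eq')
  thus ?thesis unfolding ds_isotopic_def
    using block_permutation_comp[OF b'(1) b(1)] block_permutation_comp[OF b'(2) b(2)]
        block_permutation_comp[OF b'(3) b(3)] by blast
qed

lemma equiv_ds_isotopism: "equiv standard_division_sudokus ds_isotopism"
proof (rule equivI)
  show "refl_on standard_division_sudokus ds_isotopism"
    using block_permutation_id by (force simp: refl_on_def ds_isotopism_def ds_isotopic_def)
  show "sym ds_isotopism" using ds_isotopic_sym by (auto simp: sym_def ds_isotopism_def)
  show "trans ds_isotopism" using ds_isotopic_trans unfolding trans_def ds_isotopism_def by blast
qed (auto simp: ds_isotopism_def)

section \<open>Enumeration of the diagonally cyclic squares\<close>

definition rows17 :: "nat list list" where "rows17 = [[1, 4, 7, 2, 5, 8, 3, 6, 9],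
      [8, 2, 5, 9, 3, 6, 7, 1, 4],
      [6, 9, 3, 4, 7, 1, 5, 8, 2],
      [2, 5, 8, 3, 6, 9, 1, 4, 7],
      [9, 3, 6, 7, 1, 4, 8, 2, 5],
      [4, 7, 1, 5, 8, 2, 6, 9, 3],
      [3, 6, 9, 1, 4, 7, 2, 5, 8],
      [7, 1, 4, 8, 2, 5, 9, 3, 6],
      [5, 8, 2, 6, 9, 3, 4, 7, 1]]"

definition rows175 :: "nat list list" where "rows175 = [[1, 4, 7, 2, 5, 9, 3, 8, 6],
      [8, 2, 5, 7, 3, 6, 4, 1, 9],
      [6, 9, 3, 4, 8, 1, 7, 5, 2],
      [2, 5, 9, 6, 1, 7, 8, 3, 4],
      [7, 3, 6, 8, 4, 2, 5, 9, 1],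
      [4, 8, 1, 3, 9, 5, 2, 6, 7],
      [3, 7, 4, 1, 6, 8, 9, 2, 5],
      [5, 1, 8, 9, 2, 4, 6, 7, 3],
      [9, 6, 2, 5, 7, 3, 1, 4, 8]]"

definition rows179 :: "nat list list" where "rows179 = [[1, 4, 7, 2, 5, 9, 3, 8, 6],
      [8, 2, 5, 7, 3, 6, 4, 1, 9],
      [6, 9, 3, 4, 8, 1, 7, 5, 2],
      [2, 6, 8, 1, 9, 4, 5, 7, 3],
      [9, 3, 4, 5, 2, 7, 1, 6, 8],
      [5, 7, 1, 8, 6, 3, 9, 2, 4],
      [3, 8, 6, 9, 1, 5, 2, 4, 7],
      [4, 1, 9, 6, 7, 2, 8, 3, 5],
      [7, 5, 2, 3, 4, 8, 6, 9, 1]]"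

text \<open>
  The partial functions on the given points with value 0 at 0 whose entries are pairwise compatible.
\<close>

primrec extensions :: "pt list \<Rightarrow> (pt \<times> pt) list list" where
  "extensions [] = [[(0, 0)]]"
| "extensions (z # zs) = [(z, w) # g. g \<leftarrow> extensions zs, w \<leftarrow> points, list_all (compatible (z, w)) g]"

definition thetas :: "(pt \<times> pt) list list" where "thetas = extensions (butlast (rev points))"

lemma extensions_complete:
  assumes "\<theta> 0 = 0" "\<And>z z'. z \<noteq> z' \<Longrightarrow> compatible (z, \<theta> z) (z', \<theta> z')"
  shows "distinct zs \<Longrightarrow> 0 \<notin> set zs \<Longrightarrow> map (\<lambda>z. (z, \<theta> z)) (zs @ [0]) \<in> set (extensions zs)"
proof (induction zs)
  case Nil
  thus ?case using assms(1) by (simp add: zero_prod_def)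
next
  case (Cons z zs)
  have "list_all (compatible (z, \<theta> z)) (map (\<lambda>z. (z, \<theta> z)) (zs @ [0]))"
    using Cons.prems by (auto simp: list_all_iff intro!: assms(2))
  moreover have "\<theta> z \<in> set points" by (simp add: set_points)
  ultimately show ?case using Cons by (auto intro!: bexI[of _ "map (\<lambda>z. (z, \<theta> z)) (zs @ [0])"])
qed

text \<open>
  One entry for each element of \<open>thetas\<close>, in the same order: the number of one of the three squares
  and the labellings of its rows, columns and symbols that turn it into \<open>x + \<theta> (y - x)\<close>. The number 17
  belongs exactly to the linear \<open>\<theta>\<close>.
\<close>

definition isotopisms :: "(nat \<times> nat list \<times> nat list \<times> nat list) list" where
  "isotopisms =
  [(17, [1,3,2,5,4,6,9,8,7], [1,3,2,4,6,5,7,9,8], [1,3,2,7,9,8,4,6,5]),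
   (179, [8,9,7,4,5,6,2,3,1], [1,2,3,4,5,6,9,7,8], [4,5,6,1,2,3,9,7,8]),
   (175, [6,5,4,3,2,1,9,8,7], [1,3,2,6,5,4,9,8,7], [4,6,5,1,3,2,8,7,9]),
   (179, [7,8,9,6,4,5,1,2,3], [1,2,3,4,5,6,9,7,8], [3,1,2,8,9,7,6,4,5]),
   (17, [1,2,3,7,8,9,4,5,6], [1,2,3,5,6,4,9,7,8], [1,2,3,4,5,6,7,8,9]),
   (175, [5,6,4,8,9,7,2,3,1], [1,2,3,9,7,8,6,4,5], [7,8,9,3,1,2,6,4,5]),
   (175, [4,6,5,1,3,2,7,9,8], [1,3,2,6,5,4,9,8,7], [2,1,3,9,8,7,5,4,6]),
   (175, [6,4,5,9,7,8,3,1,2], [1,2,3,9,7,8,6,4,5], [4,5,6,8,9,7,1,2,3]),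
   (175, [4,5,6,7,8,9,1,2,3], [1,2,3,9,7,8,6,4,5], [2,3,1,5,6,4,9,7,8]),
   (17, [1,3,2,7,9,8,4,6,5], [1,3,2,6,5,4,8,7,9], [1,3,2,7,9,8,4,6,5]),
   (17, [1,2,3,5,6,4,9,7,8], [1,2,3,6,4,5,8,9,7], [1,2,3,4,5,6,7,8,9]),
   (179, [9,7,8,5,6,4,3,1,2], [1,2,3,4,5,6,9,7,8], [7,8,9,5,6,4,2,3,1]),
   (175, [5,4,6,2,1,3,8,7,9], [1,3,2,6,5,4,9,8,7], [7,9,8,6,5,4,3,2,1]),
   (175, [2,1,3,9,8,7,4,6,5], [1,3,2,4,6,5,8,7,9], [8,7,9,5,4,6,3,2,1]),
   (175, [7,8,9,4,5,6,1,2,3], [1,2,3,6,4,5,9,7,8], [3,1,2,7,8,9,6,4,5]),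
   (179, [6,5,4,3,2,1,8,7,9], [1,3,2,6,5,4,7,9,8], [5,4,6,1,3,2,8,7,9]),
   (179, [4,6,5,3,2,1,7,9,8], [1,3,2,5,4,6,8,7,9], [2,1,3,8,7,9,4,6,5]),
   (175, [9,7,8,4,5,6,2,3,1], [1,2,3,4,5,6,8,9,7], [9,7,8,6,4,5,1,2,3]),
   (179, [5,4,6,3,2,1,9,8,7], [1,3,2,4,6,5,9,8,7], [9,8,7,4,6,5,1,3,2]),
   (175, [3,2,1,9,8,7,6,5,4], [1,3,2,6,5,4,9,8,7], [6,5,4,3,2,1,7,9,8]),
   (175, [9,8,7,3,2,1,6,5,4], [1,3,2,9,8,7,6,5,4], [9,8,7,2,1,3,5,4,6]),
   (179, [3,2,1,9,8,7,5,4,6], [1,3,2,4,6,5,9,8,7], [6,5,4,3,2,1,8,7,9]),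
   (175, [3,1,2,5,6,4,7,8,9], [1,2,3,8,9,7,4,5,6], [6,4,5,9,7,8,1,2,3]),
   (175, [8,7,9,1,3,2,6,5,4], [1,3,2,8,7,9,4,6,5], [5,4,6,8,7,9,3,2,1]),
   (175, [1,2,3,4,5,6,7,8,9], [1,2,3,9,7,8,6,4,5], [1,2,3,4,5,6,8,9,7]),
   (179, [2,1,3,7,9,8,5,4,6], [1,3,2,6,5,4,7,9,8], [8,7,9,5,4,6,1,3,2]),
   (179, [1,3,2,8,7,9,5,4,6], [1,3,2,5,4,6,8,7,9], [1,3,2,7,9,8,6,5,4]),
   (175, [3,2,1,7,9,8,5,4,6], [1,3,2,4,6,5,8,7,9], [6,5,4,1,3,2,9,8,7]),
   (175, [1,3,2,7,9,8,4,6,5], [1,3,2,6,5,4,9,8,7], [1,3,2,8,7,9,4,6,5]),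
   (175, [9,7,8,6,4,5,3,1,2], [1,2,3,6,4,5,9,7,8], [9,7,8,5,6,4,2,3,1]),
   (179, [5,4,6,1,3,2,8,7,9], [1,3,2,5,4,6,8,7,9], [9,8,7,5,4,6,3,2,1]),
   (175, [8,9,7,6,4,5,1,2,3], [1,2,3,4,5,6,8,9,7], [5,6,4,3,1,2,8,9,7]),
   (179, [4,6,5,1,3,2,9,8,7], [1,3,2,6,5,4,7,9,8], [2,1,3,9,8,7,6,5,4]),
   (179, [6,5,4,1,3,2,7,9,8], [1,3,2,4,6,5,9,8,7], [5,4,6,2,1,3,7,9,8]),
   (179, [2,1,3,8,7,9,4,6,5], [1,3,2,4,6,5,9,8,7], [8,7,9,6,5,4,3,2,1]),
   (175, [2,3,1,5,6,4,8,9,7], [1,2,3,9,7,8,6,4,5], [8,9,7,1,2,3,4,5,6]),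
   (175, [7,9,8,3,2,1,5,4,6], [1,3,2,8,7,9,4,6,5], [3,2,1,5,4,6,8,7,9]),
   (179, [1,3,2,9,8,7,4,6,5], [1,3,2,6,5,4,7,9,8], [1,3,2,8,7,9,5,4,6]),
   (179, [3,2,1,7,9,8,4,6,5], [1,3,2,5,4,6,8,7,9], [6,5,4,1,3,2,7,9,8]),
   (175, [1,2,3,6,4,5,8,9,7], [1,2,3,8,9,7,4,5,6], [1,2,3,6,4,5,9,7,8]),
   (175, [8,7,9,2,1,3,5,4,6], [1,3,2,9,8,7,6,5,4], [5,4,6,9,8,7,2,1,3]),
   (175, [4,5,6,9,7,8,2,3,1], [1,2,3,8,9,7,4,5,6], [2,3,1,4,5,6,7,8,9]),
   (17, [1,2,3,9,7,8,5,6,4], [1,2,3,4,5,6,7,8,9], [1,2,3,6,4,5,8,9,7]),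
   (179, [9,7,8,4,5,6,1,2,3], [1,2,3,6,4,5,7,8,9], [7,8,9,4,5,6,3,1,2]),
   (175, [6,4,5,8,9,7,1,2,3], [1,2,3,8,9,7,4,5,6], [4,5,6,7,8,9,2,3,1]),
   (17, [1,3,2,8,7,9,6,5,4], [1,3,2,4,6,5,7,9,8], [1,3,2,8,7,9,6,5,4]),
   (175, [5,6,4,7,8,9,3,1,2], [1,2,3,8,9,7,4,5,6], [7,8,9,2,3,1,4,5,6]),
   (175, [5,4,6,3,2,1,7,9,8], [1,3,2,4,6,5,8,7,9], [7,9,8,4,6,5,2,1,3]),
   (179, [8,9,7,6,4,5,3,1,2], [1,2,3,6,4,5,7,8,9], [4,5,6,3,1,2,7,8,9]),
   (175, [6,5,4,1,3,2,8,7,9], [1,3,2,4,6,5,8,7,9], [4,6,5,2,1,3,7,9,8]),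
   (17, [1,2,3,4,5,6,7,8,9], [1,2,3,5,6,4,9,7,8], [1,2,3,6,4,5,8,9,7]),
   (17, [1,3,2,6,5,4,8,7,9], [1,3,2,5,4,6,9,8,7], [1,3,2,8,7,9,6,5,4]),
   (175, [4,6,5,2,1,3,9,8,7], [1,3,2,4,6,5,8,7,9], [2,1,3,7,9,8,4,6,5]),
   (179, [7,8,9,5,6,4,2,3,1], [1,2,3,6,4,5,7,8,9], [3,1,2,7,8,9,4,5,6]),
   (179, [1,3,2,7,9,8,6,5,4], [1,3,2,4,6,5,9,8,7], [1,3,2,9,8,7,4,6,5]),
   (175, [7,9,8,1,3,2,4,6,5], [1,3,2,9,8,7,6,5,4], [3,2,1,6,5,4,7,9,8]),
   (175, [2,3,1,4,5,6,9,7,8], [1,2,3,8,9,7,4,5,6], [8,9,7,3,1,2,5,6,4]),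
   (179, [3,2,1,8,7,9,6,5,4], [1,3,2,6,5,4,7,9,8], [6,5,4,2,1,3,9,8,7]),
   (179, [2,1,3,9,8,7,6,5,4], [1,3,2,5,4,6,8,7,9], [8,7,9,4,6,5,2,1,3]),
   (175, [9,8,7,2,1,3,4,6,5], [1,3,2,8,7,9,4,6,5], [9,8,7,1,3,2,6,5,4]),
   (175, [3,1,2,6,4,5,9,7,8], [1,2,3,9,7,8,6,4,5], [6,4,5,7,8,9,3,1,2]),
   (17, [1,2,3,6,4,5,8,9,7], [1,2,3,4,5,6,7,8,9], [1,2,3,5,6,4,9,7,8]),
   (179, [7,8,9,4,5,6,3,1,2], [1,2,3,5,6,4,8,9,7], [3,1,2,9,7,8,5,6,4]),
   (179, [9,7,8,6,4,5,2,3,1], [1,2,3,5,6,4,8,9,7], [7,8,9,6,4,5,1,2,3]),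
   (17, [1,3,2,4,6,5,7,9,8], [1,3,2,6,5,4,8,7,9], [1,3,2,9,8,7,5,4,6]),
   (17, [1,2,3,8,9,7,6,4,5], [1,2,3,6,4,5,8,9,7], [1,2,3,5,6,4,9,7,8]),
   (179, [8,9,7,5,6,4,1,2,3], [1,2,3,5,6,4,8,9,7], [4,5,6,2,3,1,8,9,7]),
   (175, [7,8,9,5,6,4,3,1,2], [1,2,3,4,5,6,8,9,7], [3,1,2,8,9,7,5,6,4]),
   (179, [4,6,5,2,1,3,8,7,9], [1,3,2,4,6,5,9,8,7], [2,1,3,7,9,8,5,4,6]),
   (175, [1,3,2,8,7,9,6,5,4], [1,3,2,4,6,5,8,7,9], [1,3,2,9,8,7,6,5,4]),
   (175, [8,9,7,5,6,4,2,3,1], [1,2,3,6,4,5,9,7,8], [5,6,4,2,3,1,9,7,8]),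
   (179, [5,4,6,2,1,3,7,9,8], [1,3,2,6,5,4,7,9,8], [9,8,7,6,5,4,2,1,3]),
   (179, [6,5,4,2,1,3,9,8,7], [1,3,2,5,4,6,8,7,9], [5,4,6,3,2,1,9,8,7]),
   (175, [2,1,3,8,7,9,5,4,6], [1,3,2,6,5,4,9,8,7], [8,7,9,4,6,5,1,3,2]),
   (175, [6,4,5,3,1,2,9,7,8], [1,2,3,6,4,5,9,7,8], [4,5,6,1,2,3,8,9,7]),
   (179, [8,7,9,4,6,5,2,1,3], [1,3,2,4,6,5,9,8,7], [4,6,5,1,3,2,9,8,7]),
   (17, [1,2,3,5,6,4,9,7,8], [1,2,3,4,5,6,7,8,9], [1,2,3,7,8,9,4,5,6]),
   (17, [1,2,3,7,8,9,4,5,6], [1,2,3,6,4,5,8,9,7], [1,2,3,7,8,9,4,5,6]),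
   (175, [6,5,4,9,8,7,3,2,1], [1,3,2,9,8,7,6,5,4], [4,6,5,8,7,9,1,3,2]),
   (175, [4,6,5,7,9,8,1,3,2], [1,3,2,9,8,7,6,5,4], [2,1,3,5,4,6,9,8,7]),
   (175, [4,5,6,1,2,3,7,8,9], [1,2,3,6,4,5,9,7,8], [2,3,1,9,7,8,5,6,4]),
   (175, [5,4,6,8,7,9,2,1,3], [1,3,2,9,8,7,6,5,4], [7,9,8,3,2,1,6,5,4]),
   (17, [1,3,2,7,9,8,4,6,5], [1,3,2,5,4,6,9,8,7], [1,3,2,4,6,5,7,9,8]),
   (179, [7,9,8,6,5,4,1,3,2], [1,3,2,4,6,5,9,8,7], [3,2,1,8,7,9,6,5,4]),
   (175, [5,6,4,2,3,1,8,9,7], [1,2,3,6,4,5,9,7,8], [7,8,9,6,4,5,3,1,2]),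
   (179, [9,8,7,5,4,6,3,2,1], [1,3,2,4,6,5,9,8,7], [7,9,8,5,4,6,2,1,3]),
   (17, [1,3,2,5,4,6,9,8,7], [1,3,2,6,5,4,8,7,9], [1,3,2,4,6,5,7,9,8]),
   (179, [1,2,3,7,8,9,6,4,5], [1,2,3,4,5,6,9,7,8], [1,2,3,9,7,8,4,5,6]),
   (179, [3,1,2,8,9,7,6,4,5], [1,2,3,6,4,5,7,8,9], [6,4,5,2,3,1,9,7,8]),
   (175, [2,1,3,4,6,5,9,8,7], [1,3,2,8,7,9,4,6,5], [8,7,9,3,2,1,5,4,6]),
   (175, [7,8,9,1,2,3,4,5,6], [1,2,3,9,7,8,6,4,5], [3,1,2,6,4,5,7,8,9]),
   (175, [3,2,1,6,5,4,9,8,7], [1,3,2,9,8,7,6,5,4], [6,5,4,7,9,8,3,2,1]),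
   (175, [9,7,8,2,3,1,4,5,6], [1,2,3,8,9,7,4,5,6], [9,7,8,1,2,3,6,4,5]),
   (179, [2,3,1,9,7,8,6,4,5], [1,2,3,5,6,4,8,9,7], [8,9,7,4,5,6,2,3,1]),
   (175, [3,1,2,7,8,9,5,6,4], [1,2,3,4,5,6,8,9,7], [6,4,5,1,2,3,9,7,8]),
   (175, [1,2,3,7,8,9,4,5,6], [1,2,3,6,4,5,9,7,8], [1,2,3,8,9,7,4,5,6]),
   (179, [6,4,5,1,2,3,7,8,9], [1,2,3,4,5,6,9,7,8], [5,6,4,2,3,1,7,8,9]),
   (179, [4,5,6,1,2,3,9,7,8], [1,2,3,6,4,5,7,8,9], [2,3,1,9,7,8,6,4,5]),
   (179, [5,6,4,1,2,3,8,9,7], [1,2,3,5,6,4,8,9,7], [9,7,8,5,6,4,3,1,2]),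
   (175, [8,7,9,6,5,4,1,3,2], [1,3,2,4,6,5,8,7,9], [5,4,6,3,2,1,8,7,9]),
   (175, [9,8,7,6,5,4,3,2,1], [1,3,2,6,5,4,9,8,7], [9,8,7,5,4,6,2,1,3]),
   (175, [3,2,1,5,4,6,7,9,8], [1,3,2,8,7,9,4,6,5], [6,5,4,9,8,7,1,3,2]),
   (179, [3,1,2,9,7,8,5,6,4], [1,2,3,4,5,6,9,7,8], [6,4,5,3,1,2,8,9,7]),
   (175, [9,7,8,3,1,2,6,4,5], [1,2,3,9,7,8,6,4,5], [9,7,8,2,3,1,5,6,4]),
   (179, [2,3,1,7,8,9,5,6,4], [1,2,3,6,4,5,7,8,9], [8,9,7,5,6,4,1,2,3]),
   (175, [1,3,2,4,6,5,7,9,8], [1,3,2,9,8,7,6,5,4], [1,3,2,4,6,5,8,7,9]),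
   (175, [8,9,7,1,2,3,6,4,5], [1,2,3,8,9,7,4,5,6], [5,6,4,8,9,7,3,1,2]),
   (179, [1,2,3,8,9,7,5,6,4], [1,2,3,5,6,4,8,9,7], [1,2,3,7,8,9,6,4,5]),
   (175, [8,7,9,5,4,6,2,1,3], [1,3,2,6,5,4,9,8,7], [5,4,6,2,1,3,9,8,7]),
   (179, [6,4,5,2,3,1,9,7,8], [1,2,3,5,6,4,8,9,7], [5,6,4,3,1,2,9,7,8]),
   (179, [5,6,4,2,3,1,7,8,9], [1,2,3,6,4,5,7,8,9], [9,7,8,6,4,5,2,3,1]),
   (175, [1,2,3,8,9,7,6,4,5], [1,2,3,4,5,6,8,9,7], [1,2,3,9,7,8,6,4,5]),
   (175, [7,9,8,5,4,6,3,2,1], [1,3,2,4,6,5,8,7,9], [3,2,1,8,7,9,5,4,6]),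
   (179, [4,5,6,2,3,1,8,9,7], [1,2,3,4,5,6,9,7,8], [2,3,1,7,8,9,5,6,4]),
   (175, [2,3,1,8,9,7,5,6,4], [1,2,3,6,4,5,9,7,8], [8,9,7,4,5,6,1,2,3]),
   (175, [5,6,4,3,1,2,7,8,9], [1,2,3,4,5,6,8,9,7], [7,8,9,4,5,6,2,3,1]),
   (175, [6,5,4,8,7,9,1,3,2], [1,3,2,8,7,9,4,6,5], [4,6,5,7,9,8,2,1,3]),
   (17, [1,2,3,8,9,7,6,4,5], [1,2,3,4,5,6,7,8,9], [1,2,3,8,9,7,6,4,5]),
   (175, [5,4,6,7,9,8,3,2,1], [1,3,2,8,7,9,4,6,5], [7,9,8,2,1,3,4,6,5]),
   (179, [9,8,7,4,6,5,1,3,2], [1,3,2,6,5,4,7,9,8], [7,9,8,4,6,5,3,2,1]),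
   (17, [1,3,2,9,8,7,5,4,6], [1,3,2,4,6,5,7,9,8], [1,3,2,6,5,4,8,7,9]),
   (175, [4,6,5,9,8,7,2,1,3], [1,3,2,8,7,9,4,6,5], [2,1,3,4,6,5,7,9,8]),
   (17, [1,3,2,4,6,5,7,9,8], [1,3,2,5,4,6,9,8,7], [1,3,2,6,5,4,8,7,9]),
   (179, [8,7,9,6,5,4,3,2,1], [1,3,2,6,5,4,7,9,8], [4,6,5,3,2,1,7,9,8]),
   (175, [6,4,5,1,2,3,8,9,7], [1,2,3,4,5,6,8,9,7], [4,5,6,2,3,1,7,8,9]),
   (175, [4,5,6,2,3,1,9,7,8], [1,2,3,4,5,6,8,9,7], [2,3,1,7,8,9,4,5,6]),
   (179, [7,9,8,5,4,6,2,1,3], [1,3,2,6,5,4,7,9,8], [3,2,1,7,9,8,4,6,5]),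
   (17, [1,2,3,6,4,5,8,9,7], [1,2,3,5,6,4,9,7,8], [1,2,3,8,9,7,6,4,5]),
   (175, [2,3,1,9,7,8,4,5,6], [1,2,3,4,5,6,8,9,7], [8,9,7,5,6,4,3,1,2]),
   (175, [3,1,2,9,7,8,6,4,5], [1,2,3,6,4,5,9,7,8], [6,4,5,3,1,2,7,8,9]),
   (179, [4,5,6,3,1,2,7,8,9], [1,2,3,5,6,4,8,9,7], [2,3,1,8,9,7,4,5,6]),
   (179, [5,6,4,3,1,2,9,7,8], [1,2,3,4,5,6,9,7,8], [9,7,8,4,5,6,1,2,3]),
   (175, [9,8,7,4,6,5,2,1,3], [1,3,2,4,6,5,8,7,9], [9,8,7,6,5,4,1,3,2]),
   (179, [6,4,5,3,1,2,8,9,7], [1,2,3,6,4,5,7,8,9], [5,6,4,1,2,3,8,9,7]),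
   (175, [7,9,8,4,6,5,1,3,2], [1,3,2,6,5,4,9,8,7], [3,2,1,7,9,8,6,5,4]),
   (179, [7,9,8,4,6,5,3,2,1], [1,3,2,5,4,6,8,7,9], [3,2,1,9,8,7,5,4,6]),
   (17, [1,3,2,6,5,4,8,7,9], [1,3,2,4,6,5,7,9,8], [1,3,2,5,4,6,9,8,7]),
   (17, [1,2,3,4,5,6,7,8,9], [1,2,3,6,4,5,8,9,7], [1,2,3,9,7,8,5,6,4]),
   (179, [9,8,7,6,5,4,2,1,3], [1,3,2,5,4,6,8,7,9], [7,9,8,6,5,4,1,3,2]),
   (179, [8,7,9,5,4,6,1,3,2], [1,3,2,5,4,6,8,7,9], [4,6,5,2,1,3,8,7,9]),
   (17, [1,3,2,8,7,9,6,5,4], [1,3,2,6,5,4,8,7,9], [1,3,2,5,4,6,9,8,7]),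
   (175, [2,1,3,5,4,6,8,7,9], [1,3,2,9,8,7,6,5,4], [8,7,9,1,3,2,4,6,5]),
   (175, [7,8,9,3,1,2,5,6,4], [1,2,3,8,9,7,4,5,6], [3,1,2,5,6,4,8,9,7]),
   (179, [2,3,1,8,9,7,4,5,6], [1,2,3,4,5,6,9,7,8], [8,9,7,6,4,5,3,1,2]),
   (179, [1,2,3,9,7,8,4,5,6], [1,2,3,6,4,5,7,8,9], [1,2,3,8,9,7,5,6,4]),
   (175, [1,3,2,6,5,4,8,7,9], [1,3,2,8,7,9,4,6,5], [1,3,2,6,5,4,9,8,7]),
   (175, [8,9,7,2,3,1,5,6,4], [1,2,3,9,7,8,6,4,5], [5,6,4,9,7,8,2,3,1]),
   (179, [3,1,2,7,8,9,4,5,6], [1,2,3,5,6,4,8,9,7], [6,4,5,1,2,3,7,8,9])]"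

fun representative :: "nat \<Rightarrow> nat list list" where
  "representative k = (if k = 17 then rows17 else if k = 175 then rows175 else rows179)"

text \<open>
  The pair \<open>(z, w)\<close> stands for \<open>\<theta> z = w\<close>. Writing \<open>y = x + z\<close>, the entry of the square in row \<open>x\<close> and
  column \<open>y\<close> is \<open>x + w\<close>.
\<close>

fun isotopism_to :: "(pt \<times> pt) list \<Rightarrow> nat \<times> nat list \<times> nat list \<times> nat list \<Rightarrow> bool" where
  "isotopism_to g (k, as, bs, cs) \<longleftrightarrow> block_list as \<and> block_list bs \<and> block_list cs \<and>
    (let rows = representative k in
    list_all (\<lambda>(z, w). list_all (\<lambda>x. rows ! (entry as x - 1) ! (entry bs (x + z) - 1) =
        entry cs (x + w)) points) g)"

lemma DS_rows: "DS_9_17 = array_of_rows rows17" "DS_9_175 = array_of_rows rows175"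
    "DS_9_179 = array_of_rows rows179"
  by (simp_all only: DS_9_17_def DS_9_175_def DS_9_179_def rows17_def rows175_def rows179_def)

lemma thetas_certified: "list_all2 isotopism_to thetas isotopisms"
  by code_simp

lemma list_all2_in_set: "list_all2 P xs ys \<Longrightarrow> x \<in> set xs \<Longrightarrow> \<exists>y. P x y"
  by (auto simp: list_all2_conv_all_nth in_set_conv_nth)

lemma theta_certificate:
  assumes "\<theta> 0 = 0" "\<And>z z'. z \<noteq> z' \<Longrightarrow> compatible (z, \<theta> z) (z', \<theta> z')"
  shows "\<exists>M\<in>{DS_9_17, DS_9_175, DS_9_179}. \<exists>a b c. block_labelling a \<and> block_labelling b \<and>
      block_labelling c \<and>
    (\<forall>x y. M (a x) (b y) = c (x + \<theta> (y - x)))"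
proof -
  define zs where "zs = butlast (rev points)"
  have "distinct zs" "0 \<notin> set zs" and zs: "set (zs @ [0]) = UNIV"
    unfolding zs_def UNIV_pt by (auto simp: points_eq zero_prod_def)
  hence "map (\<lambda>z. (z, \<theta> z)) (zs @ [0]) \<in> set thetas"
    unfolding thetas_def zs_def[symmetric] by (intro extensions_complete assms)
  from list_all2_in_set[OF thetas_certified this]
  obtain cert where cert: "isotopism_to (map (\<lambda>z. (z, \<theta> z)) (zs @ [0])) cert" ..
  obtain k as bs cs where kabc: "cert = (k, as, bs, cs)" by (cases cert)
  have bl: "block_list as" "block_list bs" "block_list cs" using cert by (simp_all add: kabc)
  have eq: "representative k ! (entry as x - 1) ! (entry bs (x + z) - 1) = entry cs (x + \<theta> z)" for x z
  proof -
    have "(z, \<theta> z) \<in> set (map (\<lambda>z. (z, \<theta> z)) (zs @ [0]))" "x \<in> set points" using zs set_points by auto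
    thus ?thesis using cert unfolding kabc isotopism_to.simps Let_def list_all_iff by fast
  qed
  note lab = bl[THEN block_list_labelling]
  have rng: "entry as x \<in> {1..9}" "entry bs x \<in> {1..9}" for x
    using lab(1,2) unfolding block_labelling_def by (metis UNIV_I bij_betwE)+
  have val: "array_of_rows (representative k) (entry as x) (entry bs y) =
      entry cs (x + \<theta> (y - x))" for x y
    using eq[of x "y - x"] rng[of x] rng[of y] by (simp add: array_of_rows_def)
  have mem: "array_of_rows (representative k) \<in> {DS_9_17, DS_9_175, DS_9_179}"
    by (simp add: DS_rows)
  show ?thesis
    by (rule bexI[OF _ mem], rule exI[of _ "entry as"], rule exI[of _ "entry bs"],
        rule exI[of _ "entry cs"])
      (intro conjI allI lab val)
qed

text \<open>
  Labels adapted to both partitions bring the square into the form \<open>x + \<theta> (y - x)\<close>; the list of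
  isotopisms then leads to one of the three squares.
\<close>

theorem two_partitions_isotopic:
  assumes L: "division_sudoku standard_partition L" and Q: "division_sudoku Q L" and ne:
      "standard_partition \<noteq> Q"
  shows "\<exists>M\<in>{DS_9_17, DS_9_175, DS_9_179}. ds_isotopic L M"
proof -
  have s: "sudoku_partition standard_partition" "sudoku_partition Q" using L Q
      by (auto simp: division_sudoku_def)
  obtain x0 x1 x2 x3 x4 x5 x6 x7 x8 where x: "distinct [x0,x1,x2,x3,x4,x5,x6,x7,x8]"
      "set [x0,x1,x2,x3,x4,x5,x6,x7,x8] = {1..9}"
          "standard_partition = {{x0,x1,x2},{x3,x4,x5},{x6,x7,x8}}"
      "Q = {{x0,x3,x6},{x1,x4,x7},{x2,x5,x8}}"
    using orthogonal_labels[OF s distinct_division_partitions_orthogonal[OF L Q ne]]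
        by (elim exE conjE) (rule that)
  define lam where "lam = entry [x0,x1,x2,x3,x4,x5,x6,x7,x8]"
  have lam: "bij_betw lam UNIV {1..9}" unfolding lam_def by (rule bij_betw_entry[OF x(1,2)])
  have cl: "classes lam fst = standard_partition" "classes lam snd = Q" unfolding lam_def x(3,4)
      by (rule classes_fst classes_snd)+
  have bl: "block_labelling lam" by (rule labelling_of_standard_partition[OF lam cl(1)])
  have bi: "six_factor_array (coordinates (triples lam L))"
    using triples_latin_divided[OF lam, of fst L] triples_latin_divided[OF lam, of snd L] L Q
        unfolding cl
    by (intro six_factor_array_coordinates) auto
  obtain B G \<theta> where BG: "bij B" "bij G" "\<And>x y :: pt. fst (B x) = fst (B y) \<longleftrightarrow> fst x = fst y"
    "\<And>x y :: pt. fst (G x) = fst (G y) \<longleftrightarrow> fst x = fst y" and \<theta>: "\<theta> 0 = 0"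
    and tr: "\<And>x y z. (x, B y, G z) \<in> triples lam L \<longleftrightarrow> z = x + \<theta> (y - x)"
    and co: "\<And>z z'. z \<noteq> z' \<Longrightarrow> compatible (z, \<theta> z) (z', \<theta> z')"
    by (rule normal_form[OF bi]) blast
  obtain M a b c where M: "M \<in> {DS_9_17, DS_9_175, DS_9_179}" and lab: "block_labelling a"
      "block_labelling b"
    "block_labelling c" and eq: "\<forall>x y. M (a x) (b y) = c (x + \<theta> (y - x))"
  proof -
    have "\<exists>M\<in>{DS_9_17, DS_9_175, DS_9_179}. \<exists>a b c. block_labelling a \<and> block_labelling b \<and>
        block_labelling c \<and>
        (\<forall>x y. M (a x) (b y) = c (x + \<theta> (y - x)))"
      by (rule theta_certificate[of \<theta>, OF \<theta>]) (rule co)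
    thus thesis by (elim bexE exE conjE) (rule that)
  qed
  have "ds_isotopic L M"
  proof (rule ds_isotopicI[OF bl block_labelling_comp[OF bl BG(1,3)] block_labelling_comp[OF bl
      BG(2,4)] lab])
    fix x y
    have "(x, B y, G (x + \<theta> (y - x))) \<in> triples lam L" by (simp add: tr)
    thus "\<exists>z. L (lam x) ((lam \<circ> B) y) = (lam \<circ> G) z \<and> M (a x) (b y) = c z"
      by (intro exI[of _ "x + \<theta> (y - x)"]) (simp add: triples_def eq)
  qed
  thus ?thesis using M by blast
qed

section \<open>At most four partitions\<close>

definition division_partitions :: "(nat \<Rightarrow> nat \<Rightarrow> nat) \<Rightarrow> nat set set set" where
  "division_partitions L = {P. division_sudoku P L}"

lemma sigma_eq: "sigma L = card (division_partitions L)"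
  unfolding sigma_def division_partitions_def by (rule arg_cong[of _ _ card]) (auto simp:
      division_sudoku_def)

lemma finite_division_partitions: "finite (division_partitions L)"
proof (rule finite_subset)
  show "division_partitions L \<subseteq> Pow (Pow {1..9})"
    by (auto simp: division_partitions_def division_sudoku_def sudoku_partition_def partition_on_def)
qed simp

definition block_at :: "nat set set \<Rightarrow> nat \<Rightarrow> nat set" where "block_at P n = (THE A. A \<in> P \<and> n \<in> A)"

lemma block_at:
  assumes "sudoku_partition P" "n \<in> {1..9}"
  shows "block_at P n \<in> P" "n \<in> block_at P n" "A \<in> P \<Longrightarrow> n \<in> A \<Longrightarrow> block_at P n = A"
proof -
  have part: "partition_on {1..9} P" using assms(1) by (simp add: sudoku_partition_def)
  obtain A0 where A0: "A0 \<in> P" "n \<in> A0" using partition_onD1[OF part] assms(2) by blast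
  have uniq: "B = C" if "B \<in> P" "n \<in> B" "C \<in> P" "n \<in> C" for B C
    using disjointD[OF partition_onD2[OF part] that(1,3)] that by blast
  have eq: "block_at P n = B" if "B \<in> P" "n \<in> B" for B
    unfolding block_at_def by (rule the_equality) (use that uniq in auto)
  show "block_at P n \<in> P" "n \<in> block_at P n" using eq[OF A0] A0 by auto
  show "A \<in> P \<Longrightarrow> n \<in> A \<Longrightarrow> block_at P n = A" by (rule eq)
qed

lemma block_at_meet:
  assumes "P \<in> division_partitions L" "Q \<in> division_partitions L" "P \<noteq> Q" "n \<in> {1..9}"
  shows "block_at P n \<inter> block_at Q n = {n}"
proof -
  have PQ: "division_sudoku P L" "division_sudoku Q L" using assms
      by (auto simp: division_partitions_def)
  hence s: "sudoku_partition P" "sudoku_partition Q" by (auto simp: division_sudoku_def)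
  have "card (block_at P n \<inter> block_at Q n) = 1"
    using distinct_division_partitions_orthogonal[OF PQ assms(3)] block_at(1)[OF s(1) assms(4)]
        block_at(1)[OF s(2) assms(4)] by blast
  then obtain m where m: "block_at P n \<inter> block_at Q n = {m}" by (rule card_1_singletonE)
  have "n \<in> block_at P n \<inter> block_at Q n" using block_at(2)[OF s(1) assms(4)] block_at(2)[OF s(2)
      assms(4)] by (rule IntI)
  thus ?thesis unfolding m by simp
qed

lemma card_block_at: "P \<in> division_partitions L \<Longrightarrow> n \<in> {1..9} \<Longrightarrow>
    card (block_at P n) = 3 \<and> block_at P n \<subseteq> {1..9}"
  using block_at(1)[of P n] by (auto simp: division_partitions_def division_sudoku_def
      sudoku_partition_def partition_on_def)

text \<open>
  A partition in \<open>division_partitions L\<close> is determined by its block through a given point, because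
  blocks of different partitions share at most one point.
\<close>

lemma inj_on_block_at:
  assumes "n \<in> {1..9}"
  shows "inj_on (\<lambda>P. block_at P n) (division_partitions L)"
proof (rule inj_onI, rule ccontr)
  fix P Q assume PQ: "P \<in> division_partitions L" "Q \<in> division_partitions L"
      "block_at P n = block_at Q n" "P \<noteq> Q"
  have "card (block_at P n) = 1" using block_at_meet[OF PQ(1,2,4) assms] PQ(3) by simp
  thus False using card_block_at[OF PQ(1) assms] by simp
qed

text \<open>
  The blocks through 1, with this point removed, are disjoint pairs in a set of eight points.
\<close>

lemma sigma_le_4: "sigma L \<le> 4"
proof -
  let ?D = "division_partitions L" and ?f = "\<lambda>P. block_at P 1 - {1}"
  have one: "(1::nat) \<in> {1..9}" by simp
  have c: "card (?f P) = 2" "?f P \<subseteq> {2..9}" "finite (?f P)" if P: "P \<in> ?D" for P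
  proof -
    have "1 \<in> block_at P 1" using P block_at(2)[of P 1]
        by (auto simp: division_partitions_def division_sudoku_def)
    moreover have "finite (block_at P 1)" using card_block_at[OF P one] finite_subset by blast
    ultimately show "card (?f P) = 2" "finite (?f P)" using card_block_at[OF P one] by auto
    show "?f P \<subseteq> {2..9}"
    proof
      fix y assume "y \<in> ?f P"
      hence "y \<in> {1..9}" "y \<noteq> 1" using card_block_at[OF P one] by auto
      thus "y \<in> {2..9}" by auto
    qed
  qed
  have "card (\<Union>P\<in>?D. ?f P) = (\<Sum>P\<in>?D. card (?f P))"
  proof (rule card_UN_disjoint)
    show "\<forall>P\<in>?D. \<forall>Q\<in>?D. P \<noteq> Q \<longrightarrow> ?f P \<inter> ?f Q = {}" using block_at_meet[OF _ _ _ one] by blast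
  qed (use c finite_division_partitions in auto)
  also have "\<dots> = 2 * card ?D" using c(1) by simp
  finally have "2 * card ?D = card (\<Union>P\<in>?D. ?f P)" by simp
  also have "\<dots> \<le> card {2..9::nat}" by (rule card_mono) (use c(2) in blast)+
  finally show ?thesis by (simp add: sigma_eq)
qed

section \<open>Explicit squares\<close>

definition cell :: "nat list list \<Rightarrow> nat \<Rightarrow> nat \<Rightarrow> nat" where "cell rows x y = rows ! (x - 1) ! (y - 1)"

definition digits :: "nat list" where "digits = [1,2,3,4,5,6,7,8,9]"

definition latin_rows :: "nat list list \<Rightarrow> bool" where
  "latin_rows rows \<longleftrightarrow> list_all (\<lambda>x. list_all (\<lambda>y. cell rows x y \<in> set digits \<and>
     list_ex (\<lambda>z. cell rows x z = y) digits \<and> list_ex (\<lambda>z. cell rows z x = y) digits) digits) digits"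

definition divided_rows :: "nat list list \<Rightarrow> nat list list \<Rightarrow> bool" where
  "divided_rows rows blocks \<longleftrightarrow> list_all (\<lambda>A. list_all (\<lambda>B. list_all (\<lambda>n.
     list_ex (\<lambda>x. list_ex (\<lambda>y. cell rows x y = n) B) A \<and> list_ex (\<lambda>x. cell rows x n \<in> set B) A \<and>
     list_ex (\<lambda>y. cell rows n y \<in> set B) A) digits) blocks) blocks"

lemma set_digits: "set digits = {1..9}"
  unfolding interval_1_9 digits_def by simp

lemma division_sudoku_rows:
  assumes latin: "latin_rows rows" and div: "divided_rows rows blocks" and part: "sudoku_partition
      (set (map set blocks))"
  shows "division_sudoku (set (map set blocks)) (array_of_rows rows)"
proof -
  have val: "array_of_rows rows x y = cell rows x y" if "x \<in> {1..9}" "y \<in> {1..9}" for x y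
    using that by (simp add: array_of_rows_def cell_def)
  have rng: "cell rows x y \<in> {1..9}" and rows: "\<exists>z\<in>{1..9}. cell rows x z =
      y" and cols: "\<exists>z\<in>{1..9}. cell rows z x = y"
    if "x \<in> {1..9}" "y \<in> {1..9}" for x y
    using latin that unfolding latin_rows_def list_all_iff list_ex_iff set_digits by blast+
  have "latin_square {1..9} (array_of_rows rows)"
    unfolding latin_square_def
  proof (intro conjI ballI)
    show "array_of_rows rows \<in> {1..9} \<rightarrow>\<^sub>E {1..9} \<rightarrow>\<^sub>E {1..9}"
      using rng by (auto simp: array_of_rows_def cell_def PiE_iff)
    fix x :: nat assume x: "x \<in> {1..9}"
    show "(\<lambda>y. array_of_rows rows x y) ` {1..9} = {1..9}"
      using val[OF x] rng[OF x] rows[OF x] by (auto simp: image_iff) (metis+)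
    show "(\<lambda>y. array_of_rows rows y x) ` {1..9} = {1..9}"
      using val[OF _ x] rng[OF _ x] cols[OF x] by (auto simp: image_iff) (metis+)
  qed
  moreover have "(\<forall>n\<in>{1..9}. \<exists>x y. (x, y, n) \<in> band {1..9} (array_of_rows rows) A \<inter> stack {1..9}
      (array_of_rows rows) B) \<and>
      (\<forall>n\<in>{1..9}. \<exists>x z. (x, n, z) \<in> band {1..9} (array_of_rows rows) A \<inter> pile {1..9}
          (array_of_rows rows) B) \<and>
      (\<forall>n\<in>{1..9}. \<exists>y z. (n, y, z) \<in> stack {1..9} (array_of_rows rows) A \<inter> pile {1..9}
          (array_of_rows rows) B)"
    if "A \<in> set (map set blocks)" "B \<in> set (map set blocks)" for A B
  proof -
    have sub: "A \<subseteq> {1..9}" "B \<subseteq> {1..9}" using that part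
        unfolding sudoku_partition_def partition_on_def by blast+
    have d: "\<exists>x\<in>A. \<exists>y\<in>B. cell rows x y = n" "\<exists>x\<in>A. cell rows x n \<in> B"
        "\<exists>y\<in>A. cell rows n y \<in> B" if "n \<in> {1..9}" for n
      using div that \<open>A \<in> set (map set blocks)\<close> \<open>B \<in> set (map set blocks)\<close>
      unfolding divided_rows_def list_all_iff list_ex_iff set_digits set_map by blast+
    have in_oa: "(x, y, cell rows x y) \<in> orthogonal_array {1..9} (array_of_rows rows)"
        if "x \<in> {1..9}" "y \<in> {1..9}" for x y
      unfolding orthogonal_array_def val[OF that, symmetric] using that by blast
    show ?thesis
    proof (intro conjI ballI)
      fix n :: nat assume n: "n \<in> {1..9}"
      obtain x y where xy: "x \<in> A" "y \<in> B" "cell rows x y = n" using d(1)[OF n] by blast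
      have "(x, y, cell rows x y) \<in> orthogonal_array {1..9} (array_of_rows rows)" using xy sub
          by (intro in_oa) blast+
      hence "(x, y, n) \<in> band {1..9} (array_of_rows rows) A \<inter> stack {1..9} (array_of_rows rows) B"
        using xy by (simp add: band_def stack_def)
      thus "\<exists>x y. (x, y, n) \<in> band {1..9} (array_of_rows rows) A \<inter> stack {1..9} (array_of_rows
          rows) B" by blast
      obtain x where x: "x \<in> A" "cell rows x n \<in> B" using d(2)[OF n] by blast
      have "(x, n, cell rows x n) \<in> orthogonal_array {1..9} (array_of_rows rows)" using x sub n
          by (intro in_oa) blast+
      hence "(x, n, cell rows x n) \<in> band {1..9} (array_of_rows rows) A \<inter> pile {1..9}
          (array_of_rows rows) B"
        using x by (simp add: band_def pile_def)
      thus "\<exists>x z. (x, n, z) \<in> band {1..9} (array_of_rows rows) A \<inter> pile {1..9} (array_of_rows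
          rows) B" by blast
      obtain y where y: "y \<in> A" "cell rows n y \<in> B" using d(3)[OF n] by blast
      have "(n, y, cell rows n y) \<in> orthogonal_array {1..9} (array_of_rows rows)" using y sub n
          by (intro in_oa) blast+
      hence "(n, y, cell rows n y) \<in> stack {1..9} (array_of_rows rows) A \<inter> pile {1..9}
          (array_of_rows rows) B"
        using y by (simp add: stack_def pile_def)
      thus "\<exists>y z. (n, y, z) \<in> stack {1..9} (array_of_rows rows) A \<inter> pile {1..9} (array_of_rows
          rows) B" by blast
    qed
  qed
  ultimately show ?thesis using part by (simp only: division_sudoku_def) blast
qed

text \<open>
  In each case the points of the plane are numbered line by line and the square is
  \<open>x + \<theta> (y - x)\<close>, the first row listing the values of \<open>\<theta>\<close>. The \<open>\<theta>\<close> are chosen such that parallel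
  classes of lines are division partitions: all four of \<open>line_partitions\<close> in the first and third
  square, the first three of them in the second.
\<close>

definition witness17 :: "nat list list" where "witness17 =
     [[1, 5, 9, 2, 6, 7, 3, 4, 8],
      [7, 2, 6, 8, 3, 4, 9, 1, 5],
      [4, 8, 3, 5, 9, 1, 6, 7, 2],
      [6, 7, 2, 4, 8, 3, 5, 9, 1],
      [3, 4, 8, 1, 5, 9, 2, 6, 7],
      [9, 1, 5, 7, 2, 6, 8, 3, 4],
      [8, 3, 4, 9, 1, 5, 7, 2, 6],
      [5, 9, 1, 6, 7, 2, 4, 8, 3],
      [2, 6, 7, 3, 4, 8, 1, 5, 9]]"

definition witness175 :: "nat list list" where "witness175 =
     [[1, 5, 8, 2, 9, 4, 3, 7, 6],
      [9, 2, 6, 5, 3, 7, 4, 1, 8],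
      [4, 7, 3, 8, 6, 1, 9, 5, 2],
      [6, 1, 9, 4, 8, 2, 5, 3, 7],
      [7, 4, 2, 3, 5, 9, 8, 6, 1],
      [3, 8, 5, 7, 1, 6, 2, 9, 4],
      [8, 6, 1, 9, 4, 3, 7, 2, 5],
      [2, 9, 4, 1, 7, 5, 6, 8, 3],
      [5, 3, 7, 6, 2, 8, 1, 4, 9]]"

definition witness179 :: "nat list list" where "witness179 =
     [[1, 5, 8, 2, 4, 7, 3, 9, 6],
      [9, 2, 6, 8, 3, 5, 4, 1, 7],
      [4, 7, 3, 6, 9, 1, 8, 5, 2],
      [6, 3, 9, 4, 8, 2, 5, 7, 1],
      [7, 4, 1, 3, 5, 9, 2, 6, 8],
      [2, 8, 5, 7, 1, 6, 9, 3, 4],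
      [8, 1, 4, 9, 6, 3, 7, 2, 5],
      [5, 9, 2, 1, 7, 4, 6, 8, 3],
      [3, 6, 7, 5, 2, 8, 1, 4, 9]]"

definition transversals :: "nat list list" where
  "transversals = [[d, e, f]. d \<leftarrow> [1,2,3], e \<leftarrow> [4,5,6], f \<leftarrow> [7,8,9]]"

lemma in_transversals: "d \<in> {1,2,3} \<Longrightarrow> e \<in> {4,5,6} \<Longrightarrow> f \<in> {7,8,9} \<Longrightarrow> [d, e, f] \<in> set transversals"
  unfolding transversals_def by (elim insertE emptyE; hypsubst; simp)

text \<open>
  The conditions that a division partition with blocks \<open>A\<close>, \<open>B\<close>, \<open>C\<close> imposes on these blocks
  alone, where \<open>A\<close> is a set of rows, \<open>B\<close> of columns and \<open>C\<close> of symbols.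
\<close>

definition divided_by_triple :: "nat list list \<Rightarrow> nat list \<Rightarrow> nat list \<Rightarrow> nat list \<Rightarrow> bool" where
  "divided_by_triple rows A B C \<longleftrightarrow>
     list_all (\<lambda>n. list_ex (\<lambda>x. list_ex (\<lambda>y. cell rows x y = n) B) A) digits \<and>
     list_all (\<lambda>n. list_ex (\<lambda>x. cell rows x n \<in> set C) A \<and> list_ex (\<lambda>y. cell rows n y \<in> set C) B) digits"

text \<open>
  Among the nine transversals of the standard partition through row 1 of \<open>DS(9,175)\<close> only
  \<open>{1, 4, 7}\<close> and \<open>{1, 6, 8}\<close> can be blocks of rows.
\<close>

lemma row_triples_175:
  "list_all (\<lambda>b. list_all (\<lambda>c. (b, c) \<in> set [(4,7),(6,8)] \<or> list_all (\<lambda>B. list_all (\<lambda>C.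
     \<not> divided_by_triple rows175 [1, b, c] B C) transversals) transversals) [7,8,9]) [4,5,6]"
  by code_simp

lemma array_of_rows_cell:
  assumes "x \<in> {1..9}" "y \<in> {1..9}"
  shows "array_of_rows rows x y = cell rows x y"
  using assms by (simp add: array_of_rows_def cell_def)

lemma transversal_preimage:
  assumes \<delta>: "block_permutation \<delta>" and one: "\<forall>B\<in>standard_partition. card (A \<inter> B) = 1" and A: "card A = 3"
  shows "\<exists>d\<in>{1,2,3}. \<exists>e\<in>{4,5,6}. \<exists>f\<in>{7,8,9}. A = \<delta> ` {d, e, f}"
proof -
  have inj: "inj \<delta>" using \<delta> permutes_inj by (auto simp: block_permutation_def)
  have "\<exists>d\<in>B. \<delta> d \<in> A" if "B \<in> standard_partition" for B
  proof -
    have "\<delta> ` B \<in> standard_partition" using \<delta> that by (simp add: block_permutation_def)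
    hence "card (A \<inter> \<delta> ` B) = 1" using one by blast
    then obtain v where "A \<inter> \<delta> ` B = {v}" by (rule card_1_singletonE)
    hence "v \<in> A" "v \<in> \<delta> ` B" by auto
    thus ?thesis by blast
  qed
  note hit = this
  have std: "{1,2,3} \<in> standard_partition" "{4,5,6} \<in> standard_partition" "{7,8,9} \<in> standard_partition"
    by (simp_all add: standard_partition_def)
  obtain d where d: "d \<in> {1,2,3}" "\<delta> d \<in> A" using hit[OF std(1)] by blast
  obtain e where e: "e \<in> {4,5,6}" "\<delta> e \<in> A" using hit[OF std(2)] by blast
  obtain f where f: "f \<in> {7,8,9}" "\<delta> f \<in> A" using hit[OF std(3)] by blast
  note def = d(1) e(1) f(1) d(2) e(2) f(2)
  have "d \<noteq> e" "e \<noteq> f" "d \<noteq> f" using def(1-3) by auto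
  hence "card (\<delta> ` {d, e, f}) = 3" using inj by (simp add: inj_eq[OF inj])
  moreover have "finite A" using A card.infinite by fastforce
  moreover have "\<delta> ` {d, e, f} \<subseteq> A" using def by simp
  ultimately have "A = \<delta> ` {d, e, f}" using A by (metis card_subset_eq)
  thus ?thesis using def(1-3) by blast
qed

text \<open>
  A division partition of an isotopic square need not be a division partition of \<open>DS(9,175)\<close>, since the
  isotopism moves rows, columns and symbols differently. Its block through the image of row 1, pulled
  back separately to rows, columns and symbols, yields however three transversals that satisfy
  \<open>divided_by_triple\<close>. With the standard partition there remain three possible blocks.
\<close>

lemma sigma_175_le_3:
  assumes iso: "ds_isotopic DS_9_175 L" and L: "division_sudoku standard_partition L"
  shows "sigma L \<le> 3"
proof -
  obtain \<alpha> \<beta> \<gamma> where b: "block_permutation \<alpha>" "block_permutation \<beta>" "block_permutation \<gamma>"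
    and eq0: "\<forall>x\<in>{1..9}. \<forall>y\<in>{1..9}. L (\<alpha> x) (\<beta> y) = \<gamma> (DS_9_175 x y)"
        using iso unfolding ds_isotopic_def by blast
  have p: "\<alpha> permutes {1..9}" "\<beta> permutes {1..9}" "\<gamma> permutes {1..9}" using b
      by (auto simp: block_permutation_def)
  have eq: "L (\<alpha> x) (\<beta> y) = \<gamma> (cell rows175 x y)" if "x \<in> {1..9}" "y \<in> {1..9}" for x y
    using eq0 that array_of_rows_cell[OF that] by (simp add: DS_rows)
  have \<alpha>1: "\<alpha> 1 \<in> {1..9}" using permutes_in_image[OF p(1), of 1] by simp
  have "block_at P (\<alpha> 1) \<in> {\<alpha> ` {1,2,3}, \<alpha> ` {1,4,7},
      \<alpha> ` {1,6,8}}" if P: "P \<in> division_partitions L" for P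
  proof (cases "P = standard_partition")
    case True
    have "\<alpha> ` {1,2,3} \<in> standard_partition" using b(1)
        by (simp add: block_permutation_def standard_partition_def)
    hence "block_at P (\<alpha> 1) = \<alpha> ` {1,2,3}"
      using P True by (intro block_at(3) \<alpha>1) (auto simp: division_partitions_def division_sudoku_def)
    thus ?thesis by simp
  next
    case False
    define A where "A = block_at P (\<alpha> 1)"
    have dP: "division_sudoku P L" using P by (simp add: division_partitions_def)
    hence sP: "sudoku_partition P" by (simp add: division_sudoku_def)
    have A: "A \<in> P" "\<alpha> 1 \<in> A" using block_at(1,2)[OF sP \<alpha>1] by (simp_all add: A_def)
    have one: "\<forall>B\<in>standard_partition. card (A \<inter> B) = 1"
      using distinct_division_partitions_orthogonal[OF dP L False] A(1) by blast
    have A3: "card A = 3" using sP A(1) by (simp add: sudoku_partition_def)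
    obtain a b' c where a: "a \<in> {1,2,3}" "b' \<in> {4,5,6}" "c \<in> {7,8,9}" "A = \<alpha> ` {a, b', c}"
      using transversal_preimage[OF b(1) one A3] by (elim bexE) (rule that)
    have "1 \<in> {a, b', c}" using A(2) unfolding a(4)
        by (simp add: inj_image_mem_iff[OF permutes_inj[OF p(1)]] del: image_insert)
    hence a1: "a = 1" using a(2,3) by auto
    obtain d e f where d: "d \<in> {1,2,3}" "e \<in> {4,5,6}" "f \<in> {7,8,9}" "A = \<beta> ` {d, e, f}"
      using transversal_preimage[OF b(2) one A3] by (elim bexE) (rule that)
    obtain g h i where g: "g \<in> {1,2,3}" "h \<in> {4,5,6}" "i \<in> {7,8,9}" "A = \<gamma> ` {g, h, i}"
      using transversal_preimage[OF b(3) one A3] by (elim bexE) (rule that)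
    have sub: "{1, b', c} \<subseteq> {1..9}" "{d, e, f} \<subseteq> {1..9}"
    proof -
      have "b' \<in> {1..9}" "c \<in> {1..9}" "d \<in> {1..9}" "e \<in> {1..9}" "f \<in> {1..9}"
        using a(2) by (auto, use a(3) in auto, use d(1) in auto, use d(2) in auto, use d(3) in auto)
      thus "{1, b', c} \<subseteq> {1..9}" "{d, e, f} \<subseteq> {1..9}" by simp_all
    qed
    have A\<alpha>: "\<exists>x'\<in>{1, b', c}. x = \<alpha> x'" if "x \<in> A" for x using that unfolding a(4) a1 by blast
    have A\<beta>: "\<exists>y'\<in>{d, e, f}. y = \<beta> y'" if "y \<in> A" for y using that unfolding d(4) by blast
    have A\<gamma>: "\<gamma> m \<in> A \<longleftrightarrow> m \<in> set [g, h, i]" for m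
      unfolding g(4) inj_image_mem_iff[OF permutes_inj[OF p(3)]] by simp
    have \<gamma>eq: "\<gamma> m = \<gamma> n \<longleftrightarrow> m = n" for m n by (rule inj_eq[OF permutes_inj[OF p(3)]])
    note D = dP[unfolded division_sudoku_def, THEN conjunct2, THEN conjunct2, rule_format, OF A(1) A(1)]
    have "divided_by_triple rows175 [1, b', c] [d, e, f] [g, h, i]"
      unfolding divided_by_triple_def list_all_iff list_ex_iff set_digits
    proof (intro conjI ballI)
      fix n :: nat assume n: "n \<in> {1..9}"
      have n': "\<alpha> n \<in> {1..9}" "\<beta> n \<in> {1..9}" "\<gamma> n \<in> {1..9}" using n p
          by (simp_all only: permutes_in_image)
      obtain x y where "x \<in> A" "y \<in> A" "L x y = \<gamma> n"
        using D[THEN conjunct1, rule_format, OF n'(3)]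
            by (auto simp: band_def stack_def orthogonal_array_def)
      then obtain x' y' where xy: "x' \<in> {1, b', c}" "y' \<in> {d, e, f}" "L (\<alpha> x') (\<beta> y') = \<gamma> n"
        using A\<alpha> A\<beta> by metis
      have "L (\<alpha> x') (\<beta> y') = \<gamma> (cell rows175 x' y')" using xy(1,2) sub by (intro eq) blast+
      hence "cell rows175 x' y' = n" using xy(3) \<gamma>eq by simp
      thus "\<exists>x\<in>set [1, b', c]. \<exists>y\<in>set [d, e, f]. cell rows175 x y = n" using xy by auto
      obtain x where "x \<in> A" "L x (\<beta> n) \<in> A"
        using D[THEN conjunct2, THEN conjunct1, rule_format, OF n'(2)]
            by (auto simp: band_def pile_def orthogonal_array_def)
      then obtain x' where x: "x' \<in> {1, b', c}" "L (\<alpha> x') (\<beta> n) \<in> A" using A\<alpha> by metis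
      have "L (\<alpha> x') (\<beta> n) = \<gamma> (cell rows175 x' n)" using x(1) sub n by (intro eq) blast+
      hence "cell rows175 x' n \<in> set [g, h, i]" using x(2) A\<gamma> by simp
      thus "\<exists>x\<in>set [1, b', c]. cell rows175 x n \<in> set [g, h, i]" using x(1) by auto
      obtain y where "y \<in> A" "L (\<alpha> n) y \<in> A"
        using D[THEN conjunct2, THEN conjunct2, rule_format, OF n'(1)]
            by (auto simp: stack_def pile_def orthogonal_array_def)
      then obtain y' where y: "y' \<in> {d, e, f}" "L (\<alpha> n) (\<beta> y') \<in> A" using A\<beta> by metis
      have "L (\<alpha> n) (\<beta> y') = \<gamma> (cell rows175 n y')" using y(1) sub n by (intro eq) blast+
      hence "cell rows175 n y' \<in> set [g, h, i]" using y(2) A\<gamma> by simp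
      thus "\<exists>y\<in>set [d, e, f]. cell rows175 n y \<in> set [g, h, i]" using y(1) by auto
    qed
    moreover have "[d, e, f] \<in> set transversals" "[g, h, i] \<in> set transversals"
        by (rule in_transversals[OF d(1-3)], rule in_transversals[OF g(1-3)])
    moreover have "b' \<in> set [4,5,6]" "c \<in> set [7,8,9]" using a(2,3) by auto
    ultimately have "(b', c) \<in> set [(4,7),(6,8)]"
        using bspec[OF bspec[OF row_triples_175[unfolded list_all_iff]]] by meson
    thus ?thesis unfolding A_def[symmetric] a(4) a1 by auto
  qed
  hence "(\<lambda>P. block_at P (\<alpha> 1)) ` division_partitions L \<subseteq> {\<alpha> ` {1,2,3}, \<alpha> ` {1,4,7}, \<alpha> ` {1,6,8}}"
      by blast
  hence "card ((\<lambda>P. block_at P (\<alpha> 1)) ` division_partitions L) \<le> card {\<alpha> ` {1,2,3}, \<alpha> ` {1,4,7},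
      \<alpha> ` {1,6,8}}"
    by (intro card_mono) auto
  also have "\<dots> \<le> 3" by (simp add: card_insert_if)
  finally show ?thesis using card_image[OF inj_on_block_at[OF \<alpha>1]] by (simp add: sigma_eq)
qed

text \<open>
  The four parallel classes of the affine plane of order three whose points are numbered line by
  line; the first is the standard partition.
\<close>

definition line_partitions :: "nat list list list" where
  "line_partitions = [[[1,2,3],[4,5,6],[7,8,9]], [[1,4,7],[2,5,8],[3,6,9]],
      [[1,6,8],[2,4,9],[3,5,7]], [[1,5,9],[2,6,7],[3,4,8]]]"

definition as_partition :: "nat list list \<Rightarrow> nat set set" where "as_partition blocks =
    set (map set blocks)"

lemma sudoku_partition_of_blocks:
  assumes "distinct [a,b,c,d,e,f,g,h,i]" "set [a,b,c,d,e,f,g,h,i] = {1..9}"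
  shows "sudoku_partition {{a,b,c},{d,e,f},{g,h,i}}"
proof -
  have "partition_on {1..9} {{a,b,c},{d,e,f},{g,h,i}}"
    unfolding assms(2)[symmetric] by (rule partition_onI) (use assms(1) in \<open>auto simp: disjnt_def\<close>)
  moreover have "{a,b,c} \<noteq> {d,e,f}" "{a,b,c} \<noteq> {g,h,i}" "{d,e,f} \<noteq> {g,h,i}" using assms(1) by auto
  ultimately show ?thesis using assms(1) by (simp add: sudoku_partition_def)
qed

lemma line_partitions_sudoku: "blocks \<in> set line_partitions \<Longrightarrow> sudoku_partition (as_partition blocks)"
  unfolding line_partitions_def as_partition_def
  by (auto intro!: sudoku_partition_of_blocks)

text \<open>
  The blocks through 1 differ in the second point of the line: the points 2, 4, 6 and 5 tell the four
  partitions apart.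
\<close>

lemma line_partitions_distinct: "distinct (map as_partition line_partitions)"
proof -
  have ne: "P \<noteq> Q" if "(\<exists>A\<in>P. 1 \<in> A \<and> n \<in> A) \<noteq> (\<exists>A\<in>Q. 1 \<in> A \<and> n \<in> A)"
      for P Q :: "nat set set" and n using that by blast
  show ?thesis unfolding line_partitions_def as_partition_def
    by (simp, intro conjI; (rule ne[where n = 2], simp; fail | rule ne[where n =
        4], simp; fail | rule ne[where n = 6], simp; fail))
qed

lemma sigma_ge:
  assumes "latin_rows rows" "list_all (divided_rows rows) (take n line_partitions)" "n \<le> 4"
  shows "n \<le> sigma (array_of_rows rows)"
proof -
  let ?S = "set (map as_partition (take n line_partitions))"
  have "card ?S = length (map as_partition (take n line_partitions))"
    by (rule distinct_card) (unfold take_map[symmetric], rule distinct_take[OF line_partitions_distinct])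
  hence "card ?S = n" using assms(3) by (simp add: line_partitions_def)
  moreover have "?S \<subseteq> division_partitions (array_of_rows rows)"
  proof
    fix P assume "P \<in> ?S"
    then obtain blocks where b: "blocks \<in> set (take n line_partitions)" "P = as_partition blocks" by auto
    have "division_sudoku (as_partition blocks) (array_of_rows rows)"
      using division_sudoku_rows[OF assms(1), of blocks] line_partitions_sudoku[OF in_set_takeD[OF
          b(1)]] b(1) assms(2)
      by (simp add: as_partition_def list_all_iff)
    thus "P \<in> division_partitions (array_of_rows rows)" by (simp add: division_partitions_def b(2))
  qed
  ultimately show ?thesis using card_mono[OF finite_division_partitions] sigma_eq by metis
qed

lemma standard_blocks: "as_partition [[1,2,3],[4,5,6],[7,8,9]] = standard_partition"
  by (simp add: as_partition_def standard_partition_def)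

lemma standard_if_divided_rows:
  assumes "latin_rows rows" "divided_rows rows [[1,2,3],[4,5,6],[7,8,9]]"
  shows "array_of_rows rows \<in> standard_division_sudokus"
  using division_sudoku_rows[OF assms] line_partitions_sudoku[of "[[1,2,3],[4,5,6],[7,8,9]]"]
  unfolding standard_division_sudokus_def standard_blocks[symmetric]
      by (simp add: as_partition_def line_partitions_def)

lemma entry_nth: "\<exists>n\<in>{1..9}. \<forall>xs. entry xs z = xs ! (n - 1)"
  by (cases z) (rule bexI[of _ "3 * f3_nat (fst z) + f3_nat (snd z) + 1"], auto simp: f3_nat_def)

lemma nth_entry:
  assumes "n \<in> {1..9}"
  shows "\<exists>z. \<forall>xs. entry xs z = xs ! (n - 1)"
proof -
  obtain z where z: "n - 1 = 3 * f3_nat (fst z) + f3_nat (snd z)"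
  proof
    show "n - 1 = 3 * f3_nat (fst (points ! (n - 1))) + f3_nat (snd (points ! (n - 1)))"
      using assms unfolding interval_1_9 by (elim insertE emptyE) (simp_all add: points_eq)
  qed
  show ?thesis unfolding z by (intro exI[of _ z]) (cases z, simp)
qed

definition rows_isotopic :: "nat list list \<Rightarrow> nat list list \<Rightarrow> nat list \<times> nat list \<times> nat list \<Rightarrow> bool" where
  "rows_isotopic rows rows' cert \<longleftrightarrow> (case cert of (as, bs, cs) \<Rightarrow> block_list as \<and> block_list bs \<and>
      block_list cs \<and>
     list_all (\<lambda>x. list_all (\<lambda>y. cell rows' (as ! (x - 1)) (bs ! (y - 1)) =
         cs ! (cell rows x y - 1)) digits) digits)"

lemma rows_isotopic_sound:
  assumes latin: "latin_rows rows" and iso: "rows_isotopic rows rows' cert"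
  shows "ds_isotopic (array_of_rows rows) (array_of_rows rows')"
proof -
  obtain as bs cs where cert: "cert = (as, bs, cs)" by (cases cert)
  note iso' = iso[unfolded rows_isotopic_def cert prod.case list_all_iff set_digits]
  have bl: "block_list as" "block_list bs" "block_list cs" using iso' by blast+
  have dig: "block_list digits" by code_simp
  note lab = block_list_labelling[OF dig] bl[THEN block_list_labelling]
  have rng: "entry digits x \<in> {1..9}" "entry as x \<in> {1..9}" "entry bs x \<in> {1..9}" for x
    using lab unfolding block_labelling_def by (metis UNIV_I bij_betwE)+
  have digit: "digits ! (n - 1) = n" if "n \<in> {1..9}" for n
    using that unfolding interval_1_9 digits_def by auto
  show ?thesis
  proof (rule ds_isotopicI[OF lab(1) lab(1) lab(1) lab(2-4)])
    fix x y
    obtain m where m: "m \<in> {1..9}" "\<forall>xs::nat list. entry xs x = xs ! (m - 1)" using entry_nth by blast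
    obtain n where n: "n \<in> {1..9}" "\<forall>xs::nat list. entry xs y = xs ! (n - 1)" using entry_nth by blast
    have c: "cell rows m n \<in> {1..9}" using latin m(1) n(1)
        unfolding latin_rows_def list_all_iff set_digits by blast
    obtain z where z: "\<forall>xs::nat list. entry xs z = xs ! (cell rows m n - 1)" using nth_entry[OF c]
        by blast
    have "cell rows' (as ! (m - 1)) (bs ! (n - 1)) = cs ! (cell rows m n - 1)"
        using iso' m(1) n(1) by blast
    hence "array_of_rows rows (entry digits x) (entry digits y) = entry digits z \<and>
      array_of_rows rows' (entry as x) (entry bs y) = entry cs z"
      unfolding array_of_rows_cell[OF rng(1) rng(1)] array_of_rows_cell[OF rng(2,3)]
          by (simp only: m n z digit[OF m(1)] digit[OF n(1)] digit[OF c] simp_thms)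
    thus "\<exists>z. array_of_rows rows (entry digits x) (entry digits y) = entry digits z \<and>
      array_of_rows rows' (entry as x) (entry bs y) = entry cs z" ..
  qed
qed

lemma sigma_classI:
  assumes W: "latin_rows W" "list_all (divided_rows W) (take n line_partitions)" "1 \<le> n" "n \<le> 4"
    and R: "latin_rows R" "divided_rows R [[1,2,3],[4,5,6],[7,8,9]]"
    and iso: "rows_isotopic W R cert"
    and le: "\<And>L. L \<in> ds_class (array_of_rows R) \<Longrightarrow> sigma L \<le> n"
  shows "sigma_class (ds_class (array_of_rows R)) = n"
proof -
  have "divided_rows W [[1,2,3],[4,5,6],[7,8,9]]" using W(2,3)
      by (cases n) (auto simp: line_partitions_def)
  hence "array_of_rows W \<in> standard_division_sudokus" using W(1) by (intro standard_if_divided_rows)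
  moreover have "array_of_rows R \<in> standard_division_sudokus" using R by (intro standard_if_divided_rows)
  moreover have "ds_isotopic (array_of_rows R) (array_of_rows W)"
      by (rule ds_isotopic_sym[OF rows_isotopic_sound[OF W(1) iso]])
  ultimately have mem: "array_of_rows W \<in> ds_class (array_of_rows R)"
      by (simp add: ds_class_def ds_isotopism_def)
  have "sigma (array_of_rows W) = n" using le[OF mem] sigma_ge[OF W(1,2,4)] by simp
  moreover have "finite (sigma ` ds_class (array_of_rows R))"
      by (rule finite_subset[of _ "{..n}"]) (use le in auto)
  ultimately show ?thesis unfolding sigma_class_def using le mem by (intro Max_eqI) auto
qed

lemma latin_rows_explicit: "latin_rows rows17" "latin_rows rows175" "latin_rows rows179"
  "latin_rows witness17" "latin_rows witness175" "latin_rows witness179" by code_simp+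

lemma divided_rows_explicit: "divided_rows rows17 [[1,2,3],[4,5,6],[7,8,9]]"
    "divided_rows rows175 [[1,2,3],[4,5,6],[7,8,9]]"
  "divided_rows rows179 [[1,2,3],[4,5,6],[7,8,9]]" by code_simp+

lemma divided_rows_witness: "list_all (divided_rows witness17) (take 4 line_partitions)"
  "list_all (divided_rows witness175) (take 3 line_partitions)"
  "list_all (divided_rows witness179) (take 4 line_partitions)" by code_simp+

lemma witness_isotopic:
  "rows_isotopic witness17 rows17 ([1, 2, 3, 9, 7, 8, 5, 6, 4], [1, 2, 3, 4, 5, 6, 7, 8, 9], [1, 2,
      3, 6, 4, 5, 8, 9, 7])"
  "rows_isotopic witness175 rows175 ([7, 9, 8, 3, 2, 1, 5, 4, 6], [1, 3, 2, 8, 7, 9, 4, 6, 5], [3,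
      2, 1, 5, 4, 6, 8, 7, 9])"
  "rows_isotopic witness179 rows179 ([2, 1, 3, 8, 7, 9, 4, 6, 5], [1, 3, 2, 4, 6, 5, 9, 8, 7], [8,
      7, 9, 6, 5, 4, 3, 2, 1])"
  by code_simp+

text \<open>
  A second partition of a square of the class would place the square in one of the three excluded
  classes.
\<close>

lemma other_classes_sigma:
  assumes C: "C \<in> ds_isotopism_classes" and ne: "C \<notin> {ds_class DS_9_17, ds_class DS_9_175,
      ds_class DS_9_179}"
  shows "sigma_class C = 1"
proof -
  have "sigma L = 1" if LC: "L \<in> C" for L
  proof -
    have std: "division_sudoku standard_partition L"
      using LC C in_quotient_imp_subset[OF equiv_ds_isotopism]
          unfolding ds_isotopism_classes_def standard_division_sudokus_def by blast
    have "Q = standard_partition" if Q: "division_sudoku Q L" for Q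
    proof (rule ccontr)
      assume "Q \<noteq> standard_partition"
      then obtain M where M: "M \<in> {DS_9_17, DS_9_175, DS_9_179}" "ds_isotopic L M"
          using two_partitions_isotopic[OF std Q] by blast
      have "M \<in> standard_division_sudokus"
        using M(1) standard_if_divided_rows[OF latin_rows_explicit(1) divided_rows_explicit(1)]
          standard_if_divided_rows[OF latin_rows_explicit(2) divided_rows_explicit(2)]
          standard_if_divided_rows[OF latin_rows_explicit(3) divided_rows_explicit(3)]
              unfolding DS_rows by blast
      hence LM: "(L, M) \<in> ds_isotopism" using M(2) std
          by (simp add: ds_isotopism_def standard_division_sudokus_def)
      obtain X where X: "C = ds_isotopism `` {X}" using C unfolding ds_isotopism_classes_def
          by (rule quotientE)
      hence "(X, L) \<in> ds_isotopism" using LC by simp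
      hence "C = ds_isotopism `` {L}" unfolding X by (rule equiv_class_eq[OF equiv_ds_isotopism])
      also have "\<dots> = ds_class M" unfolding ds_class_def
          by (rule equiv_class_eq[OF equiv_ds_isotopism LM])
      finally show False using ne M(1) by blast
    qed
    hence "division_partitions L = {standard_partition}" using std
        by (auto simp: division_partitions_def)
    thus ?thesis by (simp add: sigma_eq)
  qed
  moreover have "C \<noteq> {}" using C in_quotient_imp_non_empty[OF equiv_ds_isotopism]
      by (simp add: ds_isotopism_classes_def)
  ultimately have "sigma ` C = {1}" by force
  thus ?thesis by (simp add: sigma_class_def)
qed

theorem proposition5p4:
  shows "sigma_class (ds_class DS_9_17) = 4 \<and>
         sigma_class (ds_class DS_9_175) = 3 \<and>
         sigma_class (ds_class DS_9_179) = 4 \<and>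
         (\<forall>C \<in> ds_isotopism_classes -
                 {ds_class DS_9_17, ds_class DS_9_175, ds_class DS_9_179}.
            sigma_class C = 1)"
proof (intro conjI ballI)
  show "sigma_class (ds_class DS_9_17) = 4" unfolding DS_rows
    by (rule sigma_classI[OF latin_rows_explicit(4) divided_rows_witness(1) _ _
        latin_rows_explicit(1) divided_rows_explicit(1) witness_isotopic(1)])
      (simp_all add: sigma_le_4)
  show "sigma_class (ds_class DS_9_179) = 4" unfolding DS_rows
    by (rule sigma_classI[OF latin_rows_explicit(6) divided_rows_witness(3) _ _
        latin_rows_explicit(3) divided_rows_explicit(3) witness_isotopic(3)])
      (simp_all add: sigma_le_4)
  have le3: "sigma L \<le> 3" if "L \<in> ds_class (array_of_rows rows175)" for L
    using that by (intro sigma_175_le_3) (auto simp: ds_class_def ds_isotopism_def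
        standard_division_sudokus_def DS_rows)
  show "sigma_class (ds_class DS_9_175) = 3" unfolding DS_rows
    by (rule sigma_classI[OF latin_rows_explicit(5) divided_rows_witness(2) _ _
        latin_rows_explicit(2) divided_rows_explicit(2) witness_isotopic(2) le3]) simp_all
qed (use other_classes_sigma in blast)

end
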